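(* Let $\Gamma_1$ and $\Gamma_2$ be finite simple graphs such that the right-angled Artin groups $A_{\Gamma_1}$ and $A_{\Gamma_2}$ are noncyclic and have finite outer automorphism groups $\mathrm{Out}(A_{\Gamma_1})$ and $\mathrm{Out}(A_{\Gamma_2})$. Let $\Gamma = \Gamma_1 \sqcup \Gamma_2$ be the disjoint union of the two graphs and let $\Delta = \Gamma_1 \star \Gamma_2$ be their join. Then $\mathrm{Out}(A_\Gamma)$ has a finite-index subgroup isomorphic to the right-angled Artin group $A_{\Gamma_1} \oplus A_{\Gamma_2} \cong A_\Delta$.
   Context: For a finite simple graph $\Gamma$ (no loops, no double edges) with vertex set $V(\Gamma)$, the right-angled Artin group determined by $\Gamma$ is the group with presentation $$A_\Gamma = \langle v \in V(\Gamma) \mid vw = wv \text{ whenever } v \text{ and } w \text{ span an edge in } \Gamma\rangle.$$ $\mathrm{Out}(G)$ denotes the quotient of $\mathrm{Aut}(G)$ by the subgroup of inner automorphisms. The join $\Gamma_1 \star \Gamma_2$ is the graph obtained from the disjoint union $\Gamma_1\sqcup\Gamma_2$ by adding an edge between every vertex of $\Gamma_1$ and every vertex of $\Gamma_2$. The symbol $\oplus$ denotes the direct product of groups. The trivial group counts as cyclic. *)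

theory Defs
  imports
    "Graph_Theory.Pair_Digraph"
    "HOL-Algebra.Elementary_Groups"
    "HOL-Algebra.Group_Action"
begin

section \<open>Group presentations\<close>

text \<open>
  Words are lists of letters; the letter \<open>(s, True)\<close> stands for the generator \<open>s\<close> and
  \<open>(s, False)\<close> for its formal inverse.
\<close>

type_synonym 'a word = "('a \<times> bool) list"

definition words :: "'a set \<Rightarrow> 'a word set" where
  "words S = lists (S \<times> UNIV)"

text \<open>
  The least congruence on the monoid of words over \<open>S\<close> that cancels inverse letters and
  identifies the two sides of every relation in \<open>R\<close>; a pair \<open>(u, v) \<in> R\<close> is
  read as the relation \<open>u = v\<close>.
\<close>

inductive_set pres_rel :: "'a set \<Rightarrow> ('a word \<times> 'a word) set \<Rightarrow> ('a word \<times> 'a word) set"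
  for S :: "'a set" and R :: "('a word \<times> 'a word) set" where
  refl: "u \<in> words S \<Longrightarrow> (u, u) \<in> pres_rel S R"
| sym: "(u, v) \<in> pres_rel S R \<Longrightarrow> (v, u) \<in> pres_rel S R"
| trans: "(u, v) \<in> pres_rel S R \<Longrightarrow> (v, w) \<in> pres_rel S R \<Longrightarrow> (u, w) \<in> pres_rel S R"
| append: "(u, u') \<in> pres_rel S R \<Longrightarrow> (v, v') \<in> pres_rel S R \<Longrightarrow> (u @ v, u' @ v') \<in> pres_rel S R"
| cancel: "s \<in> S \<Longrightarrow> ([(s, b), (s, \<not> b)], []) \<in> pres_rel S R"
| relation: "(u, v) \<in> R \<Longrightarrow> u \<in> words S \<Longrightarrow> v \<in> words S \<Longrightarrow> (u, v) \<in> pres_rel S R"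

definition presented_group :: "'a set \<Rightarrow> ('a word \<times> 'a word) set \<Rightarrow> 'a word set monoid" where
  "presented_group S R =
    \<lparr>carrier = words S // pres_rel S R,
     mult = \<lambda>A B. \<Union>u\<in>A. \<Union>v\<in>B. pres_rel S R `` {u @ v},
     one = pres_rel S R `` {[]}\<rparr>"

lemma pres_rel_words: "(u, v) \<in> pres_rel S R \<Longrightarrow> u \<in> words S \<and> v \<in> words S"
  by (induction rule: pres_rel.induct) (auto simp: words_def)

lemma equiv_pres_rel: "equiv (words S) (pres_rel S R)"
  by (rule equivI)
    (auto simp: refl_on_def intro!: symI transI dest: pres_rel_words
      intro: pres_rel.refl pres_rel.sym pres_rel.trans)

lemma mult_presented_group:
  assumes "u \<in> words S" "v \<in> words S"
  shows "(pres_rel S R `` {u}) \<otimes>\<^bsub>presented_group S R\<^esub> (pres_rel S R `` {v}) = pres_rel S R `` {u @ v}"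
  using assms unfolding presented_group_def
  by (auto intro: pres_rel.refl pres_rel.sym pres_rel.trans pres_rel.append)

lemma inverse_word:
  assumes "u \<in> words S"
  shows "(map (\<lambda>(s, b). (s, \<not> b)) (rev u) @ u, []) \<in> pres_rel S R"
  using assms
proof (induction u)
  case Nil
  show ?case by (auto simp: words_def intro: pres_rel.refl)
next
  case (Cons x u)
  obtain s b where x: "x = (s, b)" by force
  let ?v = "map (\<lambda>(s, b). (s, \<not> b)) (rev u)"
  have u: "u \<in> words S" and s: "s \<in> S" and v: "?v \<in> words S"
    using Cons.prems x by (auto simp: words_def)
  have "([(s, \<not> b), (s, b)], []) \<in> pres_rel S R"
    using pres_rel.cancel[OF s, of "\<not> b"] by simp
  then have "(?v @ [(s, \<not> b), (s, b)] @ u, ?v @ [] @ u) \<in> pres_rel S R"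
    by (intro pres_rel.append pres_rel.refl u v)
  then have "(?v @ [(s, \<not> b), (s, b)] @ u, []) \<in> pres_rel S R"
    using Cons.IH[OF u] by (auto intro: pres_rel.trans)
  then show ?case by (simp add: x)
qed

theorem group_presented_group: "group (presented_group S R)"
proof (rule groupI)
  let ?G = "presented_group S R"
  have elem: "\<exists>u\<in>words S. A = pres_rel S R `` {u}" if "A \<in> carrier ?G" for A
    using that by (auto simp: presented_group_def elim: quotientE)
  have cls: "pres_rel S R `` {u} \<in> carrier ?G" if "u \<in> words S" for u
    using that by (auto simp: presented_group_def intro: quotientI)
  have one: "\<one>\<^bsub>?G\<^esub> = pres_rel S R `` {[]}" by (simp add: presented_group_def)
  have nil: "[] \<in> words S" by (simp add: words_def)
  have app: "u @ v \<in> words S" if "u \<in> words S" "v \<in> words S" for u v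
    using that by (simp add: words_def)
  show "\<one>\<^bsub>?G\<^esub> \<in> carrier ?G" using cls[OF nil] one by simp
  show "A \<otimes>\<^bsub>?G\<^esub> B \<in> carrier ?G" if "A \<in> carrier ?G" "B \<in> carrier ?G" for A B
    using elem[OF that(1)] elem[OF that(2)] cls app mult_presented_group by metis
  show "A \<otimes>\<^bsub>?G\<^esub> B \<otimes>\<^bsub>?G\<^esub> C = A \<otimes>\<^bsub>?G\<^esub> (B \<otimes>\<^bsub>?G\<^esub> C)"
    if "A \<in> carrier ?G" "B \<in> carrier ?G" "C \<in> carrier ?G" for A B C
    using elem[OF that(1)] elem[OF that(2)] elem[OF that(3)]
    by (auto simp: mult_presented_group app)
  show "\<one>\<^bsub>?G\<^esub> \<otimes>\<^bsub>?G\<^esub> A = A" if "A \<in> carrier ?G" for A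
    using elem[OF that] by (auto simp only: one mult_presented_group nil append_Nil)
  show "\<exists>B\<in>carrier ?G. B \<otimes>\<^bsub>?G\<^esub> A = \<one>\<^bsub>?G\<^esub>" if A: "A \<in> carrier ?G" for A
  proof -
    obtain u where u: "u \<in> words S" "A = pres_rel S R `` {u}" using elem[OF A] by blast
    let ?v = "map (\<lambda>(s, b). (s, \<not> b)) (rev u)"
    have v: "?v \<in> words S" using u(1) by (auto simp: words_def)
    have "pres_rel S R `` {?v} \<otimes>\<^bsub>?G\<^esub> A = \<one>\<^bsub>?G\<^esub>"
      using equiv_class_eq[OF equiv_pres_rel inverse_word[OF u(1)]]
      by (simp only: u(2) mult_presented_group[OF v u(1)] one)
    then show ?thesis using cls[OF v] by blast
  qed
qed

section \<open>Right-angled Artin groups\<close>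

text \<open>
  A finite simple graph is a \<^locale>\<open>pair_graph\<close>: an edge spanned by \<open>v\<close> and \<open>w\<close> is
  the pair of arcs \<open>(v, w)\<close>, \<open>(w, v)\<close>.
\<close>

definition raag :: "'v pair_pre_digraph \<Rightarrow> 'v word set monoid" where
  "raag \<Gamma> = presented_group (pverts \<Gamma>)
    {([(v, True), (w, True)], [(w, True), (v, True)]) | v w. (v, w) \<in> parcs \<Gamma>}"

definition graph_disjoint_union ::
    "'a pair_pre_digraph \<Rightarrow> 'b pair_pre_digraph \<Rightarrow> ('a + 'b) pair_pre_digraph" where
  "graph_disjoint_union \<Gamma>1 \<Gamma>2 =
    \<lparr>pverts = pverts \<Gamma>1 <+> pverts \<Gamma>2,
     parcs = map_prod Inl Inl ` parcs \<Gamma>1 \<union> map_prod Inr Inr ` parcs \<Gamma>2\<rparr>"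

definition graph_join ::
    "'a pair_pre_digraph \<Rightarrow> 'b pair_pre_digraph \<Rightarrow> ('a + 'b) pair_pre_digraph" where
  "graph_join \<Gamma>1 \<Gamma>2 =
    \<lparr>pverts = pverts (graph_disjoint_union \<Gamma>1 \<Gamma>2),
     parcs = parcs (graph_disjoint_union \<Gamma>1 \<Gamma>2)
       \<union> (Inl ` pverts \<Gamma>1) \<times> (Inr ` pverts \<Gamma>2)
       \<union> (Inr ` pverts \<Gamma>2) \<times> (Inl ` pverts \<Gamma>1)\<rparr>"

lemma group_raag: "group (raag \<Gamma>)"
  by (simp add: raag_def group_presented_group)

lemma pair_graph_disjoint_union:
  assumes "pair_graph \<Gamma>1" "pair_graph \<Gamma>2"
  shows "pair_graph (graph_disjoint_union \<Gamma>1 \<Gamma>2)"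
proof -
  interpret G1: pair_graph \<Gamma>1 by fact
  interpret G2: pair_graph \<Gamma>2 by fact
  have "sym (parcs \<Gamma>1)" "sym (parcs \<Gamma>2)"
    using G1.sym_arcs G2.sym_arcs by (simp_all add: symmetric_def)
  then show ?thesis
    by unfold_locales
      (auto simp: graph_disjoint_union_def symmetric_def sym_def
        dest: G1.in_arcsD1 G1.in_arcsD2 G2.in_arcsD1 G2.in_arcsD2
          G1.no_loops' G2.no_loops')
qed

lemma pair_graph_join:
  assumes "pair_graph \<Gamma>1" "pair_graph \<Gamma>2"
  shows "pair_graph (graph_join \<Gamma>1 \<Gamma>2)"
proof -
  interpret G1: pair_graph \<Gamma>1 by fact
  interpret G2: pair_graph \<Gamma>2 by fact
  interpret U: pair_graph "graph_disjoint_union \<Gamma>1 \<Gamma>2"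
    using assms by (rule pair_graph_disjoint_union)
  have s: "sym (parcs (graph_disjoint_union \<Gamma>1 \<Gamma>2))"
    using U.sym_arcs by (simp add: symmetric_def)
  have v: "pverts (graph_disjoint_union \<Gamma>1 \<Gamma>2) = pverts \<Gamma>1 <+> pverts \<Gamma>2"
    by (simp add: graph_disjoint_union_def)
  show ?thesis
    by unfold_locales
      (use s U.in_arcsD1 U.in_arcsD2 U.no_loops' in
        \<open>fastforce simp: graph_join_def symmetric_def sym_def v\<close>)+
qed

section \<open>Outer automorphism groups\<close>

definition Inn :: "('a, 'b) monoid_scheme \<Rightarrow> ('a \<Rightarrow> 'a) set" where
  "Inn G = (\<lambda>g. \<lambda>x \<in> carrier G. g \<otimes>\<^bsub>G\<^esub> x \<otimes>\<^bsub>G\<^esub> inv\<^bsub>G\<^esub> g) ` carrier G"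

definition Out :: "('a, 'b) monoid_scheme \<Rightarrow> ('a \<Rightarrow> 'a) set monoid" where
  "Out G = AutoGroup G Mod Inn G"

lemma (in group) conj_in_auto:
  assumes "g \<in> carrier G"
  shows "(\<lambda>x \<in> carrier G. g \<otimes> x \<otimes> inv g) \<in> auto G"
proof -
  have "(\<lambda>x \<in> carrier G. g \<otimes> x \<otimes> inv g) \<in> Bij (carrier G)"
    using conjugation_is_hom assms by (auto simp: hom_def BijGroup_def)
  moreover have "g \<otimes> (x \<otimes> y) \<otimes> inv g = (g \<otimes> x \<otimes> inv g) \<otimes> (g \<otimes> y \<otimes> inv g)"
    if "x \<in> carrier G" "y \<in> carrier G" for x y
    using that assms by (simp add: m_assoc inv_solve_left)
  ultimately show ?thesis using assms by (auto simp: auto_def hom_def)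
qed

lemma (in group) Inn_normal: "Inn G \<lhd> AutoGroup G"
proof -
  interpret A: group "AutoGroup G" by (rule AutoGroup)
  have mult: "f \<otimes>\<^bsub>AutoGroup G\<^esub> h = compose (carrier G) f h" if "f \<in> auto G" "h \<in> auto G" for f h
    using that by (auto simp: AutoGroup_def BijGroup_def auto_def)
  have carr: "carrier (AutoGroup G) = auto G" by (simp add: AutoGroup_def)
  let ?c = "\<lambda>g. \<lambda>x \<in> carrier G. g \<otimes> x \<otimes> inv g"
  have "?c \<in> hom G (AutoGroup G)"
  proof (rule homI)
    fix x y assume x: "x \<in> carrier G" and y: "y \<in> carrier G"
    show "?c (x \<otimes> y) = ?c x \<otimes>\<^bsub>AutoGroup G\<^esub> ?c y"
      unfolding mult[OF conj_in_auto[OF x] conj_in_auto[OF y]]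
      using x y by (auto simp: compose_def fun_eq_iff m_assoc inv_mult_group)
  qed (auto simp: carr conj_in_auto)
  then interpret c: group_hom G "AutoGroup G" ?c
    by unfold_locales
  have sub: "subgroup (Inn G) (AutoGroup G)"
    using c.img_is_subgroup by (simp add: Inn_def)
  have "f \<otimes>\<^bsub>AutoGroup G\<^esub> h \<otimes>\<^bsub>AutoGroup G\<^esub> inv\<^bsub>AutoGroup G\<^esub> f \<in> Inn G"
    if f: "f \<in> carrier (AutoGroup G)" and h: "h \<in> Inn G" for f h
  proof -
    obtain g where g: "g \<in> carrier G" "h = ?c g" using h by (auto simp: Inn_def)
    have fa: "f \<in> auto G" using f carr by simp
    then interpret f: group_hom G G f by unfold_locales (simp add: auto_def)
    have fg: "f g \<in> carrier G" using g by simp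
    have h': "h \<in> auto G" using conj_in_auto g by simp
    have "f \<otimes>\<^bsub>AutoGroup G\<^esub> h = ?c (f g) \<otimes>\<^bsub>AutoGroup G\<^esub> f"
      unfolding mult[OF fa h'] mult[OF conj_in_auto[OF fg] fa]
      using g by (auto simp: compose_def fun_eq_iff)
    then have "f \<otimes>\<^bsub>AutoGroup G\<^esub> h \<otimes>\<^bsub>AutoGroup G\<^esub> inv\<^bsub>AutoGroup G\<^esub> f = ?c (f g)"
      using f c.hom_closed[OF fg] by (simp add: A.m_assoc)
    then show ?thesis using fg by (auto simp: Inn_def)
  qed
  then show ?thesis using sub by (simp add: A.normal_inv_iff)
qed

lemma (in group) group_Out: "group (Out G)"
  unfolding Out_def using Inn_normal by (rule normal.factorgroup_is_group)

end

theory Submission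
  imports Defs
begin

text \<open>
  \<open>A\<^bsub>\<Gamma>\<^esub>\<close> is the free product of \<open>A\<^sub>1 = A\<^bsub>\<Gamma>1\<^esub>\<close> and \<open>A\<^sub>2 = A\<^bsub>\<Gamma>2\<^esub>\<close>. Since \<open>Out A\<^sub>i\<close> is finite and \<open>A\<^sub>i\<close> is noncyclic,
  no transvection or partial conjugation has infinite order in \<open>Out A\<^sub>i\<close>; hence \<open>\<Gamma>i\<close> is connected and no
  vertex is joined to all others, so that \<open>A\<^sub>i\<close> has trivial centre. In a free product, commuting
  elements that are independent lie in a common conjugate of a factor, so by connectedness every
  automorphism of \<open>A\<^bsub>\<Gamma>\<^esub>\<close> sends each factor onto a conjugate of a factor. If it does not exchange the two
  conjugacy classes, it preserves both factors up to an inner automorphism. So \<open>Aut A\<^sub>1 \<times> Aut A\<^sub>2\<close> has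
  index at most two in \<open>Out A\<^bsub>\<Gamma>\<^esub>\<close>, and the required subgroup is \<open>Inn A\<^sub>1 \<times> Inn A\<^sub>2 \<cong> A\<^sub>1 \<times> A\<^sub>2\<close>.
\<close>

section \<open>The universal property\<close>

text \<open>Elements are told apart by letting the group act. The universal property turns any
  family of permutations that commute along edges into an action, and the image of a single point is
  then computed. Three actions carry the argument: on the integers (nonadjacent vertices do not
  commute), on freely reduced words (the centre), and on alternating words (uniqueness of normal
  forms in the free product).

  Finiteness of \<open>Out\<close> enters in two ways. For the graphs it is a pigeonhole argument:
  an infinite family of automorphisms contains two that differ by an inner one. For the index it is
  a count: if an automorphism preserves both factors, its coset modulo the subgroup depends only on
  the outer classes of its two restrictions, and there are finitely many such pairs. The
  automorphisms that exchange the factors are absorbed by one translate.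

  Trivial centres are needed for the embedding: \<open>(a, b)\<close> acts by conjugation with
  \<open>a\<close> and \<open>b\<close> on the two factors, and this loses central elements.\<close>

definition raag_gen :: "'v pair_pre_digraph \<Rightarrow> 'v \<Rightarrow> 'v word set" where
  "raag_gen \<Gamma> v = pres_rel (pverts \<Gamma>)
    {([(v, True), (w, True)], [(w, True), (v, True)]) | v w. (v, w) \<in> parcs \<Gamma>} `` {[(v, True)]}"

definition eval_word :: "('g, 'c) monoid_scheme \<Rightarrow> ('v \<Rightarrow> 'g) \<Rightarrow> 'v word \<Rightarrow> 'g" where
  "eval_word H f u = foldr (\<lambda>(s, b) y. (if b then f s else inv\<^bsub>H\<^esub> f s) \<otimes>\<^bsub>H\<^esub> y) u \<one>\<^bsub>H\<^esub>"

definition respects_edges :: "'v pair_pre_digraph \<Rightarrow> ('g, 'c) monoid_scheme \<Rightarrow> ('v \<Rightarrow> 'g) \<Rightarrow> bool" where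
  "respects_edges \<Gamma> H f \<longleftrightarrow> f \<in> pverts \<Gamma> \<rightarrow> carrier H \<and>
    (\<forall>(v, w) \<in> parcs \<Gamma>. f v \<otimes>\<^bsub>H\<^esub> f w = f w \<otimes>\<^bsub>H\<^esub> f v)"

lemma respects_edgesI:
  assumes "\<And>v. v \<in> pverts \<Gamma> \<Longrightarrow> f v \<in> carrier H"
    and "\<And>v w. (v, w) \<in> parcs \<Gamma> \<Longrightarrow> f v \<otimes>\<^bsub>H\<^esub> f w = f w \<otimes>\<^bsub>H\<^esub> f v"
  shows "respects_edges \<Gamma> H f"
  using assms by (auto simp: respects_edges_def)

text \<open>The representative chosen by \<open>SOME\<close> is immaterial once \<open>f\<close>
  respects the edges. The restriction to the carrier makes the map extensional, which membership in
  \<open>auto\<close> demands.\<close>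

definition raag_lift :: "'v pair_pre_digraph \<Rightarrow> ('g, 'c) monoid_scheme \<Rightarrow> ('v \<Rightarrow> 'g) \<Rightarrow> 'v word set \<Rightarrow> 'g" where
  "raag_lift \<Gamma> H f = (\<lambda>X \<in> carrier (raag \<Gamma>). eval_word H f (SOME u. u \<in> X))"

lemma (in group) eval_word_closed:
  "f \<in> S \<rightarrow> carrier G \<Longrightarrow> u \<in> words S \<Longrightarrow> eval_word G f u \<in> carrier G"
  by (induction u) (auto simp: eval_word_def words_def Pi_iff)

lemma (in group) eval_word_append:
  "f \<in> S \<rightarrow> carrier G \<Longrightarrow> u \<in> words S \<Longrightarrow> v \<in> words S \<Longrightarrow>
    eval_word G f (u @ v) = eval_word G f u \<otimes> eval_word G f v"
proof (induction u)
  case Nil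
  then show ?case using eval_word_closed[of f S v] by (simp add: eval_word_def)
next
  case (Cons a u)
  obtain s b where a: "a = (s, b)" by force
  have u: "u \<in> words S" and s: "s \<in> S" using Cons.prems a by (auto simp: words_def)
  have [simp]: "f s \<in> carrier G" using s Cons.prems by auto
  have [simp]: "eval_word G f u \<in> carrier G" "eval_word G f v \<in> carrier G"
    using eval_word_closed[of f S] u Cons.prems by auto
  have "eval_word G f (a # w) = (if b then f s else inv f s) \<otimes> eval_word G f w" for w
    by (simp add: eval_word_def a)
  then show ?case using Cons u by (simp add: m_assoc)
qed

lemma (in group) eval_word_respects:
  assumes f: "f \<in> S \<rightarrow> carrier G"
    and R: "\<And>u v. (u, v) \<in> R \<Longrightarrow> u \<in> words S \<Longrightarrow> v \<in> words S \<Longrightarrow> eval_word G f u = eval_word G f v"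
    and uv: "(u, v) \<in> pres_rel S R"
  shows "eval_word G f u = eval_word G f v"
  using uv
proof (induction rule: pres_rel.induct)
  case (append u u' v v')
  then show ?case using eval_word_append[OF f] pres_rel_words by metis
next
  case (cancel s b)
  then have "f s \<in> carrier G" using f by auto
  then show ?case by (simp add: eval_word_def)
qed (auto intro: R)

context
  fixes \<Gamma> :: "'v pair_pre_digraph"
begin

private abbreviation "rel \<equiv> pres_rel (pverts \<Gamma>)
    {([(v, True), (w, True)], [(w, True), (v, True)]) | v w. (v, w) \<in> parcs \<Gamma>}"

lemma raag_gen_closed [simp]: "v \<in> pverts \<Gamma> \<Longrightarrow> raag_gen \<Gamma> v \<in> carrier (raag \<Gamma>)"
  by (auto simp: raag_gen_def raag_def presented_group_def words_def intro!: quotientI)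

private lemma raag_mult:
  "u \<in> words (pverts \<Gamma>) \<Longrightarrow> v \<in> words (pverts \<Gamma>) \<Longrightarrow>
    (rel `` {u}) \<otimes>\<^bsub>raag \<Gamma>\<^esub> (rel `` {v}) = rel `` {u @ v}"
  unfolding raag_def by (rule mult_presented_group)

private lemma raag_one: "\<one>\<^bsub>raag \<Gamma>\<^esub> = rel `` {[]}"
  by (simp add: raag_def presented_group_def)

private lemma raag_elem: "x \<in> carrier (raag \<Gamma>) \<Longrightarrow> \<exists>u\<in>words (pverts \<Gamma>). x = rel `` {u}"
  by (auto simp: raag_def presented_group_def elim: quotientE)

private lemma raag_cls: "u \<in> words (pverts \<Gamma>) \<Longrightarrow> rel `` {u} \<in> carrier (raag \<Gamma>)"
  by (auto simp: raag_def presented_group_def intro: quotientI)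

private lemma raag_inv_gen:
  assumes "v \<in> pverts \<Gamma>"
  shows "inv\<^bsub>raag \<Gamma>\<^esub> raag_gen \<Gamma> v = rel `` {[(v, False)]}"
proof -
  interpret group "raag \<Gamma>" by (rule group_raag)
  have w: "[(v, True)] \<in> words (pverts \<Gamma>)" "[(v, False)] \<in> words (pverts \<Gamma>)"
    using assms by (auto simp: words_def)
  have "([(v, False), (v, \<not> False)], []) \<in> rel"
    using assms by (rule pres_rel.cancel)
  then have "rel `` {[(v, False), (v, True)]} = rel `` {[]}"
    by (intro equiv_class_eq[OF equiv_pres_rel]) simp
  then have "rel `` {[(v, False)]} \<otimes>\<^bsub>raag \<Gamma>\<^esub> raag_gen \<Gamma> v = \<one>\<^bsub>raag \<Gamma>\<^esub>"
    using raag_mult[OF w(2) w(1)] by (simp add: raag_gen_def raag_one)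
  then show ?thesis
    using inv_equality[of "rel `` {[(v, False)]}" "raag_gen \<Gamma> v"] raag_cls[OF w(2)] assms by simp
qed

lemma raag_gen_commute:
  assumes "v \<in> pverts \<Gamma>" "w \<in> pverts \<Gamma>" "(v, w) \<in> parcs \<Gamma>"
  shows "raag_gen \<Gamma> v \<otimes>\<^bsub>raag \<Gamma>\<^esub> raag_gen \<Gamma> w = raag_gen \<Gamma> w \<otimes>\<^bsub>raag \<Gamma>\<^esub> raag_gen \<Gamma> v"
proof -
  have w: "[(v, True)] \<in> words (pverts \<Gamma>)" "[(w, True)] \<in> words (pverts \<Gamma>)"
    using assms by (auto simp: words_def)
  have "([(v, True), (w, True)], [(w, True), (v, True)]) \<in> rel"
    using assms by (intro pres_rel.relation) (auto simp: words_def)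
  then have "rel `` {[(v, True), (w, True)]} = rel `` {[(w, True), (v, True)]}"
    by (intro equiv_class_eq[OF equiv_pres_rel])
  then show ?thesis
    using raag_mult[OF w] raag_mult[OF w(2) w(1)] by (simp add: raag_gen_def)
qed

text \<open>Prepending a letter to a word multiplies its class by a generator or by the inverse of
  one, so later arguments need not choose representing words.\<close>

lemma raag_induct [consumes 1, case_names one gen inv]:
  assumes "x \<in> carrier (raag \<Gamma>)"
    and one: "P \<one>\<^bsub>raag \<Gamma>\<^esub>"
    and gen: "\<And>v x. v \<in> pverts \<Gamma> \<Longrightarrow> x \<in> carrier (raag \<Gamma>) \<Longrightarrow> P x \<Longrightarrow> P (raag_gen \<Gamma> v \<otimes>\<^bsub>raag \<Gamma>\<^esub> x)"
    and inv: "\<And>v x. v \<in> pverts \<Gamma> \<Longrightarrow> x \<in> carrier (raag \<Gamma>) \<Longrightarrow> P x \<Longrightarrow>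
      P (inv\<^bsub>raag \<Gamma>\<^esub> raag_gen \<Gamma> v \<otimes>\<^bsub>raag \<Gamma>\<^esub> x)"
  shows "P x"
proof -
  have "P (rel `` {u})" if "u \<in> words (pverts \<Gamma>)" for u
    using that
  proof (induction u)
    case Nil
    then show ?case using one by (simp add: raag_one)
  next
    case (Cons a u)
    obtain s b where a: "a = (s, b)" by force
    have u: "u \<in> words (pverts \<Gamma>)" and s: "s \<in> pverts \<Gamma>" and sb: "[(s, b)] \<in> words (pverts \<Gamma>)"
      using Cons.prems a by (auto simp: words_def)
    have "rel `` {a # u} = rel `` {[(s, b)]} \<otimes>\<^bsub>raag \<Gamma>\<^esub> rel `` {u}"
      using raag_mult[OF sb u] by (simp add: a)
    then show ?case
      using gen[OF s raag_cls[OF u]] inv[OF s raag_cls[OF u]] Cons.IH[OF u]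
      by (cases b) (simp_all add: raag_inv_gen[OF s], simp add: raag_gen_def)
  qed
  then show ?thesis using raag_elem[OF assms(1)] by auto
qed

context
  fixes H :: "('g, 'c) monoid_scheme" and f :: "'v \<Rightarrow> 'g"
  assumes H: "group H" and f: "respects_edges \<Gamma> H f"
begin

private lemma raag_lift_cls:
  assumes u: "u \<in> words (pverts \<Gamma>)"
  shows "raag_lift \<Gamma> H f (rel `` {u}) = eval_word H f u"
proof -
  interpret H: group H by (rule H)
  have "u \<in> rel `` {u}" using u by (auto intro: pres_rel.refl)
  then have "(SOME w. w \<in> rel `` {u}) \<in> rel `` {u}" by (rule someI)
  then have "(u, SOME w. w \<in> rel `` {u}) \<in> rel" by simp
  moreover have f': "f \<in> pverts \<Gamma> \<rightarrow> carrier H" using f by (simp add: respects_edges_def)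
  moreover have R: "eval_word H f p = eval_word H f q"
    if pq: "(p, q) \<in> {([(v, True), (w, True)], [(w, True), (v, True)]) | v w. (v, w) \<in> parcs \<Gamma>}"
      and w: "p \<in> words (pverts \<Gamma>)" "q \<in> words (pverts \<Gamma>)" for p q
  proof -
    obtain v w where *: "p = [(v, True), (w, True)]" "q = [(w, True), (v, True)]" "(v, w) \<in> parcs \<Gamma>"
      using pq by auto
    then have "f v \<in> carrier H" "f w \<in> carrier H" "f v \<otimes>\<^bsub>H\<^esub> f w = f w \<otimes>\<^bsub>H\<^esub> f v"
      using w f by (auto simp: respects_edges_def words_def)
    then show ?thesis by (simp add: * eval_word_def)
  qed
  ultimately have "eval_word H f u = eval_word H f (SOME w. w \<in> rel `` {u})"
    by (intro H.eval_word_respects[OF f' R])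
  then show ?thesis using raag_cls[OF u] by (simp add: raag_lift_def)
qed

lemma raag_lift_gen [simp]: "v \<in> pverts \<Gamma> \<Longrightarrow> raag_lift \<Gamma> H f (raag_gen \<Gamma> v) = f v"
proof -
  interpret H: group H by (rule H)
  assume v: "v \<in> pverts \<Gamma>"
  then have "f v \<in> carrier H" using f by (auto simp: respects_edges_def)
  then show ?thesis
    using raag_lift_cls[of "[(v, True)]"] v by (simp add: words_def eval_word_def raag_gen_def)
qed

lemma raag_lift_hom: "raag_lift \<Gamma> H f \<in> hom (raag \<Gamma>) H"
proof (rule homI)
  interpret H: group H by (rule H)
  have f': "f \<in> pverts \<Gamma> \<rightarrow> carrier H" using f by (simp add: respects_edges_def)
  show "raag_lift \<Gamma> H f x \<in> carrier H" if "x \<in> carrier (raag \<Gamma>)" for x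
    using raag_elem[OF that] H.eval_word_closed[OF f'] by (auto simp: raag_lift_cls)
  fix x y assume "x \<in> carrier (raag \<Gamma>)" "y \<in> carrier (raag \<Gamma>)"
  then obtain u v where uv: "u \<in> words (pverts \<Gamma>)" "v \<in> words (pverts \<Gamma>)" "x = rel `` {u}" "y = rel `` {v}"
    using raag_elem by blast
  moreover from uv have "u @ v \<in> words (pverts \<Gamma>)" by (simp add: words_def)
  ultimately show "raag_lift \<Gamma> H f (x \<otimes>\<^bsub>raag \<Gamma>\<^esub> y) = raag_lift \<Gamma> H f x \<otimes>\<^bsub>H\<^esub> raag_lift \<Gamma> H f y"
    using H.eval_word_append[OF f'] by (simp add: raag_mult raag_lift_cls)
qed

end

lemma raag_lift_extensional: "raag_lift \<Gamma> H f \<in> extensional (carrier (raag \<Gamma>))"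
  by (simp add: raag_lift_def)

lemma raag_hom_eqI:
  assumes H: "group H" and h: "h \<in> hom (raag \<Gamma>) H" "k \<in> hom (raag \<Gamma>) H"
    and eq: "\<And>v. v \<in> pverts \<Gamma> \<Longrightarrow> h (raag_gen \<Gamma> v) = k (raag_gen \<Gamma> v)"
    and x: "x \<in> carrier (raag \<Gamma>)"
  shows "h x = k x"
proof -
  interpret h: group_hom "raag \<Gamma>" H h
    using H h group_raag by (simp add: group_hom_def group_hom_axioms_def)
  interpret k: group_hom "raag \<Gamma>" H k
    using H h group_raag by (simp add: group_hom_def group_hom_axioms_def)
  show ?thesis using x by (induction rule: raag_induct) (simp_all add: eq)
qed

text \<open>This is the universal property with the group of bijections of \<open>N\<close> as
  target, where the maps \<open>p v\<close> satisfy the defining relations. The maps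
  \<open>n v\<close> witness bijectivity and describe the inverse generators. Elements that move
  some point differently are then distinct.\<close>

lemma raag_action:
  assumes mem: "\<And>v l. v \<in> pverts \<Gamma> \<Longrightarrow> l \<in> N \<Longrightarrow> p v l \<in> N \<and> n v l \<in> N"
    and inv: "\<And>v l. v \<in> pverts \<Gamma> \<Longrightarrow> l \<in> N \<Longrightarrow> p v (n v l) = l \<and> n v (p v l) = l"
    and comm: "\<And>v w l. (v, w) \<in> parcs \<Gamma> \<Longrightarrow> l \<in> N \<Longrightarrow> p v (p w l) = p w (p v l)"
    and arcs: "\<And>v w. (v, w) \<in> parcs \<Gamma> \<Longrightarrow> v \<in> pverts \<Gamma> \<and> w \<in> pverts \<Gamma>"
  obtains \<Phi> where
    "\<And>x l. x \<in> carrier (raag \<Gamma>) \<Longrightarrow> l \<in> N \<Longrightarrow> \<Phi> x l \<in> N"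
    "\<And>l. l \<in> N \<Longrightarrow> \<Phi> \<one>\<^bsub>raag \<Gamma>\<^esub> l = l"
    "\<And>x y l. x \<in> carrier (raag \<Gamma>) \<Longrightarrow> y \<in> carrier (raag \<Gamma>) \<Longrightarrow> l \<in> N \<Longrightarrow>
      \<Phi> (x \<otimes>\<^bsub>raag \<Gamma>\<^esub> y) l = \<Phi> x (\<Phi> y l)"
    "\<And>v l. v \<in> pverts \<Gamma> \<Longrightarrow> l \<in> N \<Longrightarrow> \<Phi> (raag_gen \<Gamma> v) l = p v l"
    "\<And>v l. v \<in> pverts \<Gamma> \<Longrightarrow> l \<in> N \<Longrightarrow> \<Phi> (inv\<^bsub>raag \<Gamma>\<^esub> raag_gen \<Gamma> v) l = n v l"
proof -
  interpret A: group "raag \<Gamma>" by (rule group_raag)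
  define f where "f v = restrict (p v) N" for v
  have bij: "f v \<in> Bij N" if v: "v \<in> pverts \<Gamma>" for v
    unfolding Bij_def f_def using mem[OF v] inv[OF v]
    by (auto simp: bij_betw_restrict_eq intro!: bij_betw_byWitness[where f' = "n v"])
  have mult: "(g \<otimes>\<^bsub>BijGroup N\<^esub> h) l = g (h l)" if "g \<in> Bij N" "h \<in> Bij N" "l \<in> N" for g h l
    using that by (simp add: BijGroup_def compose_def)
  have re: "respects_edges \<Gamma> (BijGroup N) f"
  proof (rule respects_edgesI)
    show "f v \<in> carrier (BijGroup N)" if "v \<in> pverts \<Gamma>" for v
      using bij[OF that] by (simp add: BijGroup_def)
    fix v w assume vw: "(v, w) \<in> parcs \<Gamma>"
    then have b: "f v \<in> Bij N" "f w \<in> Bij N" and v: "v \<in> pverts \<Gamma>" "w \<in> pverts \<Gamma>"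
      using arcs[OF vw] bij by auto
    have "compose N (f v) (f w) l = compose N (f w) (f v) l" for l
      using comm[OF vw] mem[OF v(1)] mem[OF v(2)] by (auto simp: compose_def f_def)
    then show "f v \<otimes>\<^bsub>BijGroup N\<^esub> f w = f w \<otimes>\<^bsub>BijGroup N\<^esub> f v"
      using b by (auto simp: BijGroup_def)
  qed
  obtain L where L: "L \<in> hom (raag \<Gamma>) (BijGroup N)"
    and Lgen: "\<And>v. v \<in> pverts \<Gamma> \<Longrightarrow> L (raag_gen \<Gamma> v) = f v"
    using raag_lift_hom[OF group_BijGroup re] raag_lift_gen[OF group_BijGroup re] by blast
  interpret L: group_hom "raag \<Gamma>" "BijGroup N" L
    using L group_raag group_BijGroup by (simp add: group_hom_def group_hom_axioms_def)
  have carr: "carrier (BijGroup N) = Bij N" by (simp add: BijGroup_def)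
  have cl: "L x \<in> Bij N" if "x \<in> carrier (raag \<Gamma>)" for x
    using L.hom_closed[OF that] unfolding carr .
  have one: "L \<one>\<^bsub>raag \<Gamma>\<^esub> l = l" if "l \<in> N" for l
    using that L.hom_one by (simp add: BijGroup_def)
  have app: "L (x \<otimes>\<^bsub>raag \<Gamma>\<^esub> y) l = L x (L y l)"
    if "x \<in> carrier (raag \<Gamma>)" "y \<in> carrier (raag \<Gamma>)" "l \<in> N" for x y l
    using that cl mult by simp
  have mem': "L x l \<in> N" if "x \<in> carrier (raag \<Gamma>)" "l \<in> N" for x l
    using cl[OF that(1)] that(2) Bij_imp_funcset by blast
  have gen: "L (raag_gen \<Gamma> v) l = p v l" if "v \<in> pverts \<Gamma>" "l \<in> N" for v l
    using that Lgen by (simp add: f_def)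
  have "L (inv\<^bsub>raag \<Gamma>\<^esub> raag_gen \<Gamma> v) l = n v l" if v: "v \<in> pverts \<Gamma>" and l: "l \<in> N" for v l
  proof -
    have "l = L (raag_gen \<Gamma> v) (n v l)"
      using gen[OF v] mem[OF v l] inv[OF v l] by simp
    then have "L (inv\<^bsub>raag \<Gamma>\<^esub> raag_gen \<Gamma> v) l = L (inv\<^bsub>raag \<Gamma>\<^esub> raag_gen \<Gamma> v \<otimes>\<^bsub>raag \<Gamma>\<^esub> raag_gen \<Gamma> v) (n v l)"
      using app[of "inv\<^bsub>raag \<Gamma>\<^esub> raag_gen \<Gamma> v" "raag_gen \<Gamma> v" "n v l"] mem[OF v l] v by simp
    then show ?thesis using v one mem[OF v l] by simp
  qed
  then show ?thesis using that[of L] mem' one app gen by blast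
qed

end

lemma pair_graph_arcsD:
  assumes "pair_graph \<Gamma>" "(v, w) \<in> parcs \<Gamma>"
  shows "v \<in> pverts \<Gamma>" "w \<in> pverts \<Gamma>" "v \<noteq> w" "(w, v) \<in> parcs \<Gamma>"
proof -
  interpret pair_graph \<Gamma> by fact
  show "v \<in> pverts \<Gamma>" "w \<in> pverts \<Gamma>" "v \<noteq> w" "(w, v) \<in> parcs \<Gamma>"
    using assms(2) in_arcsD1 in_arcsD2 no_loops' sym_arcs by (auto simp: symmetric_def dest: symD)
qed

lemma (in group) inv_mult_cancel [simp]:
  assumes "x \<in> carrier G" "y \<in> carrier G"
  shows "inv x \<otimes> (x \<otimes> y) = y" and "x \<otimes> (inv x \<otimes> y) = y"
  using assms by (simp_all flip: m_assoc)

lemma (in group) mult_commute_mult: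
  assumes "x \<in> carrier G" "y \<in> carrier G" "z \<in> carrier G" "x \<otimes> y = y \<otimes> x" "x \<otimes> z = z \<otimes> x"
  shows "x \<otimes> (y \<otimes> z) = (y \<otimes> z) \<otimes> x"
  using assms by (metis m_assoc)

section \<open>Automorphisms\<close>

lemma carrier_AutoGroup: "carrier (AutoGroup G) = auto G"
  by (simp add: AutoGroup_def)

lemma mult_AutoGroup:
  "f \<in> auto G \<Longrightarrow> h \<in> auto G \<Longrightarrow> f \<otimes>\<^bsub>AutoGroup G\<^esub> h = compose (carrier G) f h"
  by (auto simp: AutoGroup_def BijGroup_def auto_def)

lemma auto_closed: "f \<in> auto G \<Longrightarrow> x \<in> carrier G \<Longrightarrow> f x \<in> carrier G"
  by (auto simp: auto_def hom_def)

lemma auto_surj: "f \<in> auto G \<Longrightarrow> f ` carrier G = carrier G"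
  by (simp add: auto_def Bij_def bij_betw_def)

lemma auto_inj: "f \<in> auto G \<Longrightarrow> inj_on f (carrier G)"
  by (simp add: auto_def Bij_def bij_betw_def)

lemma auto_extensional: "f \<in> auto G \<Longrightarrow> f \<in> extensional (carrier G)"
  by (simp add: auto_def Bij_def)

lemma auto_hom: "f \<in> auto G \<Longrightarrow> f \<in> hom G G"
  by (simp add: auto_def)

lemma (in group) auto_group_hom: "f \<in> auto G \<Longrightarrow> group_hom G G f"
  by (simp add: group_hom_def group_hom_axioms_def auto_hom)

lemma autoI:
  assumes "f \<in> hom G G" "f \<in> extensional (carrier G)" "\<And>x. x \<in> carrier G \<Longrightarrow> h x \<in> carrier G"
    and "\<And>x. x \<in> carrier G \<Longrightarrow> f (h x) = x" "\<And>x. x \<in> carrier G \<Longrightarrow> h (f x) = x"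
  shows "f \<in> auto G"
proof -
  have "bij_betw f (carrier G) (carrier G)"
    using assms by (intro bij_betw_byWitness[where f' = h]) (auto simp: hom_def)
  then show ?thesis using assms by (simp add: auto_def Bij_def)
qed

lemma (in group) auto_inverse:
  assumes f: "f \<in> auto G"
  obtains h where "h \<in> auto G" "\<And>x. x \<in> carrier G \<Longrightarrow> h (f x) = x"
    "\<And>x. x \<in> carrier G \<Longrightarrow> f (h x) = x"
proof -
  interpret A: group "AutoGroup G" by (rule AutoGroup)
  define h where "h = inv\<^bsub>AutoGroup G\<^esub> f"
  have fA: "f \<in> carrier (AutoGroup G)" using f by (simp add: carrier_AutoGroup)
  then have h: "h \<in> auto G" using A.inv_closed[OF fA] by (simp add: h_def carrier_AutoGroup)
  have one: "\<one>\<^bsub>AutoGroup G\<^esub> = (\<lambda>x\<in>carrier G. x)" by (simp add: AutoGroup_def BijGroup_def)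
  have "compose (carrier G) h f = (\<lambda>x\<in>carrier G. x)" "compose (carrier G) f h = (\<lambda>x\<in>carrier G. x)"
    using A.l_inv[OF fA] A.r_inv[OF fA] mult_AutoGroup[OF f h] mult_AutoGroup[OF h f]
    by (simp_all add: one h_def)
  then have "h (f x) = x" "f (h x) = x" if "x \<in> carrier G" for x
    using that by (metis compose_eq restrict_apply')+
  then show ?thesis using that h by blast
qed

abbreviation Out_class :: "('a, 'b) monoid_scheme \<Rightarrow> ('a \<Rightarrow> 'a) \<Rightarrow> ('a \<Rightarrow> 'a) set" where
  "Out_class G f \<equiv> Inn G #>\<^bsub>AutoGroup G\<^esub> f"

lemma carrier_Out: "carrier (Out G) = Out_class G ` auto G"
  by (auto simp: Out_def FactGroup_def RCOSETS_def carrier_AutoGroup)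

lemma (in group) Out_mult:
  assumes "f \<in> auto G" "h \<in> auto G"
  shows "Out_class G f \<otimes>\<^bsub>Out G\<^esub> Out_class G h = Out_class G (compose (carrier G) f h)"
proof -
  interpret N: normal "Inn G" "AutoGroup G" by (rule Inn_normal)
  show ?thesis using N.rcos_sum[of f h] assms by (simp add: Out_def carrier_AutoGroup mult_AutoGroup)
qed

lemma (in group) compose_auto: "f \<in> auto G \<Longrightarrow> h \<in> auto G \<Longrightarrow> compose (carrier G) f h \<in> auto G"
  using group.is_monoid[OF AutoGroup] monoid.m_closed[of "AutoGroup G" f h]
  by (simp add: carrier_AutoGroup mult_AutoGroup)

text \<open>The coset of \<open>h\<close> consists of the composites of inner automorphisms with
  \<open>h\<close>. All maps involved are extensional, so equality is tested on the carrier.\<close>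

lemma (in group) Out_class_eq_iff:
  assumes f: "f \<in> auto G" and h: "h \<in> auto G"
  shows "Out_class G f = Out_class G h \<longleftrightarrow> (\<exists>g\<in>carrier G. \<forall>x\<in>carrier G. f x = g \<otimes> h x \<otimes> inv g)"
proof -
  interpret A: group "AutoGroup G" by (rule AutoGroup)
  interpret N: normal "Inn G" "AutoGroup G" by (rule Inn_normal)
  let ?c = "\<lambda>g. \<lambda>x \<in> carrier G. g \<otimes> x \<otimes> inv g"
  have fA: "f \<in> carrier (AutoGroup G)" and hA: "h \<in> carrier (AutoGroup G)"
    using f h by (simp_all add: carrier_AutoGroup)
  have "Out_class G f = Out_class G h \<longleftrightarrow> f \<in> Out_class G h"
    using A.repr_independence[of f "Inn G" h] A.rcos_self[of f "Inn G"] fA hA N.subgroup_axioms by metis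
  also have "\<dots> \<longleftrightarrow> (\<exists>g\<in>carrier G. f = ?c g \<otimes>\<^bsub>AutoGroup G\<^esub> h)"
    by (auto simp: r_coset_def Inn_def)
  also have "\<dots> \<longleftrightarrow> (\<exists>g\<in>carrier G. \<forall>x\<in>carrier G. f x = g \<otimes> h x \<otimes> inv g)"
  proof (rule bex_cong[OF HOL.refl])
    fix g assume g: "g \<in> carrier G"
    have "f = compose (carrier G) (?c g) h \<longleftrightarrow> (\<forall>x\<in>carrier G. f x = compose (carrier G) (?c g) h x)"
      using auto_extensional[OF f] by (metis compose_extensional extensionalityI)
    then show "f = ?c g \<otimes>\<^bsub>AutoGroup G\<^esub> h \<longleftrightarrow> (\<forall>x\<in>carrier G. f x = g \<otimes> h x \<otimes> inv g)"
      using mult_AutoGroup[OF conj_in_auto[OF g] h] auto_closed[OF h] by (simp add: compose_def)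
  qed
  finally show ?thesis .
qed

text \<open>Pigeonhole on outer classes. Equality of classes is symmetric, so the two indices can be
  ordered, and \<open>l - k\<close> is available as a positive exponent.\<close>

lemma (in group) finite_Out_family:
  fixes \<tau> :: "nat \<Rightarrow> 'a \<Rightarrow> 'a"
  assumes "finite (carrier (Out G))" and \<tau>: "\<And>k. \<tau> k \<in> auto G"
  obtains k l g where "k < l" "g \<in> carrier G" "\<And>x. x \<in> carrier G \<Longrightarrow> \<tau> l x = g \<otimes> \<tau> k x \<otimes> inv g"
proof -
  have "finite (range (\<lambda>k. Out_class G (\<tau> k)))"
    using \<tau> by (intro finite_subset[OF _ assms(1)]) (auto simp: carrier_Out)
  then have "\<not> inj (\<lambda>k. Out_class G (\<tau> k))"
    using finite_imageD infinite_UNIV_nat by blast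
  then obtain k l where "k \<noteq> l" "Out_class G (\<tau> k) = Out_class G (\<tau> l)"
    by (auto simp: inj_def)
  then have "\<exists>k l. k < l \<and> Out_class G (\<tau> l) = Out_class G (\<tau> k)"
    by (metis nat_neq_iff)
  then show ?thesis using Out_class_eq_iff[OF \<tau> \<tau>] that by metis
qed

text \<open>Both composites fix every generator and are therefore the identity, so an inverse has to
  be exhibited on vertices only.\<close>

lemma raag_autoI:
  assumes f: "respects_edges \<Gamma> (raag \<Gamma>) f" and h: "respects_edges \<Gamma> (raag \<Gamma>) h"
    and fh: "\<And>v. v \<in> pverts \<Gamma> \<Longrightarrow> raag_lift \<Gamma> (raag \<Gamma>) f (h v) = raag_gen \<Gamma> v"
    and hf: "\<And>v. v \<in> pverts \<Gamma> \<Longrightarrow> raag_lift \<Gamma> (raag \<Gamma>) h (f v) = raag_gen \<Gamma> v"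
  shows "raag_lift \<Gamma> (raag \<Gamma>) f \<in> auto (raag \<Gamma>)"
proof -
  let ?f = "raag_lift \<Gamma> (raag \<Gamma>) f" and ?h = "raag_lift \<Gamma> (raag \<Gamma>) h"
  have hom: "?f \<in> hom (raag \<Gamma>) (raag \<Gamma>)" "?h \<in> hom (raag \<Gamma>) (raag \<Gamma>)"
    using raag_lift_hom[OF group_raag] f h by auto
  have cancel: "k (k' x) = x"
    if k: "k \<in> hom (raag \<Gamma>) (raag \<Gamma>)" "k' \<in> hom (raag \<Gamma>) (raag \<Gamma>)"
      and x: "x \<in> carrier (raag \<Gamma>)"
      and gen: "\<And>v. v \<in> pverts \<Gamma> \<Longrightarrow> k (k' (raag_gen \<Gamma> v)) = raag_gen \<Gamma> v" for k k' x
  proof -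
    have c: "k \<circ> k' \<in> hom (raag \<Gamma>) (raag \<Gamma>)" using k by (auto intro: hom_compose)
    have i: "(\<lambda>x. x) \<in> hom (raag \<Gamma>) (raag \<Gamma>)" by (simp add: hom_def)
    have "(k \<circ> k') x = x"
      by (rule raag_hom_eqI[OF group_raag c i _ x]) (simp add: gen)
    then show ?thesis by simp
  qed
  have inv: "?f (?h x) = x" "?h (?f x) = x" if "x \<in> carrier (raag \<Gamma>)" for x
    using cancel[OF hom that] cancel[OF hom(2,1) that] fh hf raag_lift_gen[OF group_raag f]
      raag_lift_gen[OF group_raag h] by simp_all
  show ?thesis
    by (rule autoI[OF hom(1) raag_lift_extensional hom_in_carrier[OF hom(2)] inv])
qed

section \<open>Exponent sums and transvections\<close>

text \<open>One coordinate of the abelianisation. Being a homomorphism to an abelian group, it is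
  constant on conjugacy classes.\<close>

definition exponent_sum :: "'v pair_pre_digraph \<Rightarrow> 'v \<Rightarrow> 'v word set \<Rightarrow> int" where
  "exponent_sum \<Gamma> v = raag_lift \<Gamma> integer_group (\<lambda>u. if u = v then 1 else 0)"

lemma respects_exponent: "respects_edges \<Gamma> integer_group (\<lambda>u. if u = v then 1 else 0)"
  by (auto simp: respects_edges_def)

lemma exponent_sum_gen:
  "u \<in> pverts \<Gamma> \<Longrightarrow> exponent_sum \<Gamma> v (raag_gen \<Gamma> u) = (if u = v then 1 else 0)"
  by (simp add: exponent_sum_def raag_lift_gen[OF group_integer_group respects_exponent])

lemma group_hom_exponent_sum: "group_hom (raag \<Gamma>) integer_group (exponent_sum \<Gamma> v)"
  by (simp add: group_hom_def group_hom_axioms_def group_raag exponent_sum_def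
      raag_lift_hom[OF group_integer_group respects_exponent])

lemma exponent_sum_hom:
  shows "x \<in> carrier (raag \<Gamma>) \<Longrightarrow> y \<in> carrier (raag \<Gamma>) \<Longrightarrow>
      exponent_sum \<Gamma> v (x \<otimes>\<^bsub>raag \<Gamma>\<^esub> y) = exponent_sum \<Gamma> v x + exponent_sum \<Gamma> v y"
    and "x \<in> carrier (raag \<Gamma>) \<Longrightarrow> exponent_sum \<Gamma> v (inv\<^bsub>raag \<Gamma>\<^esub> x) = - exponent_sum \<Gamma> v x"
    and "x \<in> carrier (raag \<Gamma>) \<Longrightarrow> exponent_sum \<Gamma> v (x [^]\<^bsub>raag \<Gamma>\<^esub> (i :: int)) = i * exponent_sum \<Gamma> v x"
    and "exponent_sum \<Gamma> v \<one>\<^bsub>raag \<Gamma>\<^esub> = 0"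
proof -
  interpret group_hom "raag \<Gamma>" integer_group "exponent_sum \<Gamma> v" by (rule group_hom_exponent_sum)
  show "x \<in> carrier (raag \<Gamma>) \<Longrightarrow> y \<in> carrier (raag \<Gamma>) \<Longrightarrow>
      exponent_sum \<Gamma> v (x \<otimes>\<^bsub>raag \<Gamma>\<^esub> y) = exponent_sum \<Gamma> v x + exponent_sum \<Gamma> v y"
    and "x \<in> carrier (raag \<Gamma>) \<Longrightarrow> exponent_sum \<Gamma> v (inv\<^bsub>raag \<Gamma>\<^esub> x) = - exponent_sum \<Gamma> v x"
    and "x \<in> carrier (raag \<Gamma>) \<Longrightarrow> exponent_sum \<Gamma> v (x [^]\<^bsub>raag \<Gamma>\<^esub> i) = i * exponent_sum \<Gamma> v x"
    and "exponent_sum \<Gamma> v \<one>\<^bsub>raag \<Gamma>\<^esub> = 0"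
    using hom_mult[of x y] hom_inv[of x] hom_int_pow[of x i] hom_one by simp_all
qed

lemma raag_gen_not_one: "v \<in> pverts \<Gamma> \<Longrightarrow> raag_gen \<Gamma> v \<noteq> \<one>\<^bsub>raag \<Gamma>\<^esub>"
  using exponent_sum_gen[of v \<Gamma> v] exponent_sum_hom(4)[of \<Gamma> v] by auto

text \<open>Conjugation by \<open>x\<close> is an endomorphism that fixes \<open>y\<close>, hence
  fixes all powers of \<open>y\<close>.\<close>

lemma (in group) commute_int_pow:
  assumes "x \<in> carrier G" "y \<in> carrier G" "x \<otimes> y = y \<otimes> x"
  shows "x \<otimes> y [^] (i :: int) = y [^] i \<otimes> x"
proof -
  interpret c: group_hom G G "\<lambda>y. x \<otimes> y \<otimes> inv x"
    using conjugation_is_hom assms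
    by unfold_locales (auto simp: hom_def m_assoc inv_solve_left)
  have "x \<otimes> y \<otimes> inv x = y" using assms by (simp add: inv_solve_right')
  moreover have "x \<otimes> y [^] i \<otimes> inv x = (x \<otimes> y \<otimes> inv x) [^] i"
    using c.hom_int_pow[OF assms(2)] .
  ultimately have "x \<otimes> y [^] i \<otimes> inv x = y [^] i" by (simp only:)
  then show ?thesis using assms by (simp add: inv_solve_right')
qed

text \<open>Otherwise every neighbour of \<open>v\<close> equals \<open>w\<close> or is adjacent to
  \<open>w\<close>, so multiplying \<open>v\<close> on the right by a power of \<open>w\<close>
  respects all edges. The exponent sum of \<open>w\<close> in the image of \<open>v\<close> is the
  power used. Inner automorphisms preserve it, so these transvections lie in pairwise different
  outer classes.\<close>

lemma finite_Out_no_domination: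
  assumes \<Gamma>: "pair_graph \<Gamma>" and fin: "finite (carrier (Out (raag \<Gamma>)))"
    and vw: "v \<in> pverts \<Gamma>" "w \<in> pverts \<Gamma>" "v \<noteq> w"
  shows "\<exists>u. (v, u) \<in> parcs \<Gamma> \<and> u \<noteq> w \<and> (w, u) \<notin> parcs \<Gamma>"
proof (rule ccontr)
  assume dom: "\<not> ?thesis"
  interpret \<Gamma>: pair_graph \<Gamma> by (rule \<Gamma>)
  interpret group "raag \<Gamma>" by (rule group_raag)
  let ?g = "raag_gen \<Gamma>"
  define f where "f (i :: int) u = (if u = v then ?g v \<otimes>\<^bsub>raag \<Gamma>\<^esub> ?g w [^]\<^bsub>raag \<Gamma>\<^esub> i else ?g u)" for i u
  have closed: "f i u \<in> carrier (raag \<Gamma>)" if "u \<in> pverts \<Gamma>" for i u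
    using that vw by (simp add: f_def)
  have comm: "?g u \<otimes>\<^bsub>raag \<Gamma>\<^esub> ?g u' = ?g u' \<otimes>\<^bsub>raag \<Gamma>\<^esub> ?g u" if "(u, u') \<in> parcs \<Gamma>" for u u'
    using that \<Gamma>.in_arcsD1 \<Gamma>.in_arcsD2 by (intro raag_gen_commute) auto
  have star: "f i v \<otimes>\<^bsub>raag \<Gamma>\<^esub> ?g u = ?g u \<otimes>\<^bsub>raag \<Gamma>\<^esub> f i v" if u: "(v, u) \<in> parcs \<Gamma>" for u i
  proof -
    have uV: "u \<in> pverts \<Gamma>" using \<Gamma>.in_arcsD2[OF u] .
    have "u = w \<or> (w, u) \<in> parcs \<Gamma>" using dom u by auto
    then have "?g u \<otimes>\<^bsub>raag \<Gamma>\<^esub> ?g w = ?g w \<otimes>\<^bsub>raag \<Gamma>\<^esub> ?g u" using comm[of w u] by auto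
    then have "?g u \<otimes>\<^bsub>raag \<Gamma>\<^esub> ?g w [^]\<^bsub>raag \<Gamma>\<^esub> i = ?g w [^]\<^bsub>raag \<Gamma>\<^esub> i \<otimes>\<^bsub>raag \<Gamma>\<^esub> ?g u"
      using commute_int_pow uV vw by simp
    then show ?thesis
      using comm[OF u] uV vw mult_commute_mult[of "?g u" "?g v" "?g w [^]\<^bsub>raag \<Gamma>\<^esub> i"]
      by (simp add: f_def)
  qed
  have re: "respects_edges \<Gamma> (raag \<Gamma>) (f i)" for i
  proof (rule respects_edgesI)
    show "f i u \<in> carrier (raag \<Gamma>)" if "u \<in> pverts \<Gamma>" for u using that closed by simp
    fix u u' assume uu: "(u, u') \<in> parcs \<Gamma>"
    have "(u', u) \<in> parcs \<Gamma>" "u \<noteq> u'" using pair_graph_arcsD[OF \<Gamma> uu] by auto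
    then show "f i u \<otimes>\<^bsub>raag \<Gamma>\<^esub> f i u' = f i u' \<otimes>\<^bsub>raag \<Gamma>\<^esub> f i u"
      using uu star[of u i] star[of u' i] comm[OF uu] by (cases "u = v"; cases "u' = v") (auto simp: f_def)
  qed
  let ?\<tau> = "\<lambda>i. raag_lift \<Gamma> (raag \<Gamma>) (f i)"
  have gen: "?\<tau> i (?g u) = f i u" if "u \<in> pverts \<Gamma>" for i u
    using raag_lift_gen[OF group_raag re that] .
  \<comment> \<open>The transvection fixes \<open>w\<close> and hence the powers of
    \<open>w\<close>, so the opposite exponent inverts it.\<close>
  have inv: "?\<tau> i (f (- i) u) = ?g u" if u: "u \<in> pverts \<Gamma>" for i u
  proof (cases "u = v")
    case True
    interpret h: group_hom "raag \<Gamma>" "raag \<Gamma>" "?\<tau> i"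
      using raag_lift_hom[OF group_raag re] group_raag by (simp add: group_hom_def group_hom_axioms_def)
    have "?\<tau> i (?g v \<otimes>\<^bsub>raag \<Gamma>\<^esub> ?g w [^]\<^bsub>raag \<Gamma>\<^esub> (- i)) = f i v \<otimes>\<^bsub>raag \<Gamma>\<^esub> f i w [^]\<^bsub>raag \<Gamma>\<^esub> (- i)"
      using vw h.hom_int_pow by (simp add: gen)
    also have "\<dots> = ?g v"
      using vw int_pow_mult[of "?g w" i "- i"] by (simp add: f_def m_assoc)
    finally show ?thesis using True by (simp add: f_def)
  qed (use gen[OF u] in \<open>simp add: f_def\<close>)
  have "?\<tau> i \<in> auto (raag \<Gamma>)" for i
    using inv[of _ i] inv[of _ "- i"] by (intro raag_autoI[of _ "f i" "f (- i)"] re) auto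
  then obtain k l :: nat and g where kl: "k < l" "g \<in> carrier (raag \<Gamma>)"
    "\<And>x. x \<in> carrier (raag \<Gamma>) \<Longrightarrow> ?\<tau> (int l) x = g \<otimes>\<^bsub>raag \<Gamma>\<^esub> ?\<tau> (int k) x \<otimes>\<^bsub>raag \<Gamma>\<^esub> inv\<^bsub>raag \<Gamma>\<^esub> g"
    using finite_Out_family[OF fin, of "\<lambda>k. ?\<tau> (int k)"] by metis
  have exp: "exponent_sum \<Gamma> w (f i v) = i" for i
    using vw by (simp add: f_def exponent_sum_hom exponent_sum_gen)
  have "f (int l) v = g \<otimes>\<^bsub>raag \<Gamma>\<^esub> f (int k) v \<otimes>\<^bsub>raag \<Gamma>\<^esub> inv\<^bsub>raag \<Gamma>\<^esub> g"
    using kl(3)[of "?g v"] vw by (simp add: gen)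
  then have "exponent_sum \<Gamma> w (f (int l) v) =
      exponent_sum \<Gamma> w (g \<otimes>\<^bsub>raag \<Gamma>\<^esub> f (int k) v \<otimes>\<^bsub>raag \<Gamma>\<^esub> inv\<^bsub>raag \<Gamma>\<^esub> g)"
    by (rule arg_cong)
  also have "\<dots> = exponent_sum \<Gamma> w (f (int k) v)"
    using kl(2) closed[OF vw(1)] by (simp add: exponent_sum_hom(1,2))
  finally have "int l = int k" unfolding exp .
  then show False using kl(1) by simp
qed

text \<open>Let \<open>c\<close> act on the integers by translation by one and \<open>d\<close> by
  exchanging 0 and 1, while all other vertices act trivially. The edge relations hold because
  \<open>c\<close> and \<open>d\<close> span no edge. From the point 0 the two products lead to
  \<open>i + 1\<close> and to \<open>sw i\<close>.\<close>

lemma nonadjacent_not_commute: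
  assumes \<Gamma>: "pair_graph \<Gamma>" and cd: "c \<in> pverts \<Gamma>" "d \<in> pverts \<Gamma>" "c \<noteq> d" "(c, d) \<notin> parcs \<Gamma>"
    and i: "i > 0"
  shows "raag_gen \<Gamma> c [^]\<^bsub>raag \<Gamma>\<^esub> (i :: int) \<otimes>\<^bsub>raag \<Gamma>\<^esub> raag_gen \<Gamma> d \<noteq>
    raag_gen \<Gamma> d \<otimes>\<^bsub>raag \<Gamma>\<^esub> raag_gen \<Gamma> c [^]\<^bsub>raag \<Gamma>\<^esub> i"
proof -
  interpret \<Gamma>: pair_graph \<Gamma> by (rule \<Gamma>)
  interpret A: group "raag \<Gamma>" by (rule group_raag)
  define sw :: "int \<Rightarrow> int" where "sw n = (if n = 0 then 1 else if n = 1 then 0 else n)" for n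
  define p where "p u = (if u = c then (\<lambda>n. n + 1) else if u = d then sw else id)" for u
  define q where "q u = (if u = c then (\<lambda>n. n - 1) else if u = d then sw else id)" for u
  obtain \<Phi> :: "'a word set \<Rightarrow> int \<Rightarrow> int" where
    one: "\<And>l. \<Phi> \<one>\<^bsub>raag \<Gamma>\<^esub> l = l" and
    mult: "\<And>x y l. x \<in> carrier (raag \<Gamma>) \<Longrightarrow> y \<in> carrier (raag \<Gamma>) \<Longrightarrow>
      \<Phi> (x \<otimes>\<^bsub>raag \<Gamma>\<^esub> y) l = \<Phi> x (\<Phi> y l)" and
    gen: "\<And>v l. v \<in> pverts \<Gamma> \<Longrightarrow> \<Phi> (raag_gen \<Gamma> v) l = p v l"
  proof (rule raag_action[of \<Gamma> UNIV p q])
    fix v w and l :: int assume vw: "(v, w) \<in> parcs \<Gamma>"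
    have "v \<noteq> w" "(w, v) \<in> parcs \<Gamma>" using pair_graph_arcsD[OF \<Gamma> vw] by auto
    with vw cd show "p v (p w l) = p w (p v l)" by (auto simp: p_def)
    show "v \<in> pverts \<Gamma> \<and> w \<in> pverts \<Gamma>" using vw \<Gamma>.in_arcsD1 \<Gamma>.in_arcsD2 by auto
  next
    fix \<Phi> :: "'a word set \<Rightarrow> int \<Rightarrow> int"
    assume *: "\<And>l. l \<in> UNIV \<Longrightarrow> \<Phi> \<one>\<^bsub>raag \<Gamma>\<^esub> l = l"
      "\<And>x y l. x \<in> carrier (raag \<Gamma>) \<Longrightarrow> y \<in> carrier (raag \<Gamma>) \<Longrightarrow> l \<in> UNIV \<Longrightarrow>
        \<Phi> (x \<otimes>\<^bsub>raag \<Gamma>\<^esub> y) l = \<Phi> x (\<Phi> y l)"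
      "\<And>v l. v \<in> pverts \<Gamma> \<Longrightarrow> l \<in> UNIV \<Longrightarrow> \<Phi> (raag_gen \<Gamma> v) l = p v l"
    show thesis by (rule that[of \<Phi>]) (simp_all add: *)
  qed (auto simp: p_def q_def sw_def)
  let ?c = "raag_gen \<Gamma> c" and ?d = "raag_gen \<Gamma> d"
  have pow: "\<Phi> (?c [^]\<^bsub>raag \<Gamma>\<^esub> n) l = l + int n" for n :: nat and l
  proof (induction n arbitrary: l)
    case (Suc n)
    then show ?case using cd by (simp add: mult gen p_def)
  qed (simp add: one)
  have pow': "\<Phi> (?c [^]\<^bsub>raag \<Gamma>\<^esub> i) l = l + i" for l
    using pow zero_less_imp_eq_int[OF i] by (auto simp: int_pow_int)
  have "\<Phi> (?c [^]\<^bsub>raag \<Gamma>\<^esub> i \<otimes>\<^bsub>raag \<Gamma>\<^esub> ?d) 0 = i + 1"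
    using cd by (simp add: mult gen pow' p_def sw_def)
  moreover have "\<Phi> (?d \<otimes>\<^bsub>raag \<Gamma>\<^esub> ?c [^]\<^bsub>raag \<Gamma>\<^esub> i) 0 = sw i"
    using cd by (simp add: mult gen pow' p_def)
  \<comment> \<open>As \<open>i\<close> is positive, \<open>sw i\<close> is 0 for
    \<open>i = 1\<close> and \<open>i\<close> otherwise.\<close>
  moreover have "sw i \<noteq> i + 1" using i by (auto simp: sw_def)
  ultimately show ?thesis by metis
qed

section \<open>The centre\<close>

definition cancels :: "'g \<times> bool \<Rightarrow> 'g \<times> bool \<Rightarrow> bool" where
  "cancels p q \<longleftrightarrow> fst p = fst q \<and> snd p \<noteq> snd q"

definition push :: "'g \<times> bool \<Rightarrow> 'g word \<Rightarrow> 'g word" where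
  "push p l = (case l of [] \<Rightarrow> [p] | q # l' \<Rightarrow> if cancels p q then l' else p # l)"

definition freely_reduced :: "'g word \<Rightarrow> bool" where
  "freely_reduced l \<longleftrightarrow> successively (\<lambda>p q. \<not> cancels p q) l"

text \<open>An invariant of pairs of words: the action used below changes words at the left end or
  letter by letter, so a difference at the right end persists. It has to be symmetric because
  pushing onto the empty word and onto a one-letter word may reverse which of the two is
  longer.\<close>

definition differ_by_last :: "'b list \<Rightarrow> 'b list \<Rightarrow> bool" where
  "differ_by_last l m \<longleftrightarrow> (\<exists>q. m = l @ [q] \<or> l = m @ [q])"

lemma freely_reduced_Cons:
  "freely_reduced (p # l) \<longleftrightarrow> (l = [] \<or> \<not> cancels p (hd l)) \<and> freely_reduced l"
  by (cases l) (auto simp: freely_reduced_def)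

lemma freely_reduced_push: "freely_reduced l \<Longrightarrow> freely_reduced (push p l)"
  by (cases l) (auto simp: push_def freely_reduced_Cons freely_reduced_def[of "[]"])

lemma push_words: "l \<in> words S \<Longrightarrow> fst p \<in> S \<Longrightarrow> push p l \<in> words S"
  by (cases p; cases l) (auto simp: push_def words_def)

text \<open>If the inner \<open>push\<close> removes the first letter of \<open>l\<close>,
  reducedness prevents the outer one from cancelling the next letter, so the first letter is
  restored. Otherwise the outer \<open>push\<close> removes the letter just added.\<close>

lemma push_push_inverse:
  assumes "freely_reduced l"
  shows "push (x, e) (push (x, \<not> e) l) = l"
  using assms by (cases l; cases "tl l") (auto simp: push_def freely_reduced_Cons cancels_def)

lemma map_push:
  assumes "\<And>q. q \<in> set l \<Longrightarrow> cancels (f p) (f q) \<longleftrightarrow> cancels p q"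
  shows "map f (push p l) = push (f p) (map f l)"
  using assms by (cases l) (auto simp: push_def)

lemma freely_reduced_map:
  assumes "\<And>p q. p \<in> set l \<Longrightarrow> q \<in> set l \<Longrightarrow> cancels (f p) (f q) \<longleftrightarrow> cancels p q"
  shows "freely_reduced (map f l) \<longleftrightarrow> freely_reduced l"
  unfolding freely_reduced_def successively_map using assms by (auto intro!: successively_cong)

lemma differ_by_last_push: "differ_by_last l m \<Longrightarrow> differ_by_last (push p l) (push p m)"
  by (cases l; cases m) (auto simp: differ_by_last_def push_def)

lemma differ_by_last_map: "differ_by_last l m \<Longrightarrow> differ_by_last (map f l) (map f m)"
  by (auto simp: differ_by_last_def)

lemma (in group) eval_word_push:
  assumes "l \<in> words (carrier G)" "x \<in> carrier G"
  shows "eval_word G (\<lambda>x. x) (push (x, e) l) =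
    (if e then x else inv x) \<otimes> eval_word G (\<lambda>x. x) l"
proof (cases l)
  case Nil
  then show ?thesis using assms by (simp add: push_def eval_word_def)
next
  case (Cons a l')
  obtain y b where a: "a = (y, b)" by force
  have y: "y \<in> carrier G" and l': "eval_word G (\<lambda>x. x) l' \<in> carrier G"
    using assms Cons a by (auto simp: words_def intro!: eval_word_closed[of _ "carrier G"])
  have ev: "eval_word G (\<lambda>x. x) (q # m) = (if snd q then fst q else inv fst q) \<otimes> eval_word G (\<lambda>x. x) m"
    for q m by (cases q) (simp add: eval_word_def)
  show ?thesis
    using y l' assms(2) by (auto simp: Cons a push_def ev cancels_def simp flip: m_assoc)
qed

definition conj_letter :: "('g, 'c) monoid_scheme \<Rightarrow> 'g \<Rightarrow> 'g \<times> bool \<Rightarrow> 'g \<times> bool" where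
  "conj_letter G g = map_prod (\<lambda>x. g \<otimes>\<^bsub>G\<^esub> x \<otimes>\<^bsub>G\<^esub> inv\<^bsub>G\<^esub> g) id"

lemma (in group) conj_eq_iff:
  "g \<in> carrier G \<Longrightarrow> x \<in> carrier G \<Longrightarrow> y \<in> carrier G \<Longrightarrow>
    g \<otimes> x \<otimes> inv g = g \<otimes> y \<otimes> inv g \<longleftrightarrow> x = y"
  by simp

lemma (in group) conj_conj:
  "g \<in> carrier G \<Longrightarrow> h \<in> carrier G \<Longrightarrow> x \<in> carrier G \<Longrightarrow>
    g \<otimes> (h \<otimes> x \<otimes> inv h) \<otimes> inv g = g \<otimes> h \<otimes> x \<otimes> inv (g \<otimes> h)"
  by (simp add: m_assoc inv_mult_group)

lemma (in group) eval_word_conj: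
  assumes "l \<in> words (carrier G)" "g \<in> carrier G"
  shows "eval_word G (\<lambda>x. x) (map (conj_letter G g) l) = g \<otimes> eval_word G (\<lambda>x. x) l \<otimes> inv g"
  using assms
proof (induction l)
  case Nil
  then show ?case by (simp add: eval_word_def)
next
  case (Cons a l)
  obtain y b where a: "a = (y, b)" by force
  have y: "y \<in> carrier G" and l: "eval_word G (\<lambda>x. x) l \<in> carrier G" "l \<in> words (carrier G)"
    using Cons.prems a by (auto simp: words_def intro!: eval_word_closed[of _ "carrier G"])
  have ev: "eval_word G (\<lambda>x. x) (q # m) = (if snd q then fst q else inv fst q) \<otimes> eval_word G (\<lambda>x. x) m"
    for q m by (cases q) (simp add: eval_word_def)
  have IH: "eval_word G (\<lambda>x. x) (map (conj_letter G g) l) = g \<otimes> eval_word G (\<lambda>x. x) l \<otimes> inv g"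
    using Cons.IH l Cons.prems by simp
  have letter: "conj_letter G g (y, b) = (g \<otimes> y \<otimes> inv g, b)" by (simp add: conj_letter_def)
  show ?case
    using y l Cons.prems(2)
    by (simp add: a ev IH letter m_assoc inv_mult_group)
qed

text \<open>The retraction onto the subgroup generated by the vertices outside \<open>S\<close>.
  That it fixes an element says that the element lies in this subgroup; for a disconnected graph it
  is the projection of the free product to a factor.\<close>

definition kill :: "'v pair_pre_digraph \<Rightarrow> 'v set \<Rightarrow> 'v word set \<Rightarrow> 'v word set" where
  "kill \<Gamma> S = raag_lift \<Gamma> (raag \<Gamma>) (\<lambda>u. if u \<in> S then \<one>\<^bsub>raag \<Gamma>\<^esub> else raag_gen \<Gamma> u)"

lemma respects_kill:
  assumes "pair_graph \<Gamma>"
  shows "respects_edges \<Gamma> (raag \<Gamma>) (\<lambda>u. if u \<in> S then \<one>\<^bsub>raag \<Gamma>\<^esub> else raag_gen \<Gamma> u)"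
proof -
  interpret group "raag \<Gamma>" by (rule group_raag)
  show ?thesis
  proof (rule respects_edgesI)
    fix v w assume vw: "(v, w) \<in> parcs \<Gamma>"
    note arcs = pair_graph_arcsD[OF assms vw]
    show "(if v \<in> S then \<one>\<^bsub>raag \<Gamma>\<^esub> else raag_gen \<Gamma> v) \<otimes>\<^bsub>raag \<Gamma>\<^esub> (if w \<in> S then \<one>\<^bsub>raag \<Gamma>\<^esub> else raag_gen \<Gamma> w) =
        (if w \<in> S then \<one>\<^bsub>raag \<Gamma>\<^esub> else raag_gen \<Gamma> w) \<otimes>\<^bsub>raag \<Gamma>\<^esub> (if v \<in> S then \<one>\<^bsub>raag \<Gamma>\<^esub> else raag_gen \<Gamma> v)"
      using arcs raag_gen_commute[OF arcs(1,2) vw] by simp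
  qed simp
qed

lemma kill_gen:
  "pair_graph \<Gamma> \<Longrightarrow> u \<in> pverts \<Gamma> \<Longrightarrow>
    kill \<Gamma> S (raag_gen \<Gamma> u) = (if u \<in> S then \<one>\<^bsub>raag \<Gamma>\<^esub> else raag_gen \<Gamma> u)"
  by (simp add: kill_def raag_lift_gen[OF group_raag respects_kill])

lemma kill_hom: "pair_graph \<Gamma> \<Longrightarrow> kill \<Gamma> S \<in> hom (raag \<Gamma>) (raag \<Gamma>)"
  by (simp add: kill_def raag_lift_hom[OF group_raag respects_kill])

lemma kill_insert:
  assumes \<Gamma>: "pair_graph \<Gamma>" and x: "x \<in> carrier (raag \<Gamma>)"
  shows "kill \<Gamma> (insert v S) x = kill \<Gamma> {v} (kill \<Gamma> S x)"
proof -
  interpret k: group_hom "raag \<Gamma>" "raag \<Gamma>" "kill \<Gamma> {v}"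
    using kill_hom[OF \<Gamma>] group_raag by (simp add: group_hom_def group_hom_axioms_def)
  have c: "kill \<Gamma> {v} \<circ> kill \<Gamma> S \<in> hom (raag \<Gamma>) (raag \<Gamma>)"
    using kill_hom[OF \<Gamma>] by (auto intro: hom_compose)
  have "kill \<Gamma> (insert v S) x = (kill \<Gamma> {v} \<circ> kill \<Gamma> S) x"
    using \<Gamma> by (intro raag_hom_eqI[OF group_raag kill_hom[OF \<Gamma>] c _ x]) (auto simp: kill_gen)
  then show ?thesis by simp
qed

text \<open>
  The kernel of \<open>kill \<Gamma> {v}\<close> is free on the conjugates of \<open>v\<close> under the subgroup generated by the
  other vertices. Accordingly the group acts on freely reduced words whose letters are group elements: \<open>v\<close> multiplies from the
  left by the letter \<open>v\<close>, and any other generator conjugates all letters. A central \<open>z\<close> moves the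
  empty word to a word \<open>l\<close>. If \<open>l\<close> is nonempty, choose a conjugate \<open>y\<close> of \<open>v\<close> that is not its first
  letter; computing the image of the empty word under \<open>z y = y z\<close> in two ways gives a contradiction.
\<close>

lemma central_imp_kill_eq:
  assumes \<Gamma>: "pair_graph \<Gamma>" and v: "v \<in> pverts \<Gamma>" and w: "w \<in> pverts \<Gamma>" "w \<noteq> v" "(v, w) \<notin> parcs \<Gamma>"
    and z: "z \<in> carrier (raag \<Gamma>)" "\<And>x. x \<in> carrier (raag \<Gamma>) \<Longrightarrow> z \<otimes>\<^bsub>raag \<Gamma>\<^esub> x = x \<otimes>\<^bsub>raag \<Gamma>\<^esub> z"
  shows "kill \<Gamma> {v} z = z"
proof -
  interpret A: group "raag \<Gamma>" by (rule group_raag)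
  interpret k: group_hom "raag \<Gamma>" "raag \<Gamma>" "kill \<Gamma> {v}"
    using kill_hom[OF \<Gamma>] group_raag by (simp add: group_hom_def group_hom_axioms_def)
  let ?A = "raag \<Gamma>" and ?g = "raag_gen \<Gamma>"
  let ?c = "conj_letter (raag \<Gamma>)" and ?ev = "eval_word (raag \<Gamma>) (\<lambda>x. x)"
  define N where "N = {l \<in> words (carrier ?A). freely_reduced l}"
  define p where "p u l = (if u = v then push (?g v, True) l else map (?c (?g u)) l)" for u l
  define n where "n u l = (if u = v then push (?g v, False) l else map (?c (inv\<^bsub>?A\<^esub> ?g u)) l)" for u l
  have cancels_conj: "cancels (?c g a) (?c g b) \<longleftrightarrow> cancels a b"
    if "g \<in> carrier ?A" "fst a \<in> carrier ?A" "fst b \<in> carrier ?A" for g a b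
    using that A.conj_eq_iff by (auto simp: cancels_def conj_letter_def)
  have letters: "fst a \<in> carrier ?A" if "l \<in> N" "a \<in> set l" for a l
    using that by (auto simp: N_def words_def)
  have map_N: "map (?c g) l \<in> N" if g: "g \<in> carrier ?A" and l: "l \<in> N" for g l
  proof -
    have "freely_reduced (map (?c g) l)"
      using freely_reduced_map[of l "?c g"] cancels_conj[OF g] letters[OF l] l by (simp add: N_def)
    moreover have "map (?c g) l \<in> words (carrier ?A)"
      using g letters[OF l] by (force simp: words_def conj_letter_def)
    ultimately show ?thesis by (simp add: N_def)
  qed
  have push_N: "push (x, e) l \<in> N" if "x \<in> carrier ?A" "l \<in> N" for x e l
    using that by (simp add: N_def freely_reduced_push push_words)
  have conj_conj: "map (?c g) (map (?c h) l) = map (?c (g \<otimes>\<^bsub>?A\<^esub> h)) l"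
    if "g \<in> carrier ?A" "h \<in> carrier ?A" "l \<in> N" for g h l
    using letters[OF that(3)] that by (auto simp: conj_letter_def A.conj_conj)
  have conj_one: "map (?c \<one>\<^bsub>?A\<^esub>) l = l" if "l \<in> N" for l
    using letters[OF that] by (intro map_idI) (auto simp: conj_letter_def)
  have conj_push: "map (?c g) (push (x, e) l) = push (g \<otimes>\<^bsub>?A\<^esub> x \<otimes>\<^bsub>?A\<^esub> inv\<^bsub>?A\<^esub> g, e) (map (?c g) l)"
    if "g \<in> carrier ?A" "x \<in> carrier ?A" "l \<in> N" for g x e l
    using map_push[of l "?c g" "(x, e)"] cancels_conj letters that by (auto simp: conj_letter_def)
  obtain \<Phi> where mem: "\<And>x l. x \<in> carrier ?A \<Longrightarrow> l \<in> N \<Longrightarrow> \<Phi> x l \<in> N"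
    and one: "\<And>l. l \<in> N \<Longrightarrow> \<Phi> \<one>\<^bsub>?A\<^esub> l = l"
    and mult: "\<And>x y l. x \<in> carrier ?A \<Longrightarrow> y \<in> carrier ?A \<Longrightarrow> l \<in> N \<Longrightarrow>
      \<Phi> (x \<otimes>\<^bsub>?A\<^esub> y) l = \<Phi> x (\<Phi> y l)"
    and gen: "\<And>u l. u \<in> pverts \<Gamma> \<Longrightarrow> l \<in> N \<Longrightarrow> \<Phi> (?g u) l = p u l"
    and inv: "\<And>u l. u \<in> pverts \<Gamma> \<Longrightarrow> l \<in> N \<Longrightarrow> \<Phi> (inv\<^bsub>?A\<^esub> ?g u) l = n u l"
  proof (rule raag_action[of \<Gamma> N p n])
    fix u l assume u: "u \<in> pverts \<Gamma>" and l: "l \<in> N"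
    show "p u l \<in> N \<and> n u l \<in> N"
      using u l v by (simp add: p_def n_def push_N map_N)
    have "push (?g v, e) (push (?g v, \<not> e) l) = l" for e
      using push_push_inverse l by (auto simp: N_def)
    from this[of True] this[of False] show "p u (n u l) = l \<and> n u (p u l) = l"
      using u l v conj_conj[of "?g u" "inv\<^bsub>?A\<^esub> ?g u"] conj_conj[of "inv\<^bsub>?A\<^esub> ?g u" "?g u"]
      by (auto simp: p_def n_def conj_one simp del: map_map)
  next
    fix u u' l assume uu: "(u, u') \<in> parcs \<Gamma>" and l: "l \<in> N"
    note arcs = pair_graph_arcsD[OF \<Gamma> uu]
    have comm: "?g u \<otimes>\<^bsub>?A\<^esub> ?g u' = ?g u' \<otimes>\<^bsub>?A\<^esub> ?g u"
      using uu arcs by (intro raag_gen_commute)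
    \<comment> \<open>When one endpoint is \<open>v\<close>, the relation says that letterwise
      conjugation by the other endpoint commutes with pushing \<open>v\<close>. This holds since
      that conjugation fixes the letter \<open>v\<close>.\<close>
    then have "?g u \<otimes>\<^bsub>?A\<^esub> ?g u' \<otimes>\<^bsub>?A\<^esub> inv\<^bsub>?A\<^esub> ?g u = ?g u'"
      and "?g u' \<otimes>\<^bsub>?A\<^esub> ?g u \<otimes>\<^bsub>?A\<^esub> inv\<^bsub>?A\<^esub> ?g u' = ?g u"
      using arcs by (simp_all add: A.inv_solve_right')
    then show "p u (p u' l) = p u' (p u l)"
      using arcs l comm
      by (cases "u = v"; cases "u' = v") (simp_all add: p_def conj_push conj_conj del: map_map)
  qed (use pair_graph_arcsD[OF \<Gamma>] in auto)
  have nil: "[] \<in> N" by (simp add: N_def words_def freely_reduced_def)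
  have ev_closed: "?ev l \<in> carrier ?A" if "l \<in> N" for l
    using that by (auto simp: N_def intro: A.eval_word_closed[of _ "carrier ?A"])
  \<comment> \<open>Both kinds of generator obey one formula: for \<open>v\<close> the factor coming
    from \<open>kill\<close> is trivial and pushing is left multiplication, while any other
    generator is fixed by \<open>kill\<close> and acts by conjugation.\<close>
  have ev: "?ev (\<Phi> x l) = x \<otimes>\<^bsub>?A\<^esub> ?ev l \<otimes>\<^bsub>?A\<^esub> inv\<^bsub>?A\<^esub> kill \<Gamma> {v} x" if x: "x \<in> carrier ?A" and l: "l \<in> N" for x l
    using x
  proof (induction rule: raag_induct)
    case one
    then show ?case using ev_closed[OF l] assms(1) l by (simp add: \<open>\<And>l. l \<in> N \<Longrightarrow> \<Phi> \<one>\<^bsub>?A\<^esub> l = l\<close>)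
  next
    case (gen u x)
    have N: "\<Phi> x l \<in> N" using mem gen l by simp
    have "?ev (p u (\<Phi> x l)) = ?g u \<otimes>\<^bsub>?A\<^esub> ?ev (\<Phi> x l) \<otimes>\<^bsub>?A\<^esub> inv\<^bsub>?A\<^esub> kill \<Gamma> {v} (?g u)"
      using N gen.hyps(1) A.eval_word_push[of "\<Phi> x l" "?g u" True] A.eval_word_conj ev_closed[OF N]
      by (auto simp: p_def kill_gen[OF \<Gamma>] N_def)
    then show ?case
      using gen N l ev_closed[OF l] ev_closed[OF N] \<open>\<And>u l. u \<in> pverts \<Gamma> \<Longrightarrow> l \<in> N \<Longrightarrow> \<Phi> (?g u) l = p u l\<close>
      by (simp add: mult A.m_assoc A.inv_mult_group)
  next
    case (inv u x)
    have N: "\<Phi> x l \<in> N" using mem inv l by simp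
    have "?ev (n u (\<Phi> x l)) = inv\<^bsub>?A\<^esub> ?g u \<otimes>\<^bsub>?A\<^esub> ?ev (\<Phi> x l) \<otimes>\<^bsub>?A\<^esub> kill \<Gamma> {v} (?g u)"
      using N inv.hyps(1) A.eval_word_push[of "\<Phi> x l" "?g u" False] A.eval_word_conj ev_closed[OF N]
      by (auto simp: n_def kill_gen[OF \<Gamma>] N_def)
    then show ?case
      using inv N l ev_closed[OF l] ev_closed[OF N] \<open>\<And>u l. u \<in> pverts \<Gamma> \<Longrightarrow> l \<in> N \<Longrightarrow> \<Phi> (inv\<^bsub>?A\<^esub> ?g u) l = n u l\<close>
      by (simp add: mult A.m_assoc A.inv_mult_group)
  qed
  have differ: "differ_by_last (\<Phi> x l) (\<Phi> x m)"
    if x: "x \<in> carrier ?A" and lm: "l \<in> N" "m \<in> N" "differ_by_last l m" for x l m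
    using x
  proof (induction rule: raag_induct)
    case one
    then show ?case using lm \<open>\<And>l. l \<in> N \<Longrightarrow> \<Phi> \<one>\<^bsub>?A\<^esub> l = l\<close> by simp
  next
    case (gen u x)
    then show ?case
      using lm mem \<open>\<And>u l. u \<in> pverts \<Gamma> \<Longrightarrow> l \<in> N \<Longrightarrow> \<Phi> (?g u) l = p u l\<close>
      by (simp add: mult p_def differ_by_last_push differ_by_last_map)
  next
    case (inv u x)
    then show ?case
      using lm mem \<open>\<And>u l. u \<in> pverts \<Gamma> \<Longrightarrow> l \<in> N \<Longrightarrow> \<Phi> (inv\<^bsub>?A\<^esub> ?g u) l = n u l\<close>
      by (simp add: mult n_def differ_by_last_push differ_by_last_map)
  qed
  define y where "y g = g \<otimes>\<^bsub>?A\<^esub> ?g v \<otimes>\<^bsub>?A\<^esub> inv\<^bsub>?A\<^esub> g" for g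
  \<comment> \<open>\<open>w\<close> differs from \<open>v\<close> and thus acts by letterwise
    conjugation. Conjugating the push of \<open>v\<close> by this map gives the push of the
    conjugated letter.\<close>
  have act: "\<Phi> (y g) l = push (y g, True) l" if g: "g = \<one>\<^bsub>?A\<^esub> \<or> g = ?g w" and l: "l \<in> N" for g l
    using g
  proof
    assume "g = ?g w"
    moreover have "n w l \<in> N" using l w by (simp add: n_def map_N)
    moreover have "map (?c (?g w)) (n w l) = l"
      using conj_conj[of "?g w" "inv\<^bsub>?A\<^esub> ?g w" l] w l by (simp add: n_def conj_one del: map_map)
    ultimately show ?thesis
      using v w l by (simp add: y_def mult gen inv mem p_def push_N conj_push del: map_map)
  qed (use v l gen in \<open>simp add: y_def p_def\<close>)
  define l where "l = \<Phi> z []"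
  have l: "l \<in> N" using mem z nil by (simp add: l_def)
  have "l = []"
  proof (rule ccontr)
    assume ne: "l \<noteq> []"
    \<comment> \<open>Since \<open>w\<close> is not adjacent to \<open>v\<close>, it does not
      commute with \<open>v\<close>. This gives two distinct conjugates of \<open>v\<close>, at most
      one of which is the first letter of \<open>l\<close>.\<close>
    have "y \<one>\<^bsub>?A\<^esub> \<noteq> y (?g w)"
      using nonadjacent_not_commute[OF \<Gamma> v w(1) w(2)[symmetric] w(3), of 1] v w
      by (auto simp: y_def A.inv_solve_right)
    then obtain g where g: "g = \<one>\<^bsub>?A\<^esub> \<or> g = ?g w" and ny: "y g \<noteq> fst (hd l)" by metis
    have yg: "y g \<in> carrier ?A" using g v w by (auto simp: y_def)
    have "\<Phi> z [(y g, True)] = \<Phi> z (\<Phi> (y g) [])" by (simp add: act[OF g nil] push_def)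
    also have "\<dots> = \<Phi> (y g) l" using mult[OF z(1) yg nil] mult[OF yg z(1) nil] z(2)[OF yg] by (simp add: l_def)
    also have "\<dots> = (y g, True) # l"
      using act[OF g l] ne ny by (auto simp: push_def cancels_def split: list.split)
    finally have "\<Phi> z [(y g, True)] = (y g, True) # l" .
    moreover have "differ_by_last [] [(y g, True)]" unfolding differ_by_last_def by (intro exI disjI1) simp
    moreover have "[(y g, True)] \<in> N" using push_N[OF yg nil, of True] by (simp add: push_def)
    \<comment> \<open>The words \<open>[]\<close> and \<open>[(y g, True)]\<close> differ by a last
      letter, and \<open>z\<close> moves them to \<open>l\<close> and to
      \<open>(y g, True) # l\<close>. By length the latter is \<open>l\<close> with a letter
      appended, so \<open>l\<close> itself would begin with \<open>y g\<close>.\<close>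
    ultimately have "differ_by_last l ((y g, True) # l)"
      using differ[OF z(1) nil] l_def by metis
    then obtain q where "(y g, True) # l = l @ [q] \<or> l = ((y g, True) # l) @ [q]"
      by (auto simp: differ_by_last_def)
    moreover have "l \<noteq> ((y g, True) # l) @ [q]" by (metis length_append_singleton length_Cons n_not_Suc_n Suc_n_not_le_n le_SucI le_refl)
    ultimately have "(y g, True) # l = l @ [q]" by simp
    then have "hd l = (y g, True)" using ne by (metis hd_append2 list.sel(1))
    then show False using ny by simp
  qed
  then have "\<one>\<^bsub>?A\<^esub> = z \<otimes>\<^bsub>?A\<^esub> inv\<^bsub>?A\<^esub> kill \<Gamma> {v} z"
    using ev[OF z(1) nil] z(1) by (simp add: l_def eval_word_def)
  then have "z = \<one>\<^bsub>?A\<^esub> \<otimes>\<^bsub>?A\<^esub> kill \<Gamma> {v} z"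
    using z(1) by (subst (asm) A.inv_solve_right) auto
  then show ?thesis using z(1) by simp
qed

text \<open>A central \<open>z\<close> survives the killing of any one vertex, hence of all vertices
  one after another; but killing all of them leaves only the identity.\<close>

lemma raag_center_trivial:
  assumes \<Gamma>: "pair_graph \<Gamma>"
    and nonadj: "\<And>v. v \<in> pverts \<Gamma> \<Longrightarrow> \<exists>w\<in>pverts \<Gamma>. w \<noteq> v \<and> (v, w) \<notin> parcs \<Gamma>"
    and z: "z \<in> carrier (raag \<Gamma>)" "\<And>x. x \<in> carrier (raag \<Gamma>) \<Longrightarrow> z \<otimes>\<^bsub>raag \<Gamma>\<^esub> x = x \<otimes>\<^bsub>raag \<Gamma>\<^esub> z"
  shows "z = \<one>\<^bsub>raag \<Gamma>\<^esub>"
proof -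
  interpret \<Gamma>: pair_graph \<Gamma> by (rule \<Gamma>)
  interpret A: group "raag \<Gamma>" by (rule group_raag)
  have "kill \<Gamma> S z = z" if "finite S" "S \<subseteq> pverts \<Gamma>" for S
    using that
  proof (induction S)
    case empty
    have "(\<lambda>x. x) \<in> hom (raag \<Gamma>) (raag \<Gamma>)" by (simp add: hom_def)
    from raag_hom_eqI[OF group_raag kill_hom[OF \<Gamma>] this _ z(1)] show ?case
      using \<Gamma> by (simp add: kill_gen)
  next
    case (insert v S)
    then have "v \<in> pverts \<Gamma>" by simp
    from nonadj[OF this] obtain w where "w \<in> pverts \<Gamma>" "w \<noteq> v" "(v, w) \<notin> parcs \<Gamma>" by blast
    from central_imp_kill_eq[OF \<Gamma> \<open>v \<in> pverts \<Gamma>\<close> this z] insert show ?case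
      using kill_insert[OF \<Gamma> z(1), of v S] by simp
  qed
  then have "z = kill \<Gamma> (pverts \<Gamma>) z" by simp
  also have "\<dots> = (\<lambda>_. \<one>\<^bsub>raag \<Gamma>\<^esub>) z"
    using \<Gamma> by (intro raag_hom_eqI[OF group_raag kill_hom[OF \<Gamma>] _ _ z(1)]) (auto simp: kill_gen hom_def)
  finally show ?thesis .
qed

section \<open>Free products of two subgroups\<close>

text \<open>The letters are nontrivial, so for subgroups with trivial intersection
  \<open>y \<notin> A\<close> says that \<open>y\<close> comes from \<open>B\<close>. A single
  membership test therefore decides the type of a letter.\<close>

definition alternating :: "('g, 'c) monoid_scheme \<Rightarrow> 'g set \<Rightarrow> 'g set \<Rightarrow> 'g list \<Rightarrow> bool" where
  "alternating G A B l \<longleftrightarrow> set l \<subseteq> A \<union> B - {\<one>\<^bsub>G\<^esub>} \<and> successively (\<lambda>x y. x \<in> A \<longleftrightarrow> y \<notin> A) l"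

definition mprod :: "('g, 'c) monoid_scheme \<Rightarrow> 'g list \<Rightarrow> 'g" where
  "mprod G l = foldr (\<otimes>\<^bsub>G\<^esub>) l \<one>\<^bsub>G\<^esub>"

definition conj_set :: "('g, 'c) monoid_scheme \<Rightarrow> 'g \<Rightarrow> 'g set \<Rightarrow> 'g set" where
  "conj_set G g F = (\<lambda>x. g \<otimes>\<^bsub>G\<^esub> x \<otimes>\<^bsub>G\<^esub> inv\<^bsub>G\<^esub> g) ` F"

lemma mprod_simps [simp]:
  "mprod G [] = \<one>\<^bsub>G\<^esub>" "mprod G (x # l) = x \<otimes>\<^bsub>G\<^esub> mprod G l"
  by (simp_all add: mprod_def)

context group
begin

lemma mprod_closed [simp]: "set l \<subseteq> carrier G \<Longrightarrow> mprod G l \<in> carrier G"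
  by (induction l) auto

lemma mprod_append:
  "set l \<subseteq> carrier G \<Longrightarrow> set m \<subseteq> carrier G \<Longrightarrow> mprod G (l @ m) = mprod G l \<otimes> mprod G m"
  by (induction l) (auto simp: m_assoc)

lemma mprod_inv:
  "set l \<subseteq> carrier G \<Longrightarrow> mprod G (map (m_inv G) (rev l)) = inv (mprod G l)"
proof (induction l)
  case (Cons x l)
  then have "set (map (m_inv G) (rev l)) \<subseteq> carrier G" by auto
  then show ?case using Cons by (simp add: mprod_append inv_mult_group)
qed simp

lemma mprod_replicate:
  "set l \<subseteq> carrier G \<Longrightarrow> mprod G (concat (replicate n l)) = mprod G l [^] n"
proof (induction n)
  case (Suc n)
  then have "set (concat (replicate n l)) \<subseteq> carrier G" by auto
  then show ?case using Suc nat_pow_Suc2 by (simp add: mprod_append)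
qed simp

lemma conj_set_mult:
  "g \<in> carrier G \<Longrightarrow> h \<in> carrier G \<Longrightarrow> F \<subseteq> carrier G \<Longrightarrow>
    conj_set G g (conj_set G h F) = conj_set G (g \<otimes> h) F"
  unfolding conj_set_def image_image by (rule image_cong) (auto simp: conj_conj)

lemma conj_set_one: "F \<subseteq> carrier G \<Longrightarrow> conj_set G \<one> F = F"
  unfolding conj_set_def by (subst image_cong[where g = "\<lambda>x. x"]) auto

lemma conj_set_closed: "g \<in> carrier G \<Longrightarrow> F \<subseteq> carrier G \<Longrightarrow> conj_set G g F \<subseteq> carrier G"
  by (auto simp: conj_set_def)

lemma conj_set_subgroup:
  assumes "subgroup F G" "g \<in> F"
  shows "conj_set G g F = F"
proof -
  interpret F: subgroup F G by fact
  have sub: "conj_set G h F \<subseteq> F" if "h \<in> F" for h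
    using that by (auto simp: conj_set_def)
  have "F = conj_set G (g \<otimes> inv g) F" using assms F.subset by (simp add: conj_set_one)
  also have "\<dots> = conj_set G g (conj_set G (inv g) F)"
    using assms F.subset by (subst conj_set_mult) auto
  also have "\<dots> \<subseteq> conj_set G g F"
    using sub[of "inv g"] assms by (auto simp: conj_set_def)
  finally show ?thesis using sub[OF assms(2)] by blast
qed

lemma hom_conj_set:
  assumes "f \<in> auto G" "g \<in> carrier G" "F \<subseteq> carrier G"
  shows "f ` conj_set G g F = conj_set G (f g) (f ` F)"
proof -
  interpret f: group_hom G G f using assms by (simp add: auto_group_hom)
  show ?thesis
    using assms unfolding conj_set_def image_image by (intro image_cong) auto
qed

end

section \<open>Alternating words and left multiplication on them\<close>

locale disjoint_subgroups = group G for G :: "('g, 'c) monoid_scheme" (structure) +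
  fixes A B :: "'g set"
  assumes subgroups: "subgroup A G" "subgroup B G"
    and disjoint: "A \<inter> B = {\<one>}"
begin

sublocale A: subgroup A G by (rule subgroups)
sublocale B: subgroup B G by (rule subgroups)

abbreviation "alt \<equiv> alternating G A B"

lemma alt_Nil [simp]: "alt []" by (simp add: alternating_def)

lemma alt_Cons:
  "alt (x # l) \<longleftrightarrow> x \<in> A \<union> B \<and> x \<noteq> \<one> \<and> (l = [] \<or> (x \<in> A \<longleftrightarrow> hd l \<notin> A)) \<and> alt l"
  by (cases l) (auto simp: alternating_def)

lemma alt_append:
  "alt (l @ m) \<longleftrightarrow> alt l \<and> alt m \<and> (l = [] \<or> m = [] \<or> (last l \<in> A \<longleftrightarrow> hd m \<notin> A))"
  by (auto simp: alternating_def successively_append_iff)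

lemma alt_carrier: "alt l \<Longrightarrow> set l \<subseteq> carrier G"
  by (auto simp: alternating_def)

lemma notin_A: "x \<in> A \<union> B \<Longrightarrow> x \<noteq> \<one> \<Longrightarrow> x \<notin> A \<longleftrightarrow> x \<in> B"
  using disjoint by auto

lemma alt_last: "alt l \<Longrightarrow> l \<noteq> [] \<Longrightarrow> last l \<in> A \<union> B \<and> last l \<noteq> \<one>"
  and alt_hd: "alt l \<Longrightarrow> l \<noteq> [] \<Longrightarrow> hd l \<in> A \<union> B \<and> hd l \<noteq> \<one>"
  using last_in_set[of l] hd_in_set[of l] unfolding alternating_def by blast+

lemma inv_in_A_iff: "x \<in> carrier G \<Longrightarrow> inv x \<in> A \<longleftrightarrow> x \<in> A"
  by (metis A.m_inv_closed inv_inv)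

lemma alt_inv:
  assumes "alt l"
  shows "alt (map (m_inv G) (rev l))"
  using assms
proof (induction l)
  case (Cons x l)
  then have x: "x \<in> A \<union> B" "x \<noteq> \<one>" "x \<in> carrier G" by (auto simp: alt_Cons)
  have "l \<noteq> [] \<Longrightarrow> hd l \<in> carrier G" using Cons alt_hd[of l] by (auto simp: alt_Cons)
  then have "last (map (m_inv G) (rev l)) \<in> A \<longleftrightarrow> hd l \<in> A" if "l \<noteq> []"
    using that by (simp add: last_map last_rev inv_in_A_iff)
  then show ?case
    using Cons x by (auto simp: alt_append alt_Cons inv_in_A_iff)
qed simp

text \<open>Left multiplication carried out on alternating words. The identity is treated apart
  because it is not a letter and because membership in \<open>A\<close> does not determine its
  type.\<close>

definition lmul :: "'g \<Rightarrow> 'g list \<Rightarrow> 'g list" where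
  "lmul a l = (if a = \<one> then l else case l of [] \<Rightarrow> [a]
    | x # m \<Rightarrow> if (a \<in> A \<longleftrightarrow> x \<in> A) then if a \<otimes> x = \<one> then m else (a \<otimes> x) # m else a # l)"

lemma lmul_Cons: "alt (a # l) \<Longrightarrow> lmul a l = a # l"
  by (cases l) (auto simp: lmul_def alt_Cons)

lemma same_factor:
  assumes "a \<in> A \<union> B" "a \<noteq> \<one>" "x \<in> A \<union> B" "x \<noteq> \<one>" "a \<in> A \<longleftrightarrow> x \<in> A"
  shows "a \<otimes> x \<in> A \<union> B" "a \<otimes> x \<noteq> \<one> \<longrightarrow> (a \<otimes> x \<in> A \<longleftrightarrow> x \<in> A)"
proof -
  have "a \<in> A \<and> x \<in> A \<or> a \<in> B \<and> x \<in> B" using assms disjoint by auto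
  then show "a \<otimes> x \<in> A \<union> B" "a \<otimes> x \<noteq> \<one> \<longrightarrow> (a \<otimes> x \<in> A \<longleftrightarrow> x \<in> A)"
    using assms disjoint by auto
qed

lemma lmul_alt:
  assumes a: "a \<in> A \<union> B" and l: "alt l"
  shows "alt (lmul a l)" "mprod G (lmul a l) = a \<otimes> mprod G l"
proof -
  have "alt (lmul a l) \<and> mprod G (lmul a l) = a \<otimes> mprod G l"
  proof (cases "a = \<one> \<or> l = [] \<or> (a \<in> A \<longleftrightarrow> hd l \<notin> A)")
    case True
    then show ?thesis
      using a l alt_carrier[OF l] lmul_Cons[of a l] by (cases "a = \<one>") (auto simp: alt_Cons lmul_def[of \<one>])
  next
    case False
    then obtain x m where x: "l = x # m" "a \<in> A \<longleftrightarrow> x \<in> A" "a \<noteq> \<one>" by (cases l) auto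
    have m: "x \<in> A \<union> B" "x \<noteq> \<one>" "alt m" "m = [] \<or> (x \<in> A \<longleftrightarrow> hd m \<notin> A)"
      using l by (auto simp: x alt_Cons)
    have c: "a \<in> carrier G" "x \<in> carrier G" "mprod G m \<in> carrier G"
      using a m alt_carrier[OF m(3)] by auto
    have eq: "a \<otimes> (x \<otimes> mprod G m) = a \<otimes> x \<otimes> mprod G m" using c by (simp add: m_assoc)
    show ?thesis
      using same_factor[OF a x(3) m(1,2) x(2)] m x c by (auto simp: lmul_def alt_Cons eq)
  qed
  then show "alt (lmul a l)" "mprod G (lmul a l) = a \<otimes> mprod G l" by auto
qed

lemma lmul_one: "lmul \<one> l = l"
  by (simp add: lmul_def)

text \<open>Each factor acts on alternating words through \<open>lmul\<close>. The delicate cases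
  are those where \<open>b\<close> cancels the first letter or \<open>a\<close> cancels
  \<open>b\<close>; they are consistent because at most the first letter of \<open>l\<close> is ever
  affected.\<close>

lemma lmul_mult:
  assumes F: "F \<in> {A, B}" and a: "a \<in> F" and b: "b \<in> F" and l: "alt l"
  shows "lmul a (lmul b l) = lmul (a \<otimes> b) l"
proof (cases "a = \<one> \<or> b = \<one>")
  case True
  then show ?thesis using F a b by (auto simp: lmul_one)
next
  case False
  interpret F: subgroup F G using F subgroups by auto
  have c: "a \<in> carrier G" "b \<in> carrier G" using a b by auto
  have ab: "a \<otimes> b \<in> F" using a b by simp
  \<comment> \<open>All nontrivial elements of \<open>F\<close> have the same type, which treats
    both factors at once.\<close>
  have FA: "x \<in> A \<longleftrightarrow> F = A" if "x \<in> F" "x \<noteq> \<one>" for x using that F disjoint by auto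
  show ?thesis
  proof (cases l)
    case Nil
    then show ?thesis using False FA[OF a] FA[OF b] by (auto simp: lmul_def)
  next
    case (Cons x m)
    have x: "x \<in> A \<union> B" "x \<noteq> \<one>" "alt m" "m = [] \<or> (x \<in> A \<longleftrightarrow> hd m \<notin> A)"
      using l by (auto simp: Cons alt_Cons)
    then have xc: "x \<in> carrier G" by auto
    show ?thesis
    proof (cases "x \<in> F")
      case True
      have bx: "b \<otimes> x \<in> F" using b True by simp
      have same: "(a \<in> A \<longleftrightarrow> x \<in> A) \<and> (b \<in> A \<longleftrightarrow> x \<in> A)" using FA a b True x False by metis
      show ?thesis
      proof (cases "b \<otimes> x = \<one>")
        case bx1: True
        have abx: "a \<otimes> b \<otimes> x = a" using bx1 c xc by (simp add: m_assoc)
        have "alt (a # m)" using a F False same x by (auto simp: alt_Cons)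
        then have 1: "lmul a (lmul b l) = a # m"
          using bx1 same False by (simp add: Cons lmul_def[of b] lmul_Cons)
        show ?thesis
        proof (cases "a \<otimes> b = \<one>")
          case True
          then have "x = a" using abx xc by simp
          then show ?thesis using 1 True by (simp add: Cons lmul_one)
        next
          case False
          then have "a \<otimes> b \<in> A \<longleftrightarrow> x \<in> A" using FA[OF ab] FA[OF \<open>x \<in> F\<close>] x by simp
          then show ?thesis using 1 False \<open>\<not> (a = \<one> \<or> b = \<one>)\<close> by (simp add: Cons lmul_def[of "a \<otimes> b"] abx)
        qed
      next
        case bx1: False
        have bxA: "b \<otimes> x \<in> A \<longleftrightarrow> x \<in> A" using FA[OF bx bx1] FA[OF True] x by simp
        have assoc: "a \<otimes> (b \<otimes> x) = a \<otimes> b \<otimes> x" using c xc by (simp add: m_assoc)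
        have "lmul b l = (b \<otimes> x) # m" using same False bx1 by (simp add: Cons lmul_def)
        then have 1: "lmul a (lmul b l) = (if a \<otimes> b \<otimes> x = \<one> then m else (a \<otimes> b \<otimes> x) # m)"
          using same False bxA by (simp add: lmul_def assoc)
        show ?thesis
        proof (cases "a \<otimes> b = \<one>")
          case True
          then show ?thesis using 1 xc x by (simp add: Cons lmul_one)
        next
          case False
          then have "a \<otimes> b \<in> A \<longleftrightarrow> x \<in> A" using FA[OF ab] FA[OF \<open>x \<in> F\<close>] x by simp
          then show ?thesis using 1 False by (simp add: Cons lmul_def[of "a \<otimes> b"])
        qed
      qed
    next
      case False
      then have diff: "y \<in> A \<longleftrightarrow> x \<notin> A" if "y \<in> F" "y \<noteq> \<one>" for y
        using that FA[OF that] x F by auto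
      have "lmul b l = b # l" "a \<otimes> b \<noteq> \<one> \<Longrightarrow> lmul (a \<otimes> b) l = (a \<otimes> b) # l"
        using diff[OF b] diff[OF ab] \<open>\<not> (a = \<one> \<or> b = \<one>)\<close> by (simp_all add: Cons lmul_def)
      then show ?thesis
        using FA[OF a] FA[OF b] \<open>\<not> (a = \<one> \<or> b = \<one>)\<close>
        by (cases "a \<otimes> b = \<one>") (simp_all add: lmul_def[of a] lmul_one)
    qed
  qed
qed

lemma prepend_length:
  assumes "x \<in> A \<union> B" "alt m"
  shows "\<exists>n. alt n \<and> mprod G n = x \<otimes> mprod G m \<and> length n \<le> Suc (length m) \<and>
    (m \<noteq> [] \<and> (x \<in> A \<longleftrightarrow> hd m \<in> A) \<longrightarrow> length n \<le> length m)"
  using lmul_alt[OF assms] by (intro exI[of _ "lmul x m"]) (auto simp: lmul_def split: list.split)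

lemma mult_length:
  assumes "alt l" "alt m"
  shows "\<exists>n. alt n \<and> mprod G n = mprod G l \<otimes> mprod G m \<and> length n \<le> length l + length m"
  using assms(1)
proof (induction l)
  case Nil
  then show ?case using assms(2) alt_carrier by (intro exI[of _ m]) auto
next
  case (Cons x l)
  then obtain n where n: "alt n" "mprod G n = mprod G l \<otimes> mprod G m" "length n \<le> length l + length m"
    by (auto simp: alt_Cons)
  obtain n' where "alt n'" "mprod G n' = x \<otimes> mprod G n" "length n' \<le> Suc (length n)"
    using prepend_length[of x n] Cons.prems n by (auto simp: alt_Cons)
  then show ?case
    using n Cons.prems alt_carrier[OF Cons.prems] alt_carrier[OF assms(2)]
    by (intro exI[of _ n']) (auto simp: m_assoc)
qed

text \<open>The letters that meet belong to the same factor, so they merge into one letter or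
  cancel, and at least one letter is lost.\<close>

lemma mult_length_less:
  assumes l: "alt l" "l \<noteq> []" and m: "alt m" "m \<noteq> []" and same: "last l \<in> A \<longleftrightarrow> hd m \<in> A"
  shows "\<exists>n. alt n \<and> mprod G n = mprod G l \<otimes> mprod G m \<and> length n < length l + length m"
proof -
  have l': "alt (butlast l @ [last l])" using l by simp
  obtain n1 where n1: "alt n1" "mprod G n1 = last l \<otimes> mprod G m" "length n1 \<le> length m"
    using prepend_length[of "last l" m] same m alt_last[OF l] by blast
  obtain n where n: "alt n" "mprod G n = mprod G (butlast l) \<otimes> mprod G n1" "length n \<le> length (butlast l) + length n1"
    using mult_length[of "butlast l" n1] n1 l' by (auto simp: alt_append)
  have c: "set (butlast l) \<subseteq> carrier G" "last l \<in> carrier G" "set m \<subseteq> carrier G"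
    using alt_carrier[OF l'] alt_carrier[OF m(1)] by auto
  have "mprod G l = mprod G (butlast l) \<otimes> last l"
    using mprod_append[of "butlast l" "[last l]"] c l(2) by simp
  then have "mprod G n = mprod G l \<otimes> mprod G m"
    using n n1 c by (simp add: m_assoc)
  moreover have "length n < length l + length m"
  proof -
    have "0 < length l" using l(2) by simp
    then show ?thesis using n(3) n1(3) unfolding length_butlast by linarith
  qed
  ultimately show ?thesis using n by blast
qed

end

section \<open>Internal free products, described by unique alternating normal forms\<close>

locale free_product = disjoint_subgroups +
  assumes normal_form: "g \<in> carrier G \<Longrightarrow> \<exists>l. alternating G A B l \<and> mprod G l = g"
    and normal_form_unique: "alternating G A B l \<Longrightarrow> alternating G A B m \<Longrightarrow> mprod G l = mprod G m \<Longrightarrow> l = m"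
begin

text \<open>The test in \<open>alternating\<close> favours \<open>A\<close>. On nontrivial letters
  membership in \<open>B\<close> is the complementary test, so every fact proved for
  \<open>A\<close> transfers to \<open>B\<close>.\<close>

lemma free_product_commute: "free_product G B A"
proof -
  have "successively (\<lambda>x y. x \<in> B \<longleftrightarrow> y \<notin> B) l \<longleftrightarrow> successively (\<lambda>x y. x \<in> A \<longleftrightarrow> y \<notin> A) l"
    if "set l \<subseteq> A \<union> B - {\<one>}" for l
    using that notin_A by (intro successively_cong) auto
  then have "alternating G B A l \<longleftrightarrow> alt l" for l
    by (auto simp: alternating_def Un_commute)
  then show ?thesis
    using subgroups disjoint normal_form normal_form_unique
    by unfold_locales (auto simp: Int_commute)
qed

text \<open>Split off a final letter of \<open>A\<close> from the normal form of \<open>g\<close>,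
  leaving \<open>m1\<close>, and absorb it into \<open>x\<close>. If \<open>m1\<close> were
  nonempty, the conjugate would have the reduced form consisting of \<open>m1\<close>, one letter of
  \<open>A\<close>, and the inverse of \<open>m1\<close>. That is too long for an element of a
  factor.\<close>

lemma malnormal_A:
  assumes x: "x \<in> A" "x \<noteq> \<one>" and g: "g \<in> carrier G" and gx: "g \<otimes> x \<otimes> inv g \<in> A \<union> B"
  shows "g \<in> A"
proof (rule ccontr)
  assume gA: "g \<notin> A"
  obtain m where m: "alt m" "mprod G m = g" using normal_form[OF g] by blast
  have "\<exists>m1 a. alt m1 \<and> a \<in> A \<and> g = mprod G m1 \<otimes> a \<and> (m1 \<noteq> [] \<longrightarrow> last m1 \<notin> A)"
  proof (cases "m \<noteq> [] \<and> last m \<in> A")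
    case True
    then have m': "m = butlast m @ [last m]" by simp
    then have a: "alt (butlast m @ [last m])" using m by metis
    then have "alt (butlast m)" "butlast m \<noteq> [] \<longrightarrow> last (butlast m) \<notin> A"
      using True unfolding alt_append by auto
    moreover have "mprod G (butlast m @ [last m]) = mprod G (butlast m) \<otimes> last m"
      using mprod_append[of "butlast m" "[last m]"] alt_carrier[OF a] by simp
    then have "g = mprod G (butlast m) \<otimes> last m"
      using m(2) m' by metis
    ultimately show ?thesis using True by blast
  next
    case False
    then show ?thesis using m g by (intro exI[of _ m] exI[of _ \<one>]) auto
  qed
  then obtain m1 a where m1: "alt m1" "a \<in> A" "g = mprod G m1 \<otimes> a" "m1 \<noteq> [] \<longrightarrow> last m1 \<notin> A"
    by blast
  have c: "set m1 \<subseteq> carrier G" using alt_carrier m1 by blast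
  have ne: "m1 \<noteq> []" using gA m1 by auto
  define b where "b = a \<otimes> x \<otimes> inv a"
  have b: "b \<in> A" "b \<noteq> \<one>" using x m1(2) by (auto simp: b_def inv_solve_right')
  have lc: "last m1 \<in> carrier G" using c ne by auto
  have "hd (map (m_inv G) (rev m1)) \<notin> A"
    using ne m1(4) lc by (simp add: hd_map hd_rev inv_in_A_iff)
  then have alt: "alt (m1 @ b # map (m_inv G) (rev m1))"
    using m1 b ne alt_inv by (simp add: alt_append alt_Cons)
  have "set (map (m_inv G) (rev m1)) \<subseteq> carrier G" using c by auto
  then have "mprod G (m1 @ b # map (m_inv G) (rev m1)) = mprod G m1 \<otimes> (b \<otimes> inv (mprod G m1))"
    using b c by (simp add: mprod_append mprod_inv)
  also have "\<dots> = g \<otimes> x \<otimes> inv g"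
    using m1(2,3) x c by (simp add: b_def m_assoc inv_mult_group)
  finally have "mprod G (m1 @ b # map (m_inv G) (rev m1)) = mprod G [g \<otimes> x \<otimes> inv g]"
    using g x by simp
  moreover have "alt [g \<otimes> x \<otimes> inv g]"
    using gx g x by (auto simp: alt_Cons inv_solve_right')
  ultimately have "m1 @ b # map (m_inv G) (rev m1) = [g \<otimes> x \<otimes> inv g]"
    using normal_form_unique alt by blast
  then show False using ne by (cases m1) auto
qed

lemma malnormal:
  assumes "F \<in> {A, B}" "x \<in> F" "x \<noteq> \<one>" "g \<in> carrier G" "g \<otimes> x \<otimes> inv g \<in> A \<union> B"
  shows "g \<in> F"
proof -
  interpret BA: free_product G B A by (rule free_product_commute)
  show ?thesis using assms malnormal_A BA.malnormal_A by auto
qed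

lemma subgroup_factor: "F \<in> {A, B} \<Longrightarrow> subgroup F G"
  using subgroups by auto

lemma factor_centralizer:
  assumes F: "F \<in> {A, B}" and x: "x \<in> F" "x \<noteq> \<one>" and g: "g \<in> carrier G" "g \<otimes> x = x \<otimes> g"
  shows "g \<in> F"
proof -
  have "x \<in> carrier G" using F x by auto
  then have "g \<otimes> x \<otimes> inv g = x" using g by (simp add: inv_solve_right')
  then show ?thesis using malnormal[OF F x g(1)] F x by auto
qed

text \<open>Translating a common nontrivial element by \<open>inv g\<close> shows that
  \<open>inv g \<otimes> h\<close> conjugates a nontrivial element of \<open>F'\<close> into a
  factor. Malnormality then places \<open>inv g \<otimes> h\<close> in \<open>F'\<close>, and
  conjugation by an element of \<open>F'\<close> does not move \<open>F'\<close>.\<close>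

lemma conj_factor_unique:
  assumes F: "F \<in> {A, B}" "F' \<in> {A, B}" and gh: "g \<in> carrier G" "h \<in> carrier G"
    and x: "x \<noteq> \<one>" "x \<in> conj_set G g F" "x \<in> conj_set G h F'"
  shows "F = F' \<and> conj_set G g F = conj_set G h F'"
proof -
  obtain y y' where y: "y \<in> F" "x = g \<otimes> y \<otimes> inv g" and y': "y' \<in> F'" "x = h \<otimes> y' \<otimes> inv h"
    using x by (auto simp: conj_set_def)
  have c: "y \<in> carrier G" "y' \<in> carrier G" "F \<subseteq> carrier G" "F' \<subseteq> carrier G" using F y y' by auto
  have "g \<otimes> y \<otimes> inv g = h \<otimes> y' \<otimes> inv h" using y y' by simp
  then have "inv g \<otimes> (g \<otimes> y \<otimes> inv g) \<otimes> g = inv g \<otimes> (h \<otimes> y' \<otimes> inv h) \<otimes> g" by simp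
  then have eq: "y = (inv g \<otimes> h) \<otimes> y' \<otimes> inv (inv g \<otimes> h)"
    using c gh by (simp add: m_assoc inv_mult_group)
  have "y' \<noteq> \<one>" using x y' gh by auto
  moreover have "inv g \<otimes> h \<otimes> y' \<otimes> inv (inv g \<otimes> h) \<in> A \<union> B" using eq y F by auto
  ultimately have k: "inv g \<otimes> h \<in> F'" using malnormal[OF F(2) y'(1)] gh by auto
  interpret F': subgroup F' G using F by (auto intro: subgroup_factor)
  have "y \<in> F'" using eq k y' F'.m_closed F'.m_inv_closed by simp
  moreover have "y \<noteq> \<one>" using x y gh by auto
  ultimately have "F = F'" using F y disjoint by auto
  moreover have "conj_set G h F' = conj_set G g (conj_set G (inv g \<otimes> h) F')"
    using gh c by (simp add: conj_set_mult)
  ultimately show ?thesis using conj_set_subgroup[OF F'.subgroup_axioms k] by simp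
qed

text \<open>
  Here the word \<open>l\<close> is cyclically reduced. If \<open>m\<close> is also cyclically reduced, then after possibly
  inverting it both concatenations are reduced, so \<open>l\<close> and \<open>m\<close> commute as words. Otherwise exactly one
  of the two concatenations is reduced, and the lengths of the normal forms differ.
\<close>

lemma commute_cyclically_reduced:
  assumes l: "alt l" "l \<noteq> []" "last l \<in> A \<longleftrightarrow> hd l \<notin> A" and y: "y \<in> carrier G"
    and comm: "mprod G l \<otimes> y = y \<otimes> mprod G l"
  shows "\<exists>(i :: int) (j :: int). j \<noteq> 0 \<and> mprod G l [^] i = y [^] j"
proof -
  have lc: "mprod G l \<in> carrier G" using alt_carrier[OF l(1)] by simp
  have words: "\<exists>(i :: int) (j :: int). j \<noteq> 0 \<and> mprod G l [^] i = mprod G m [^] j"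
    if m: "alt m" "m \<noteq> []" "last l \<in> A \<longleftrightarrow> hd m \<notin> A" "last m \<in> A \<longleftrightarrow> hd l \<notin> A"
      and comm: "mprod G l \<otimes> mprod G m = mprod G m \<otimes> mprod G l" for m
  proof -
    have "alt (l @ m)" "alt (m @ l)" using l m by (auto simp: alt_append)
    moreover have "mprod G (l @ m) = mprod G (m @ l)"
      using comm alt_carrier l m by (simp add: mprod_append)
    ultimately have "l @ m = m @ l" by (rule normal_form_unique)
    \<comment> \<open>Lists that commute under concatenation are powers of a common list. The
      multiplicity \<open>p\<close> is nonzero because \<open>l\<close> is nonempty, and it becomes
      the exponent of the second element.\<close>
    then obtain p q zs where pq: "concat (replicate p zs) = l" "concat (replicate q zs) = m"
      using comm_append_are_replicate by blast
    have p: "p \<noteq> 0" using pq l by auto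
    have zs: "set zs \<subseteq> carrier G" using pq(1) p alt_carrier[OF l(1)] by (cases p) auto
    have "mprod G l = mprod G zs [^] p" "mprod G m = mprod G zs [^] q"
      using mprod_replicate[OF zs] pq by auto
    then have "mprod G l [^] int q = mprod G m [^] int p"
      using zs by (simp add: int_pow_int nat_pow_pow mult.commute)
    then show ?thesis using p by (intro exI[of _ "int q"] exI[of _ "int p"]) auto
  qed
  obtain m where m: "alt m" "mprod G m = y" using normal_form[OF y] by blast
  consider "m = []" | "m \<noteq> []" "last l \<in> A \<longleftrightarrow> hd m \<notin> A" "last m \<in> A \<longleftrightarrow> hd l \<notin> A"
    | "m \<noteq> []" "last l \<in> A \<longleftrightarrow> hd m \<in> A" "last m \<in> A \<longleftrightarrow> hd l \<in> A"
    | "m \<noteq> []" "(last l \<in> A \<longleftrightarrow> hd m \<in> A) \<noteq> (last m \<in> A \<longleftrightarrow> hd l \<in> A)"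
    by blast
  then show ?thesis
  proof cases
    case 1
    then show ?thesis using m by (intro exI[of _ 0] exI[of _ 1]) auto
  next
    case 2
    then show ?thesis using words[of m] m comm by simp
  next
    case 3
    let ?m = "map (m_inv G) (rev m)"
    have hl: "hd m \<in> carrier G" "last m \<in> carrier G"
      using alt_carrier[OF m(1)] 3 by auto
    have inv: "mprod G ?m = inv y" using mprod_inv alt_carrier m by auto
    have "mprod G l \<otimes> inv y = inv y \<otimes> mprod G l"
      using comm y lc by (metis inv_solve_left inv_solve_right' m_assoc inv_closed m_closed)
    then obtain i j :: int where ij: "j \<noteq> 0" "mprod G l [^] i = inv y [^] j"
      using words[of ?m] alt_inv[OF m(1)] 3 l hl inv
      by (auto simp: hd_map hd_rev last_map last_rev inv_in_A_iff)
    then have "mprod G l [^] i = y [^] (- j)" using y by (simp add: int_pow_inv int_pow_neg)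
    then show ?thesis using ij by (intro exI[of _ i] exI[of _ "- j"]) auto
  next
    case 4
    have "\<exists>n n'. alt n \<and> alt n' \<and> mprod G n = mprod G n' \<and> length n \<noteq> length n'"
    proof (cases "last l \<in> A \<longleftrightarrow> hd m \<in> A")
      case True
      then obtain n where "alt n" "mprod G n = mprod G l \<otimes> mprod G m" "length n < length l + length m"
        using mult_length_less l m 4 by blast
      moreover have "alt (m @ l)" using True 4 m l by (auto simp: alt_append)
      moreover have "mprod G (m @ l) = mprod G m \<otimes> mprod G l"
        using alt_carrier m l by (simp add: mprod_append)
      ultimately show ?thesis using comm m by (intro exI[of _ n] exI[of _ "m @ l"]) auto
    next
      case False
      then obtain n where "alt n" "mprod G n = mprod G m \<otimes> mprod G l" "length n < length m + length l"
        using mult_length_less[of m l] l m 4 by blast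
      moreover have "alt (l @ m)" using False 4 m l by (auto simp: alt_append)
      moreover have "mprod G (l @ m) = mprod G l \<otimes> mprod G m"
        using alt_carrier m l by (simp add: mprod_append)
      ultimately show ?thesis using comm m by (intro exI[of _ n] exI[of _ "l @ m"]) auto
    qed
    then show ?thesis using normal_form_unique by blast
  qed
qed

text \<open>If both ends of a word of length at least two lie in the same factor, conjugation moves
  the first letter to the end, where it merges with or cancels the last one. The normal form becomes
  shorter.\<close>

lemma conj_cyclically_reduced:
  assumes "alt l"
  shows "\<exists>h\<in>carrier G. \<exists>m. alt m \<and> h \<otimes> mprod G l \<otimes> inv h = mprod G m \<and>
    (length m \<le> 1 \<or> (last m \<in> A \<longleftrightarrow> hd m \<notin> A))"
  using assms
proof (induction "length l" arbitrary: l rule: less_induct)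
  case less
  have lc: "mprod G l \<in> carrier G" using alt_carrier[OF less.prems] by simp
  show ?case
  proof (cases "length l \<le> 1 \<or> (last l \<in> A \<longleftrightarrow> hd l \<notin> A)")
    case True
    then show ?thesis using less.prems lc by (intro bexI[of _ \<one>] exI[of _ l]) auto
  next
    case False
    then obtain x t where xt: "l = x # t" "t \<noteq> []" by (cases l; cases "tl l") auto
    have t: "alt t" "alt [x]" and same: "last t \<in> A \<longleftrightarrow> x \<in> A"
      using less.prems False xt by (auto simp: alt_Cons)
    obtain n where n: "alt n" "mprod G n = mprod G t \<otimes> mprod G [x]" "length n < length t + length [x]"
      using mult_length_less[OF t(1) xt(2) t(2)] same by auto
    have c: "x \<in> carrier G" "mprod G t \<in> carrier G"
      using alt_carrier[OF t(1)] alt_carrier[OF t(2)] by auto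
    have n': "mprod G n = inv x \<otimes> mprod G l \<otimes> x" using n c by (simp add: xt m_assoc)
    obtain h m where hm: "h \<in> carrier G" "alt m" "h \<otimes> mprod G n \<otimes> inv h = mprod G m"
        "length m \<le> 1 \<or> (last m \<in> A \<longleftrightarrow> hd m \<notin> A)"
      using less.hyps[of n] n xt by auto
    have "(h \<otimes> inv x) \<otimes> mprod G l \<otimes> inv (h \<otimes> inv x) = mprod G m"
      using hm(1,3) n' c lc by (simp add: m_assoc inv_mult_group)
    then show ?thesis using hm c by (intro bexI[of _ "h \<otimes> inv x"] exI[of _ m]) auto
  qed
qed

text \<open>Conjugate \<open>x\<close> to a cyclically reduced word. If its ends lay in different
  factors, commutation would force a relation between powers that \<open>indep\<close> forbids. So
  the word is a single letter, and the centralizer of a nontrivial letter stays inside its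
  factor.\<close>

lemma commuting_in_common_conjugate:
  assumes x: "x \<in> carrier G" "x \<noteq> \<one>" and y: "y \<in> carrier G" and comm: "x \<otimes> y = y \<otimes> x"
    and indep: "\<And>(i :: int) (j :: int). x [^] i = y [^] j \<Longrightarrow> j = 0"
  shows "\<exists>F\<in>{A, B}. \<exists>g\<in>carrier G. x \<in> conj_set G g F \<and> y \<in> conj_set G g F"
proof -
  obtain l where l: "alt l" "mprod G l = x" using normal_form[OF x(1)] by blast
  obtain h m where hm: "h \<in> carrier G" "alt m" "h \<otimes> x \<otimes> inv h = mprod G m"
      "length m \<le> 1 \<or> (last m \<in> A \<longleftrightarrow> hd m \<notin> A)"
    using conj_cyclically_reduced[OF l(1)] l(2) by blast
  interpret c: group_hom G G "\<lambda>z. h \<otimes> z \<otimes> inv h"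
    using conjugation_is_hom hm(1) by unfold_locales (auto simp: hom_def m_assoc)
  define y' where "y' = h \<otimes> y \<otimes> inv h"
  have y': "y' \<in> carrier G" using y hm by (simp add: y'_def)
  have ne: "m \<noteq> []" using hm x by (auto simp: inv_solve_right')
  have comm': "mprod G m \<otimes> y' = y' \<otimes> mprod G m"
    using c.hom_mult[OF x(1) y] c.hom_mult[OF y x(1)] comm hm(3) by (simp add: y'_def)
  have "\<not> (last m \<in> A \<longleftrightarrow> hd m \<notin> A)"
  proof
    assume "last m \<in> A \<longleftrightarrow> hd m \<notin> A"
    then obtain i j :: int where ij: "j \<noteq> 0" "mprod G m [^] i = y' [^] j"
      using commute_cyclically_reduced[OF hm(2) ne _ y' comm'] by blast
    then have "h \<otimes> (x [^] i) \<otimes> inv h = h \<otimes> (y [^] j) \<otimes> inv h"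
      using c.hom_int_pow[OF x(1), of i] c.hom_int_pow[OF y, of j] hm(3) by (simp add: y'_def)
    then have "x [^] i = y [^] j" using conj_eq_iff hm x y by simp
    then show False using indep ij by blast
  qed
  then obtain a where a: "m = [a]" using hm(4) ne by (cases m) auto
  then have aF: "a \<in> A \<union> B" "a \<noteq> \<one>" and ac: "a \<in> carrier G" using hm(2) by (auto simp: alt_Cons)
  then obtain F where F: "F \<in> {A, B}" "a \<in> F" by auto
  have "y' \<in> F" using factor_centralizer[OF F aF(2) y'] comm' a ac by simp
  moreover have "x = inv h \<otimes> a \<otimes> inv (inv h)" "y = inv h \<otimes> y' \<otimes> inv (inv h)"
    using hm(1,3) a ac x y by (auto simp: y'_def m_assoc inv_solve_left)
  ultimately have "x \<in> conj_set G (inv h) F" "y \<in> conj_set G (inv h) F"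
    using F unfolding conj_set_def by blast+
  then show ?thesis using F hm(1) by blast
qed

end

section \<open>Automorphisms of a free product\<close>

context free_product
begin

text \<open>
  Suppose \<open>f\<close> maps \<open>A\<close> to itself and \<open>B\<close> to \<open>h B h\<inverse>\<close>, where the normal form of \<open>h\<close> starts in \<open>B\<close>
  and ends in \<open>A\<close>. Substituting the normal forms of the images into a normal form causes no
  cancellation, so no letter of \<open>B\<close> lies in the image of \<open>f\<close>.
\<close>

lemma no_long_conjugator:
  assumes f: "f \<in> auto G" and fA: "f ` A = A" and fB: "f ` B = conj_set G (mprod G m) B"
    and m: "alt m" "m \<noteq> []" "hd m \<notin> A" "last m \<in> A" and B: "B \<noteq> {\<one>}"
  shows False
proof -
  interpret f: group_hom G G f using f by (rule auto_group_hom)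
  have f1: "f x \<noteq> \<one>" if "x \<in> carrier G" "x \<noteq> \<one>" for x
    using that auto_inj[OF f] f.hom_one by (metis inj_onD one_closed)
  define h where "h = mprod G m"
  let ?m = "map (m_inv G) (rev m)"
  have mc: "set m \<subseteq> carrier G" "h \<in> carrier G" using alt_carrier[OF m(1)] by (auto simp: h_def)
  have mc': "set ?m \<subseteq> carrier G" using mc by auto
  define \<beta> where "\<beta> b = inv h \<otimes> f b \<otimes> h" for b
  have \<beta>: "\<beta> b \<in> B" "f b = h \<otimes> \<beta> b \<otimes> inv h" if "b \<in> B" for b
  proof -
    obtain c where c: "c \<in> B" "f b = h \<otimes> c \<otimes> inv h" using fB \<open>b \<in> B\<close> by (auto simp: conj_set_def h_def)
    then have "\<beta> b = c" using mc by (simp add: \<beta>_def m_assoc)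
    then show "\<beta> b \<in> B" "f b = h \<otimes> \<beta> b \<otimes> inv h" using c by auto
  qed
  \<comment> \<open>The block replacing a letter begins and ends with letters of the same type as
    that letter: \<open>m\<close> begins outside \<open>A\<close>, and hence its inverse ends
    outside \<open>A\<close>. Consecutive blocks therefore do not interact.\<close>
  define sub where "sub x = (if x \<in> A then [f x] else m @ [\<beta> x] @ ?m)" for x
  have sub: "alt (sub x) \<and> sub x \<noteq> [] \<and> (hd (sub x) \<in> A \<longleftrightarrow> x \<in> A) \<and> (last (sub x) \<in> A \<longleftrightarrow> x \<in> A)
      \<and> mprod G (sub x) = f x" if x: "x \<in> A \<union> B" "x \<noteq> \<one>" for x
  proof (cases "x \<in> A")
    case True
    then have "f x \<in> A" "f x \<noteq> \<one>" using fA f1[of x] x by auto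
    then show ?thesis using True by (simp add: sub_def alt_Cons)
  next
    case False
    then have xB: "x \<in> B" using x by auto
    have \<beta>1: "\<beta> x \<noteq> \<one>" using f1[of x] \<beta>[OF xB] xB x mc by auto
    then have \<beta>A: "\<beta> x \<notin> A" using \<beta>(1)[OF xB] disjoint by auto
    have hl: "hd m \<in> carrier G" "last m \<in> carrier G" using mc m(2) by auto
    then have "hd ?m \<in> A" "last ?m \<notin> A"
      using m by (simp_all add: hd_map hd_rev last_map last_rev inv_in_A_iff)
    then have "alt (sub x)" "last (sub x) \<notin> A"
      using m \<beta>1 \<beta>A \<beta>(1)[OF xB] alt_inv[OF m(1)] False by (simp_all add: sub_def alt_append alt_Cons)
    moreover have "mprod G (sub x) = f x"
      using \<beta>[OF xB] mc mc' False
      by (simp add: sub_def mprod_append mprod_inv m_assoc flip: h_def)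
    ultimately show ?thesis using m False by (simp add: sub_def)
  qed
  have concat: "alt (concat (map sub l)) \<and> (l \<noteq> [] \<longrightarrow> concat (map sub l) \<noteq> [] \<and>
      (hd (concat (map sub l)) \<in> A \<longleftrightarrow> hd l \<in> A)) \<and> mprod G (concat (map sub l)) = f (mprod G l)"
    if "alt l" for l
    using that
  proof (induction l)
    case (Cons x l)
    have x: "x \<in> A \<union> B" "x \<noteq> \<one>" "alt l" "l = [] \<or> (x \<in> A \<longleftrightarrow> hd l \<notin> A)"
      using Cons.prems by (auto simp: alt_Cons)
    note s = sub[OF x(1,2)] and IH = Cons.IH[OF x(3)]
    have "mprod G (sub x @ concat (map sub l)) = f x \<otimes> f (mprod G l)"
      using mprod_append[OF alt_carrier alt_carrier] s IH by metis
    also have "\<dots> = f (x \<otimes> mprod G l)"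
      using x alt_carrier[OF x(3)] by auto
    finally show ?case using s IH x by (auto simp: alt_append)
  qed simp
  \<comment> \<open>Surjectivity of \<open>f\<close> is now contradicted: the normal form of a
    preimage of \<open>b\<close> would have to start outside \<open>A\<close>, but the block of such
    a letter is already longer than \<open>[b]\<close>.\<close>
  obtain b where b: "b \<in> B" "b \<noteq> \<one>" using B B.one_closed by auto
  obtain g where g: "g \<in> carrier G" "f g = b" using auto_surj[OF f] b B.mem_carrier by (metis imageE)
  obtain l where l: "alt l" "mprod G l = g" using normal_form[OF g(1)] by blast
  have bA: "b \<notin> A" using b disjoint by auto
  have "alt [b]" "mprod G [b] = b" using b by (auto simp: alt_Cons)
  then have eq: "concat (map sub l) = [b]"
    using concat[OF l(1)] l(2) g(2) by (intro normal_form_unique) auto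
  then obtain x l' where x: "l = x # l'" by (cases l) auto
  then have "x \<notin> A" using concat[OF l(1)] eq bA by auto
  then have "length (concat (map sub l)) > 1" using m(2) by (cases m) (auto simp: x sub_def)
  then show False using eq by simp
qed

text \<open>Write \<open>inv g \<otimes> h\<close> as a product of some \<open>a\<close> in
  \<open>A\<close>, a word \<open>m2\<close> and some \<open>b\<close> in \<open>B\<close>, where
  \<open>m2\<close>, unless empty, starts outside \<open>A\<close> and ends in \<open>A\<close>.
  Conjugation by the inverse of \<open>g \<otimes> a\<close> brings the image of \<open>A\<close>
  back to \<open>A\<close> and the image of \<open>B\<close> to the conjugate of \<open>B\<close> by
  \<open>m2\<close>; the factor \<open>b\<close> is absorbed by \<open>B\<close>. A nonempty
  \<open>m2\<close> is excluded by \<open>no_long_conjugator\<close>.\<close>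

lemma normalize_automorphism:
  assumes f: "f \<in> auto G" and g: "g \<in> carrier G" "f ` A = conj_set G g A"
    and h: "h \<in> carrier G" "f ` B = conj_set G h B" and B: "B \<noteq> {\<one>}"
  shows "\<exists>k\<in>carrier G. conj_set G k (f ` A) = A \<and> conj_set G k (f ` B) = B"
proof -
  have AB: "A \<subseteq> carrier G" "B \<subseteq> carrier G" by auto
  obtain m where m: "alt m" "mprod G m = inv g \<otimes> h" using normal_form g h by blast
  obtain a m1 where a: "a \<in> A" "inv g \<otimes> h = a \<otimes> mprod G m1" "alt m1" "m1 \<noteq> [] \<longrightarrow> hd m1 \<notin> A"
  proof (cases "m \<noteq> [] \<and> hd m \<in> A")
    case True
    then obtain x m' where "m = x # m'" by (cases m) auto
    then show thesis using that[of x m'] True m by (auto simp: alt_Cons)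
  next
    case False
    then show thesis using that[of \<one> m] g h m by auto
  qed
  obtain b m2 where b: "b \<in> B" "mprod G m1 = mprod G m2 \<otimes> b" "alt m2"
    "m2 \<noteq> [] \<longrightarrow> hd m2 \<notin> A \<and> last m2 \<in> A"
  proof (cases "m1 \<noteq> [] \<and> last m1 \<notin> A")
    case True
    then have eq: "butlast m1 @ [last m1] = m1" by simp
    then have alt: "alt (butlast m1 @ [last m1])" using a by simp
    then have "alt (butlast m1)" "butlast m1 \<noteq> [] \<longrightarrow> last (butlast m1) \<in> A"
      using True unfolding alt_append by auto
    moreover have "hd (butlast m1) \<notin> A" if "butlast m1 \<noteq> []"
      using that a(4) True by (metis eq hd_append2)
    moreover have "mprod G m1 = mprod G (butlast m1) \<otimes> last m1"
      using mprod_append[of "butlast m1" "[last m1]"] alt_carrier[OF \<open>alt (butlast m1)\<close>]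
        alt_last[OF a(3)] eq True by auto
    moreover have "last m1 \<in> B" using alt_last[OF a(3)] True by auto
    ultimately show thesis using that by blast
  next
    case False
    then show thesis using that[of \<one> m1] a alt_carrier[OF a(3)] by auto
  qed
  have c: "a \<in> carrier G" "b \<in> carrier G" "mprod G m2 \<in> carrier G" using a b alt_carrier[OF b(3)] by auto
  define k where "k = inv (g \<otimes> a)"
  have k: "k \<in> carrier G" using g c by (simp add: k_def)
  have kA: "conj_set G k (f ` A) = A"
  proof -
    have "conj_set G k (f ` A) = conj_set G (inv a) A"
      using g c AB k by (simp add: conj_set_mult k_def inv_mult_group m_assoc)
    then show ?thesis using conj_set_subgroup[OF subgroups(1)] a by simp
  qed
  have "h = g \<otimes> (a \<otimes> (mprod G m2 \<otimes> b))"
    using g h a(2) b(2) by (metis inv_closed inv_solve_left m_closed c(1) mprod_closed alt_carrier a(3))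
  then have "k \<otimes> h = mprod G m2 \<otimes> b"
    using g c by (simp add: k_def inv_mult_group m_assoc)
  then have kB: "conj_set G k (f ` B) = conj_set G (mprod G m2) B"
    using h k c AB b(1) conj_set_mult[of "mprod G m2" b B] conj_set_subgroup[OF subgroups(2)]
    by (simp add: conj_set_mult)
  have "m2 = []"
  proof (rule ccontr)
    assume ne: "m2 \<noteq> []"
    let ?f = "compose (carrier G) (\<lambda>x\<in>carrier G. k \<otimes> x \<otimes> inv k) f"
    have im: "?f ` F = conj_set G k (f ` F)" if "F \<subseteq> carrier G" for F
      using that k auto_closed[OF f] unfolding conj_set_def image_image
      by (intro image_cong) (auto simp: compose_def)
    have "?f \<in> auto G" using compose_auto[OF conj_in_auto[OF k] f] .
    moreover have "?f ` A = A" "?f ` B = conj_set G (mprod G m2) B"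
      using kA kB im AB by auto
    ultimately show False using no_long_conjugator[of ?f m2] ne b B by blast
  qed
  then have "conj_set G k (f ` B) = B" using kB AB conj_set_one by simp
  then show ?thesis using kA k by blast
qed

lemma conj_set_inverse:
  "g \<in> carrier G \<Longrightarrow> F \<subseteq> carrier G \<Longrightarrow> F' = conj_set G g F \<Longrightarrow> F = conj_set G (inv g) F'"
  by (simp add: conj_set_mult conj_set_one)

text \<open>\<open>elliptic\<close> provides inclusions only. Applying it to the inverse
  \<open>r\<close> as well encloses \<open>r\<close> of the conjugate between \<open>F\<close> and
  another conjugate of a factor; these share a nontrivial element and hence coincide, so the
  inclusion is an equality. If both images were conjugates of the same factor, pulling back a
  nontrivial element of it would put one element into conjugates of both \<open>A\<close> and
  \<open>B\<close>.\<close>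

lemma automorphism_permutes_factors:
  assumes nontriv: "A \<noteq> {\<one>}" "B \<noteq> {\<one>}"
    and elliptic: "\<And>f F. f \<in> auto G \<Longrightarrow> F \<in> {A, B} \<Longrightarrow>
      \<exists>F'\<in>{A, B}. \<exists>g\<in>carrier G. f ` F \<subseteq> conj_set G g F'"
    and f: "f \<in> auto G"
  shows "\<exists>g\<in>carrier G. \<exists>h\<in>carrier G. f ` A = conj_set G g A \<and> f ` B = conj_set G h B \<or>
    f ` A = conj_set G g B \<and> f ` B = conj_set G h A"
proof -
  have sub: "F \<subseteq> carrier G" if "F \<in> {A, B}" for F using that by auto
  have ne: "\<exists>x\<in>F. x \<noteq> \<one>" if "F \<in> {A, B}" for F using that nontriv by auto
  obtain r where r: "r \<in> auto G" "\<And>x. x \<in> carrier G \<Longrightarrow> r (f x) = x" "\<And>x. x \<in> carrier G \<Longrightarrow> f (r x) = x"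
    using auto_inverse[OF f] by blast
  interpret r: group_hom G G r using r(1) by (rule auto_group_hom)
  have rf: "r ` f ` X = X" "f ` r ` X = X" if "X \<subseteq> carrier G" for X
    using that r(2,3) image_cong[of X X "\<lambda>x. r (f x)" "\<lambda>x. x"] image_cong[of X X "\<lambda>x. f (r x)" "\<lambda>x. x"]
    unfolding image_image by (simp_all add: subset_iff)
  have exact: "\<exists>F'\<in>{A, B}. \<exists>g\<in>carrier G. f ` F = conj_set G g F'" if F: "F \<in> {A, B}" for F
  proof -
    obtain F' g where F': "F' \<in> {A, B}" "g \<in> carrier G" "f ` F \<subseteq> conj_set G g F'"
      using elliptic[OF f F] by blast
    obtain F'' h where F'': "F'' \<in> {A, B}" "h \<in> carrier G" "r ` F' \<subseteq> conj_set G h F''"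
      using elliptic[OF r(1) F'(1)] by blast
    have rg: "r g \<in> carrier G" using F' by simp
    have "r ` conj_set G g F' = conj_set G (r g) (r ` F')" using hom_conj_set[OF r(1) F'(2) sub[OF F'(1)]] .
    also have "\<dots> \<subseteq> conj_set G (r g) (conj_set G h F'')" using F''(3) by (auto simp: conj_set_def)
    also have "\<dots> = conj_set G (r g \<otimes> h) F''" using conj_set_mult[OF rg F''(2) sub[OF F''(1)]] .
    finally have 1: "r ` conj_set G g F' \<subseteq> conj_set G (r g \<otimes> h) F''" .
    have "F = r ` f ` F" using rf sub[OF F] by simp
    also have "\<dots> \<subseteq> r ` conj_set G g F'" using F'(3) by blast
    finally have 2: "F \<subseteq> r ` conj_set G g F'" .
    obtain x where x: "x \<in> F" "x \<noteq> \<one>" using ne[OF F] by blast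
    have "x \<in> conj_set G \<one> F" using x(1) conj_set_one[OF sub[OF F]] by simp
    moreover have "x \<in> conj_set G (r g \<otimes> h) F''" using 1 2 x(1) by auto
    ultimately have "conj_set G \<one> F = conj_set G (r g \<otimes> h) F''"
      by (rule conj_factor_unique[OF F F''(1) one_closed m_closed[OF rg F''(2)] x(2), THEN conjunct2])
    then have "r ` conj_set G g F' \<subseteq> F" using 1 conj_set_one[OF sub[OF F]] by simp
    then have "f ` r ` conj_set G g F' \<subseteq> f ` F" by blast
    then have "conj_set G g F' \<subseteq> f ` F" using rf conj_set_closed[OF F'(2) sub[OF F'(1)]] by simp
    then show ?thesis using F' by blast
  qed
  obtain F1 g where g: "F1 \<in> {A, B}" "g \<in> carrier G" "f ` A = conj_set G g F1" using exact[of A] by blast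
  obtain F2 h where h: "F2 \<in> {A, B}" "h \<in> carrier G" "f ` B = conj_set G h F2" using exact[of B] by blast
  have pull: "r ` F' = conj_set G (r (inv g)) F" if "F \<in> {A, B}" "F' \<in> {A, B}" "g \<in> carrier G" "f ` F = conj_set G g F'"
    for F F' g
  proof -
    have "f ` F \<subseteq> carrier G" using sub[OF that(1)] auto_closed[OF f] by auto
    moreover have "F' = conj_set G (inv g) (f ` F)" using conj_set_inverse[OF that(3) sub[OF that(2)] that(4)] .
    ultimately show ?thesis
      using hom_conj_set[OF r(1), of "inv g" "f ` F"] that(3) rf sub[OF that(1)] by simp
  qed
  have "F1 \<noteq> F2"
  proof
    assume eq: "F1 = F2"
    obtain x where x: "x \<in> F1" "x \<noteq> \<one>" using ne[OF g(1)] by blast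
    have xc: "x \<in> carrier G" using x sub[OF g(1)] by blast
    have "r x \<noteq> \<one>" using r(3)[OF xc] r(3)[OF one_closed] x(2) by auto
    moreover have "r x \<in> conj_set G (r (inv g)) A" "r x \<in> conj_set G (r (inv h)) B"
      using pull[of A F1 g] pull[of B F2 h] g h eq x by auto
    ultimately have "A = B"
      using conj_factor_unique[of A B "r (inv g)" "r (inv h)" "r x"] g(2) h(2) by auto
    then show False using disjoint nontriv by auto
  qed
  then show ?thesis using g h by blast
qed

end

section \<open>Right-angled Artin groups of disconnected graphs\<close>

definition factor :: "'v pair_pre_digraph \<Rightarrow> 'v set \<Rightarrow> 'v word set set" where
  "factor \<Gamma> S = generate (raag \<Gamma>) (raag_gen \<Gamma> ` S)"

lemma factor_subgroup: "S \<subseteq> pverts \<Gamma> \<Longrightarrow> subgroup (factor \<Gamma> S) (raag \<Gamma>)"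
  unfolding factor_def by (intro group.generate_is_subgroup[OF group_raag]) auto

lemma gen_in_factor: "v \<in> S \<Longrightarrow> raag_gen \<Gamma> v \<in> factor \<Gamma> S"
  unfolding factor_def by (intro generate.incl) auto

lemma factor_hom_eq:
  assumes H: "group H" and h: "h \<in> hom (raag \<Gamma>) H" "k \<in> hom (raag \<Gamma>) H"
    and eq: "\<And>v. v \<in> S \<Longrightarrow> h (raag_gen \<Gamma> v) = k (raag_gen \<Gamma> v)"
    and S: "S \<subseteq> pverts \<Gamma>" and x: "x \<in> factor \<Gamma> S"
  shows "h x = k x"
proof -
  interpret h: group_hom "raag \<Gamma>" H h
    using H h group_raag by (simp add: group_hom_def group_hom_axioms_def)
  interpret k: group_hom "raag \<Gamma>" H k
    using H h group_raag by (simp add: group_hom_def group_hom_axioms_def)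
  have c: "x \<in> carrier (raag \<Gamma>)" if "x \<in> generate (raag \<Gamma>) (raag_gen \<Gamma> ` S)" for x
    using that subgroup.mem_carrier[OF factor_subgroup[OF S]] by (simp add: factor_def)
  show ?thesis using x unfolding factor_def
    by (induction rule: generate.induct) (use S eq in \<open>auto simp: c\<close>)
qed

text \<open>The van der Waerden argument: vertices act on alternating words by left multiplication,
  and every relation stays inside one factor, where \<open>lmul\<close> is an action. The product of
  an alternating word carries the empty word to that word, which gives uniqueness. Killing
  \<open>T\<close> separates the two factors.\<close>

lemma raag_free_product:
  assumes \<Gamma>: "pair_graph \<Gamma>" and ST: "pverts \<Gamma> = S \<union> T" "S \<inter> T = {}"
    and arcs: "\<And>v w. (v, w) \<in> parcs \<Gamma> \<Longrightarrow> v \<in> S \<longleftrightarrow> w \<in> S"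
  shows "free_product (raag \<Gamma>) (factor \<Gamma> S) (factor \<Gamma> T)"
proof -
  let ?G = "raag \<Gamma>" and ?g = "raag_gen \<Gamma>" and ?A = "factor \<Gamma> S" and ?B = "factor \<Gamma> T"
  have sub: "S \<subseteq> pverts \<Gamma>" "T \<subseteq> pverts \<Gamma>" using ST by auto
  interpret G: group ?G by (rule group_raag)
  have id: "(\<lambda>x. x) \<in> hom ?G ?G" and triv: "(\<lambda>_. \<one>\<^bsub>?G\<^esub>) \<in> hom ?G ?G" by (simp_all add: hom_def)
  have kA: "kill \<Gamma> T x = x" if "x \<in> ?A" for x
    by (rule factor_hom_eq[OF group_raag kill_hom[OF \<Gamma>] id _ sub(1) that])
      (use ST in \<open>auto simp: kill_gen[OF \<Gamma>]\<close>)
  have kB: "kill \<Gamma> T x = \<one>\<^bsub>?G\<^esub>" if "x \<in> ?B" for x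
    by (rule factor_hom_eq[OF group_raag kill_hom[OF \<Gamma>] triv _ sub(2) that])
      (use ST in \<open>auto simp: kill_gen[OF \<Gamma>]\<close>)
  have sg: "subgroup ?A ?G" "subgroup ?B ?G" using factor_subgroup sub by auto
  have "?A \<inter> ?B \<subseteq> {\<one>\<^bsub>?G\<^esub>}"
  proof
    fix x assume "x \<in> ?A \<inter> ?B"
    then have "kill \<Gamma> T x = x" "kill \<Gamma> T x = \<one>\<^bsub>?G\<^esub>" using kA kB by blast+
    then show "x \<in> {\<one>\<^bsub>?G\<^esub>}" by simp
  qed
  then have "?A \<inter> ?B = {\<one>\<^bsub>?G\<^esub>}" using sg subgroup.one_closed by blast
  then interpret AB: disjoint_subgroups ?G ?A ?B
    using sg group_raag by (simp add: disjoint_subgroups_def disjoint_subgroups_axioms_def)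
  interpret A: subgroup ?A ?G by (rule AB.subgroups)
  interpret B: subgroup ?B ?G by (rule AB.subgroups)
  let ?alt = "alternating ?G ?A ?B" and ?F = "\<lambda>v. if v \<in> S then ?A else ?B"
  have gF: "?g v \<in> ?F v" if "v \<in> pverts \<Gamma>" for v using that gen_in_factor ST by auto
  have gF': "inv\<^bsub>?G\<^esub> ?g v \<in> ?F v" if "v \<in> pverts \<Gamma>" for v using gF[OF that] by (auto split: if_splits)
  have F: "?F v \<in> {?A, ?B}" for v by auto
  obtain \<Phi> where mem: "\<And>x l. x \<in> carrier ?G \<Longrightarrow> l \<in> {l. ?alt l} \<Longrightarrow> \<Phi> x l \<in> {l. ?alt l}"
    and one: "\<And>l. l \<in> {l. ?alt l} \<Longrightarrow> \<Phi> \<one>\<^bsub>?G\<^esub> l = l"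
    and mult: "\<And>x y l. x \<in> carrier ?G \<Longrightarrow> y \<in> carrier ?G \<Longrightarrow> l \<in> {l. ?alt l} \<Longrightarrow>
      \<Phi> (x \<otimes>\<^bsub>?G\<^esub> y) l = \<Phi> x (\<Phi> y l)"
    and gen: "\<And>v l. v \<in> pverts \<Gamma> \<Longrightarrow> l \<in> {l. ?alt l} \<Longrightarrow> \<Phi> (?g v) l = AB.lmul (?g v) l"
    and inv: "\<And>v l. v \<in> pverts \<Gamma> \<Longrightarrow> l \<in> {l. ?alt l} \<Longrightarrow>
      \<Phi> (inv\<^bsub>?G\<^esub> ?g v) l = AB.lmul (inv\<^bsub>?G\<^esub> ?g v) l"
  proof (rule raag_action[of \<Gamma> "{l. ?alt l}" "\<lambda>v. AB.lmul (?g v)" "\<lambda>v. AB.lmul (inv\<^bsub>?G\<^esub> ?g v)"])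
    fix v l assume v: "v \<in> pverts \<Gamma>" and "l \<in> {l. ?alt l}"
    then have l: "?alt l" by simp
    have "?g v \<in> ?A \<union> ?B" "inv\<^bsub>?G\<^esub> ?g v \<in> ?A \<union> ?B" using gF[OF v] gF'[OF v] by (auto split: if_splits)
    then show "AB.lmul (?g v) l \<in> {l. ?alt l} \<and> AB.lmul (inv\<^bsub>?G\<^esub> ?g v) l \<in> {l. ?alt l}"
      using AB.lmul_alt(1)[OF _ l] by simp
    show "AB.lmul (?g v) (AB.lmul (inv\<^bsub>?G\<^esub> ?g v) l) = l \<and> AB.lmul (inv\<^bsub>?G\<^esub> ?g v) (AB.lmul (?g v) l) = l"
      using AB.lmul_mult[OF F gF[OF v] gF'[OF v] l] AB.lmul_mult[OF F gF'[OF v] gF[OF v] l] v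
      by (simp add: AB.lmul_one)
  next
    fix v w l assume vw: "(v, w) \<in> parcs \<Gamma>" and "l \<in> {l. ?alt l}"
    then have l: "?alt l" by simp
    note v = pair_graph_arcsD[OF \<Gamma> vw]
    \<comment> \<open>Adjacent vertices lie on the same side, so both generators belong to the
      factor of \<open>v\<close>.\<close>
    have "?g w \<in> ?F v" using gF[OF v(2)] arcs[OF vw] by simp
    then show "AB.lmul (?g v) (AB.lmul (?g w) l) = AB.lmul (?g w) (AB.lmul (?g v) l)"
      using AB.lmul_mult[OF F gF[OF v(1)] _ l] AB.lmul_mult[OF F _ gF[OF v(1)] l]
        raag_gen_commute[OF v(1,2) vw] by simp
  qed (use pair_graph_arcsD[OF \<Gamma>] in auto)
  \<comment> \<open>The letters of normal forms are arbitrary elements of a factor, so the rule for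
    generators has to be extended to the whole factor.\<close>
  have act: "\<Phi> x l = AB.lmul x l" if x: "x \<in> factor \<Gamma> U" and U: "U = S \<or> U = T" and l: "?alt l" for x U l
  proof -
    have FU: "factor \<Gamma> U \<in> {?A, ?B}" and Uv: "U \<subseteq> pverts \<Gamma>" using U sub by auto
    have c: "x \<in> carrier ?G" if "x \<in> generate ?G (?g ` U)" for x
      using that subgroup.mem_carrier[OF factor_subgroup[OF Uv]] by (simp add: factor_def)
    have "x \<in> generate ?G (?g ` U)" using x by (simp add: factor_def)
    then show ?thesis using l
    proof (induction x arbitrary: l rule: generate.induct)
      case one
      then show ?case using \<open>\<And>l. l \<in> {l. ?alt l} \<Longrightarrow> \<Phi> \<one>\<^bsub>?G\<^esub> l = l\<close> by (simp add: AB.lmul_one)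
    next
      case (incl h)
      then show ?case using gen Uv by auto
    next
      case (inv h)
      then show ?case using \<open>\<And>v l. v \<in> pverts \<Gamma> \<Longrightarrow> l \<in> {l. ?alt l} \<Longrightarrow>
        \<Phi> (inv\<^bsub>?G\<^esub> ?g v) l = AB.lmul (inv\<^bsub>?G\<^esub> ?g v) l\<close> Uv by auto
    next
      case (eng h1 h2)
      have h: "h1 \<in> factor \<Gamma> U" "h2 \<in> factor \<Gamma> U" using eng by (simp_all add: factor_def)
      have "?alt (AB.lmul h2 l)" using AB.lmul_alt(1)[OF _ eng.prems, of h2] h FU by auto
      then show ?case
        using eng AB.lmul_mult[OF FU h eng.prems] c by (simp add: mult)
    qed
  qed
  have act': "\<Phi> x l = AB.lmul x l" if "x \<in> ?A \<union> ?B" "?alt l" for x l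
    using act[of x S l] act[of x T l] that by auto
  have nf: "\<Phi> (mprod ?G l) [] = l" if "?alt l" for l
    using that
  proof (induction l)
    case Nil
    then show ?case using one by simp
  next
    case (Cons x l)
    then have x: "x \<in> ?A \<union> ?B" "?alt l" by (auto simp: AB.alt_Cons)
    have "x \<in> carrier ?G" "mprod ?G l \<in> carrier ?G" using x AB.alt_carrier[OF x(2)] by auto
    then have "\<Phi> (mprod ?G (x # l)) [] = \<Phi> x l" using Cons x by (simp add: mult)
    then show ?case using act'[OF x] AB.lmul_Cons[OF Cons.prems] by simp
  qed
  show ?thesis
  proof
    fix l m assume "?alt l" "?alt m" "mprod ?G l = mprod ?G m"
    then show "l = m" using nf by metis
  next
    fix x assume "x \<in> carrier ?G"
    then show "\<exists>l. ?alt l \<and> mprod ?G l = x"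
    proof (induction rule: raag_induct)
      case one
      show ?case by (intro exI[of _ "[]"]) simp
    next
      case (gen v x)
      then obtain l where l: "?alt l" "mprod ?G l = x" by blast
      have "?g v \<in> ?A \<union> ?B" using gF[OF gen.hyps(1)] by (auto split: if_splits)
      from AB.lmul_alt[OF this l(1)] l show ?case by blast
    next
      case (inv v x)
      then obtain l where l: "?alt l" "mprod ?G l = x" by blast
      have "inv\<^bsub>?G\<^esub> ?g v \<in> ?A \<union> ?B" using gF'[OF inv.hyps(1)] by (auto split: if_splits)
      from AB.lmul_alt[OF this l(1)] l show ?case by blast
    qed
  qed
qed

section \<open>Graphs whose groups have finite outer automorphism group\<close>

lemma (in group) commute_inv:
  "x \<in> carrier G \<Longrightarrow> y \<in> carrier G \<Longrightarrow> x \<otimes> y = y \<otimes> x \<Longrightarrow> x \<otimes> inv y = inv y \<otimes> x"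
  by (metis inv_closed inv_solve_left inv_solve_right' m_assoc m_closed)

lemma noncyclic_two_vertices:
  assumes nc: "\<not> cyclic_group (raag \<Gamma>)"
  shows "\<exists>v\<in>pverts \<Gamma>. \<exists>w\<in>pverts \<Gamma>. v \<noteq> w"
proof (rule ccontr)
  assume not: "\<not> ?thesis"
  interpret group "raag \<Gamma>" by (rule group_raag)
  \<comment> \<open>For a graph without vertices \<open>g\<close> can be the identity.\<close>
  obtain g where g: "g \<in> carrier (raag \<Gamma>)" "\<And>v. v \<in> pverts \<Gamma> \<Longrightarrow> raag_gen \<Gamma> v = g"
    using not raag_gen_closed one_closed by (metis (full_types))
  have "\<exists>n :: int. x = g [^]\<^bsub>raag \<Gamma>\<^esub> n" if "x \<in> carrier (raag \<Gamma>)" for x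
    using that
  proof (induction rule: raag_induct)
    case one
    show ?case by (intro exI[of _ 0]) simp
  next
    case (gen v x)
    then obtain n :: int where "x = g [^]\<^bsub>raag \<Gamma>\<^esub> n" by blast
    then have "raag_gen \<Gamma> v \<otimes>\<^bsub>raag \<Gamma>\<^esub> x = g [^]\<^bsub>raag \<Gamma>\<^esub> (1 + n)"
      using g gen by (simp add: int_pow_mult)
    then show ?case by blast
  next
    case (inv v x)
    then obtain n :: int where "x = g [^]\<^bsub>raag \<Gamma>\<^esub> n" by blast
    then have "inv\<^bsub>raag \<Gamma>\<^esub> raag_gen \<Gamma> v \<otimes>\<^bsub>raag \<Gamma>\<^esub> x = g [^]\<^bsub>raag \<Gamma>\<^esub> (- 1 + n)"
      using g inv int_pow_neg[OF g(1), of 1] by (simp only: int_pow_mult int_pow_1)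
    then show ?case by blast
  qed
  then have "carrier (raag \<Gamma>) = range (\<lambda>n :: int. g [^]\<^bsub>raag \<Gamma>\<^esub> n)"
    using g by auto
  then show False using nc g cyclic_group by blast
qed

section \<open>Shape of a graph whose noncyclic group has finite outer automorphism group\<close>

locale rigid_graph =
  fixes \<Gamma> :: "'v pair_pre_digraph"
  assumes graph: "pair_graph \<Gamma>"
    and noncyclic: "\<not> cyclic_group (raag \<Gamma>)"
    and finite_Out: "finite (carrier (Out (raag \<Gamma>)))"
begin

lemma other_vertex: "v \<in> pverts \<Gamma> \<Longrightarrow> \<exists>w\<in>pverts \<Gamma>. w \<noteq> v"
  using noncyclic_two_vertices[OF noncyclic] by metis

lemma nonempty: "pverts \<Gamma> \<noteq> {}"
  using noncyclic_two_vertices[OF noncyclic] by blast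

text \<open>A vertex without neighbours would be dominated by any other vertex, and there is another
  one because the group is noncyclic.\<close>

lemma neighbour: "v \<in> pverts \<Gamma> \<Longrightarrow> \<exists>u. (v, u) \<in> parcs \<Gamma>"
  using other_vertex finite_Out_no_domination[OF graph finite_Out] by metis

text \<open>Some other vertex \<open>w\<close> is not dominated by \<open>v\<close>, so it has a
  neighbour that is neither \<open>v\<close> nor adjacent to \<open>v\<close>.\<close>

lemma nonneighbour:
  assumes v: "v \<in> pverts \<Gamma>"
  shows "\<exists>u\<in>pverts \<Gamma>. u \<noteq> v \<and> (v, u) \<notin> parcs \<Gamma>"
proof -
  obtain w where "w \<in> pverts \<Gamma>" "w \<noteq> v" using other_vertex[OF v] by blast
  then obtain u where "(w, u) \<in> parcs \<Gamma>" "u \<noteq> v" "(v, u) \<notin> parcs \<Gamma>"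
    using finite_Out_no_domination[OF graph finite_Out _ v] by blast
  then show ?thesis using pair_graph_arcsD[OF graph] by blast
qed

lemma center_trivial:
  assumes "z \<in> carrier (raag \<Gamma>)"
    and "\<And>x. x \<in> carrier (raag \<Gamma>) \<Longrightarrow> z \<otimes>\<^bsub>raag \<Gamma>\<^esub> x = x \<otimes>\<^bsub>raag \<Gamma>\<^esub> z"
  shows "z = \<one>\<^bsub>raag \<Gamma>\<^esub>"
  using raag_center_trivial[OF graph nonneighbour assms] .

text \<open>
  Otherwise the group is a free product, and conjugating one factor by the powers of a non-central
  element of that factor while fixing the other one gives infinitely many outer classes.
\<close>

lemma connected:
  assumes S: "S \<subseteq> pverts \<Gamma>" "S \<noteq> {}" and closed: "\<And>v u. v \<in> S \<Longrightarrow> (v, u) \<in> parcs \<Gamma> \<Longrightarrow> u \<in> S"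
  shows "S = pverts \<Gamma>"
proof (rule ccontr)
  assume "S \<noteq> pverts \<Gamma>"
  define T where "T = pverts \<Gamma> - S"
  have T: "T \<noteq> {}" and V: "pverts \<Gamma> = S \<union> T" "S \<inter> T = {}"
    using S \<open>S \<noteq> pverts \<Gamma>\<close> by (auto simp: T_def)
  have side: "v \<in> S \<longleftrightarrow> w \<in> S" if "(v, w) \<in> parcs \<Gamma>" for v w
    using closed that pair_graph_arcsD[OF graph that] by blast
  have sideT: "v \<in> T \<longleftrightarrow> w \<in> T" if "(v, w) \<in> parcs \<Gamma>" for v w
    using side[OF that] pair_graph_arcsD[OF graph that] V by blast
  let ?G = "raag \<Gamma>" and ?g = "raag_gen \<Gamma>"
  interpret free_product ?G "factor \<Gamma> S" "factor \<Gamma> T" by (rule raag_free_product[OF graph V side])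
  obtain c where c: "c \<in> T" using T by blast
  \<comment> \<open>This makes \<open>c\<close> noncentral in its factor: a neighbour
    \<open>u\<close> of \<open>c\<close> is not dominated by \<open>c\<close>, so it leads to a
    vertex outside the star of \<open>c\<close> that still belongs to \<open>T\<close>.\<close>
  have "\<exists>d\<in>T. d \<noteq> c \<and> (c, d) \<notin> parcs \<Gamma>"
  proof (rule ccontr)
    assume all: "\<not> ?thesis"
    obtain u where u: "(c, u) \<in> parcs \<Gamma>" using neighbour c V by blast
    then have "u \<in> T" "u \<noteq> c" "u \<in> pverts \<Gamma>" "c \<in> pverts \<Gamma>"
      using sideT[OF u] c pair_graph_arcsD[OF graph u] by auto
    then obtain x where x: "(u, x) \<in> parcs \<Gamma>" "x \<noteq> c" "(c, x) \<notin> parcs \<Gamma>"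
      using finite_Out_no_domination[OF graph finite_Out] by blast
    then have "x \<in> T" using sideT[OF x(1)] \<open>u \<in> T\<close> by blast
    then show False using all x by blast
  qed
  then obtain d where d: "d \<in> T" "d \<noteq> c" "(c, d) \<notin> parcs \<Gamma>" by blast
  obtain s where s: "s \<in> S" using S by blast
  have V': "c \<in> pverts \<Gamma>" "d \<in> pverts \<Gamma>" "s \<in> pverts \<Gamma>" using c d s V by auto
  define p where "p (i :: int) = ?g c [^]\<^bsub>?G\<^esub> i" for i
  have p: "p i \<in> carrier ?G" for i using V' by (simp add: p_def)
  have p_add: "p i \<otimes>\<^bsub>?G\<^esub> p j = p (i + j)" for i j using V' by (simp add: p_def int_pow_mult)
  have p_inv: "inv\<^bsub>?G\<^esub> p i = p (- i)" for i using V' by (simp add: p_def int_pow_neg)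
  define f where "f i u = (if u \<in> T then p i \<otimes>\<^bsub>?G\<^esub> ?g u \<otimes>\<^bsub>?G\<^esub> p (- i) else ?g u)" for i u
  have f_closed: "f i u \<in> carrier ?G" if "u \<in> pverts \<Gamma>" for i u using that p by (simp add: f_def)
  \<comment> \<open>Since \<open>c\<close> and its powers are fixed, the partial conjugations by
    \<open>p i\<close> and \<open>p (- i)\<close> are mutually inverse.\<close>
  have fc: "f i c = ?g c" for i
  proof -
    have "p i \<otimes>\<^bsub>?G\<^esub> ?g c = ?g c \<otimes>\<^bsub>?G\<^esub> p i"
      using commute_int_pow[of "?g c" "?g c" i] V' by (simp add: p_def)
    then have "f i c = ?g c \<otimes>\<^bsub>?G\<^esub> p i \<otimes>\<^bsub>?G\<^esub> p (- i)" using c by (simp add: f_def)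
    then show ?thesis using V' p[of i] by (simp add: m_assoc flip: p_inv)
  qed
  have conj_hom: "p i \<otimes>\<^bsub>?G\<^esub> x \<otimes>\<^bsub>?G\<^esub> p (- i) \<otimes>\<^bsub>?G\<^esub> (p i \<otimes>\<^bsub>?G\<^esub> y \<otimes>\<^bsub>?G\<^esub> p (- i)) =
      p i \<otimes>\<^bsub>?G\<^esub> (x \<otimes>\<^bsub>?G\<^esub> y) \<otimes>\<^bsub>?G\<^esub> p (- i)" if "x \<in> carrier ?G" "y \<in> carrier ?G" for i x y
    using that p[of i] by (simp add: m_assoc flip: p_inv)
  have re: "respects_edges \<Gamma> ?G (f i)" for i
  proof (rule respects_edgesI)
    fix v w assume vw: "(v, w) \<in> parcs \<Gamma>"
    note v = pair_graph_arcsD[OF graph vw]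
    show "f i v \<otimes>\<^bsub>?G\<^esub> f i w = f i w \<otimes>\<^bsub>?G\<^esub> f i v"
      using sideT[OF vw] v raag_gen_commute[OF v(1,2) vw] by (auto simp: f_def conj_hom)
  qed (rule f_closed)
  let ?\<tau> = "\<lambda>i. raag_lift \<Gamma> ?G (f i)"
  have gen: "?\<tau> i (?g u) = f i u" if "u \<in> pverts \<Gamma>" for i u
    using raag_lift_gen[OF group_raag re that] .
  have inv: "?\<tau> i (f (- i) u) = ?g u" if u: "u \<in> pverts \<Gamma>" for i u
  proof (cases "u \<in> T")
    case True
    interpret h: group_hom ?G ?G "?\<tau> i"
      using raag_lift_hom[OF group_raag re] group_raag by (simp add: group_hom_def group_hom_axioms_def)
    have cp: "?\<tau> i (p j) = p j" for j
    proof -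
      from fc show ?thesis using h.hom_int_pow[of "?g c" j] V' gen[of c i] by (simp add: p_def)
    qed
    have "?\<tau> i (f (- i) u) = p (- i) \<otimes>\<^bsub>?G\<^esub> f i u \<otimes>\<^bsub>?G\<^esub> p i"
      using True u p by (simp add: f_def[of "- i"] cp gen)
    also have "\<dots> = ?g u" using True u p[of i] by (simp add: f_def m_assoc flip: p_inv)
    finally show ?thesis .
  qed (use gen[OF u] in \<open>simp add: f_def\<close>)
  have "?\<tau> i \<in> auto ?G" for i
    using inv[of _ i] inv[of _ "- i"] by (intro raag_autoI[of _ "f i" "f (- i)"] re) auto
  then obtain k l :: nat and x where kl: "k < l" "x \<in> carrier ?G"
    "\<And>y. y \<in> carrier ?G \<Longrightarrow> ?\<tau> (int l) y = x \<otimes>\<^bsub>?G\<^esub> ?\<tau> (int k) y \<otimes>\<^bsub>?G\<^esub> inv\<^bsub>?G\<^esub> x"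
    using finite_Out_family[OF finite_Out, of "\<lambda>k. ?\<tau> (int k)"] by metis
  have eq: "f (int l) u = x \<otimes>\<^bsub>?G\<^esub> f (int k) u \<otimes>\<^bsub>?G\<^esub> inv\<^bsub>?G\<^esub> x" if "u \<in> pverts \<Gamma>" for u
    using kl(3)[of "?g u"] that by (simp add: gen)
  have cent: "x \<otimes>\<^bsub>?G\<^esub> y = y \<otimes>\<^bsub>?G\<^esub> x" if "y \<in> carrier ?G" "y = x \<otimes>\<^bsub>?G\<^esub> y \<otimes>\<^bsub>?G\<^esub> inv\<^bsub>?G\<^esub> x" for y
    using that kl(2) by (metis inv_solve_right m_closed)
  \<comment> \<open>The conjugator \<open>x\<close> centralizes \<open>s\<close> on one side and
    \<open>c\<close> on the other, so it lies in both factors and is trivial. Then conjugating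
    \<open>d\<close> by two different powers of \<open>c\<close> gives the same result, and a
    positive power of \<open>c\<close> commutes with \<open>d\<close>.\<close>
  have "s \<notin> T" using s V by blast
  then have "?g s = x \<otimes>\<^bsub>?G\<^esub> ?g s \<otimes>\<^bsub>?G\<^esub> inv\<^bsub>?G\<^esub> x" using eq[of s] V' by (simp add: f_def)
  then have "x \<otimes>\<^bsub>?G\<^esub> ?g s = ?g s \<otimes>\<^bsub>?G\<^esub> x" using cent V' by simp
  from factor_centralizer[OF _ gen_in_factor[OF s] raag_gen_not_one[OF V'(3)] kl(2) this]
  have "x \<in> factor \<Gamma> S" by simp
  moreover have "?g c = x \<otimes>\<^bsub>?G\<^esub> ?g c \<otimes>\<^bsub>?G\<^esub> inv\<^bsub>?G\<^esub> x" using eq[of c] V' by (simp add: fc)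
  then have "x \<otimes>\<^bsub>?G\<^esub> ?g c = ?g c \<otimes>\<^bsub>?G\<^esub> x" using cent V' by simp
  from factor_centralizer[OF _ gen_in_factor[OF c] raag_gen_not_one[OF V'(1)] kl(2) this]
  have "x \<in> factor \<Gamma> T" by simp
  ultimately have "x = \<one>\<^bsub>?G\<^esub>" using disjoint by blast
  then have "f (int l) d = f (int k) d" using eq[of d] V' f_closed by simp
  then have "p (- int k) \<otimes>\<^bsub>?G\<^esub> (p (int l) \<otimes>\<^bsub>?G\<^esub> ?g d \<otimes>\<^bsub>?G\<^esub> p (- int l)) \<otimes>\<^bsub>?G\<^esub> p (int l) =
      p (- int k) \<otimes>\<^bsub>?G\<^esub> (p (int k) \<otimes>\<^bsub>?G\<^esub> ?g d \<otimes>\<^bsub>?G\<^esub> p (- int k)) \<otimes>\<^bsub>?G\<^esub> p (int l)"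
    using d by (simp add: f_def)
  then have "p (int l - int k) \<otimes>\<^bsub>?G\<^esub> ?g d = ?g d \<otimes>\<^bsub>?G\<^esub> p (int l - int k)"
    using V' p p_add[of "- int k" "int l"] p_add[of "- int k" "int k"] p_add[of "- int l" "int l"]
    by (simp add: m_assoc flip: p_inv) (simp flip: m_assoc add: p_inv p_add)
  then show False
    using nonadjacent_not_commute[OF graph V'(1,2) d(2)[symmetric] d(3), of "int l - int k"] kl(1)
    by (simp add: p_def)
qed

end

section \<open>Inclusion of and retraction onto the group of a full subgraph\<close>

locale full_subgraph =
  fixes \<Lambda> :: "'u pair_pre_digraph" and \<Gamma> :: "'v pair_pre_digraph" and e :: "'u \<Rightarrow> 'v"
  assumes graphs: "pair_graph \<Lambda>" "pair_graph \<Gamma>"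
    and inj: "inj e" and verts: "e ` pverts \<Lambda> \<subseteq> pverts \<Gamma>"
    and full: "u \<in> pverts \<Lambda> \<Longrightarrow> w \<in> pverts \<Lambda> \<Longrightarrow> (e u, e w) \<in> parcs \<Gamma> \<longleftrightarrow> (u, w) \<in> parcs \<Lambda>"
begin

definition incl :: "'u word set \<Rightarrow> 'v word set" where
  "incl = raag_lift \<Lambda> (raag \<Gamma>) (\<lambda>u. raag_gen \<Gamma> (e u))"

text \<open>Fullness makes this respect the edges: an edge between image vertices comes from
  \<open>\<Lambda>\<close>, and any other edge becomes a relation with the identity. Its purpose is
  to be a left inverse of \<open>incl\<close>, which identifies the group of
  \<open>\<Lambda>\<close> with a factor.\<close>

definition retr :: "'v word set \<Rightarrow> 'u word set" where
  "retr = raag_lift \<Gamma> (raag \<Lambda>) (\<lambda>v. if v \<in> e ` pverts \<Lambda> then raag_gen \<Lambda> (inv_into UNIV e v) else \<one>\<^bsub>raag \<Lambda>\<^esub>)"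

lemma e_verts: "u \<in> pverts \<Lambda> \<Longrightarrow> e u \<in> pverts \<Gamma>"
  using verts by blast

lemma respects_incl: "respects_edges \<Lambda> (raag \<Gamma>) (\<lambda>u. raag_gen \<Gamma> (e u))"
proof (rule respects_edgesI)
  fix v w assume vw: "(v, w) \<in> parcs \<Lambda>"
  note v = pair_graph_arcsD[OF graphs(1) vw]
  show "raag_gen \<Gamma> (e v) \<otimes>\<^bsub>raag \<Gamma>\<^esub> raag_gen \<Gamma> (e w) = raag_gen \<Gamma> (e w) \<otimes>\<^bsub>raag \<Gamma>\<^esub> raag_gen \<Gamma> (e v)"
    using full v vw e_verts by (intro raag_gen_commute) auto
qed (simp add: e_verts)

lemma respects_retr:
  "respects_edges \<Gamma> (raag \<Lambda>) (\<lambda>v. if v \<in> e ` pverts \<Lambda> then raag_gen \<Lambda> (inv_into UNIV e v) else \<one>\<^bsub>raag \<Lambda>\<^esub>)"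
  (is "respects_edges _ _ ?f")
proof (rule respects_edgesI)
  interpret \<Lambda>: group "raag \<Lambda>" by (rule group_raag)
  show c: "?f v \<in> carrier (raag \<Lambda>)" for v using inj by auto
  fix v w assume vw: "(v, w) \<in> parcs \<Gamma>"
  show "?f v \<otimes>\<^bsub>raag \<Lambda>\<^esub> ?f w = ?f w \<otimes>\<^bsub>raag \<Lambda>\<^esub> ?f v"
  proof (cases "v \<in> e ` pverts \<Lambda> \<and> w \<in> e ` pverts \<Lambda>")
    case True
    then obtain x y where xy: "x \<in> pverts \<Lambda>" "y \<in> pverts \<Lambda>" "v = e x" "w = e y" by blast
    then show ?thesis using raag_gen_commute[OF xy(1,2)] full vw inj by simp
  next
    case False
    then show ?thesis using c[of v] c[of w] by (cases "v \<in> e ` pverts \<Lambda>") simp_all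
  qed
qed

sublocale incl: group_hom "raag \<Lambda>" "raag \<Gamma>" incl
  by (simp add: group_hom_def group_hom_axioms_def incl_def group_raag
      raag_lift_hom[OF group_raag respects_incl])

sublocale retr: group_hom "raag \<Gamma>" "raag \<Lambda>" retr
  by (simp add: group_hom_def group_hom_axioms_def retr_def group_raag
      raag_lift_hom[OF group_raag respects_retr])

lemma incl_gen: "u \<in> pverts \<Lambda> \<Longrightarrow> incl (raag_gen \<Lambda> u) = raag_gen \<Gamma> (e u)"
  unfolding incl_def by (rule raag_lift_gen[OF group_raag respects_incl])

lemma retr_gen: "u \<in> pverts \<Lambda> \<Longrightarrow> retr (raag_gen \<Gamma> (e u)) = raag_gen \<Lambda> u"
  unfolding retr_def using raag_lift_gen[OF group_raag respects_retr e_verts] inj by simp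

lemma retr_gen_outside: "v \<in> pverts \<Gamma> \<Longrightarrow> v \<notin> e ` pverts \<Lambda> \<Longrightarrow> retr (raag_gen \<Gamma> v) = \<one>\<^bsub>raag \<Lambda>\<^esub>"
  unfolding retr_def using raag_lift_gen[OF group_raag respects_retr] by simp

lemma retr_incl:
  assumes x: "x \<in> carrier (raag \<Lambda>)"
  shows "retr (incl x) = x"
proof -
  have i: "(\<lambda>x. x) \<in> hom (raag \<Lambda>) (raag \<Lambda>)" by (simp add: hom_def)
  have c: "retr \<circ> incl \<in> hom (raag \<Lambda>) (raag \<Lambda>)"
    using hom_compose[OF incl.homh retr.homh] .
  have "(retr \<circ> incl) x = x"
    by (rule raag_hom_eqI[OF group_raag c i _ x]) (simp add: incl_gen retr_gen)
  then show ?thesis by simp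
qed

lemma incl_inj: "x \<in> carrier (raag \<Lambda>) \<Longrightarrow> y \<in> carrier (raag \<Lambda>) \<Longrightarrow> incl x = incl y \<Longrightarrow> x = y"
  using retr_incl by metis

abbreviation "F \<equiv> factor \<Gamma> (e ` pverts \<Lambda>)"

lemma incl_retr:
  assumes x: "x \<in> F"
  shows "incl (retr x) = x"
proof -
  have i: "(\<lambda>x. x) \<in> hom (raag \<Gamma>) (raag \<Gamma>)" by (simp add: hom_def)
  have c: "incl \<circ> retr \<in> hom (raag \<Gamma>) (raag \<Gamma>)"
    using hom_compose[OF retr.homh incl.homh] .
  have "(incl \<circ> retr) x = x"
    by (rule factor_hom_eq[OF group_raag c i _ verts x]) (auto simp: incl_gen retr_gen)
  then show ?thesis by simp
qed

lemma incl_factor: "incl ` carrier (raag \<Lambda>) = F"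
proof
  interpret F: subgroup F "raag \<Gamma>" by (rule factor_subgroup[OF verts])
  have "incl x \<in> F" if "x \<in> carrier (raag \<Lambda>)" for x
    using that
    by (induction rule: raag_induct) (auto simp: incl_gen intro!: gen_in_factor)
  then show "incl ` carrier (raag \<Lambda>) \<subseteq> F" by blast
  show "F \<subseteq> incl ` carrier (raag \<Lambda>)"
  proof
    fix x assume x: "x \<in> F"
    then have "incl (retr x) = x" "retr x \<in> carrier (raag \<Lambda>)" using incl_retr F.mem_carrier by auto
    then show "x \<in> incl ` carrier (raag \<Lambda>)" by (metis imageI)
  qed
qed

lemma incl_in_factor: "x \<in> carrier (raag \<Lambda>) \<Longrightarrow> incl x \<in> F"
  using incl_factor by blast

lemma factor_nontrivial:
  assumes "pverts \<Lambda> \<noteq> {}"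
  shows "F \<noteq> {\<one>\<^bsub>raag \<Gamma>\<^esub>}"
proof -
  obtain u where "u \<in> pverts \<Lambda>" using assms by blast
  then have "raag_gen \<Gamma> (e u) \<in> F" "raag_gen \<Gamma> (e u) \<noteq> \<one>\<^bsub>raag \<Gamma>\<^esub>"
    using raag_gen_not_one[OF e_verts] by (auto intro: gen_in_factor)
  then show ?thesis by blast
qed

definition restr :: "('v word set \<Rightarrow> 'v word set) \<Rightarrow> 'u word set \<Rightarrow> 'u word set" where
  "restr f = (\<lambda>x\<in>carrier (raag \<Lambda>). retr (f (incl x)))"

lemma incl_restr:
  assumes "f ` F = F" "x \<in> carrier (raag \<Lambda>)"
  shows "incl (restr f x) = f (incl x)"
  using assms incl_in_factor[OF assms(2)] by (auto simp: restr_def intro!: incl_retr)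

text \<open>As \<open>f\<close> maps \<open>F\<close> onto itself, so does its inverse, and the
  restriction of the inverse inverts the restriction.\<close>

lemma restr_auto:
  assumes f: "f \<in> auto (raag \<Gamma>)" and fF: "f ` F = F"
  shows "restr f \<in> auto (raag \<Lambda>)"
proof -
  interpret f: group_hom "raag \<Gamma>" "raag \<Gamma>" f using group.auto_group_hom[OF group_raag f] .
  obtain h where h: "h \<in> auto (raag \<Gamma>)" "\<And>x. x \<in> carrier (raag \<Gamma>) \<Longrightarrow> h (f x) = x"
    "\<And>x. x \<in> carrier (raag \<Gamma>) \<Longrightarrow> f (h x) = x"
    using group.auto_inverse[OF group_raag f] by blast
  interpret F: subgroup F "raag \<Gamma>" by (rule factor_subgroup[OF verts])
  have "h ` F = h ` f ` F" using fF by simp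
  also have "\<dots> = F" using h(2) F.mem_carrier by (simp add: image_image)
  finally have hF: "h ` F = F" .
  have closed: "restr k x \<in> carrier (raag \<Lambda>)" if "k \<in> auto (raag \<Gamma>)" "x \<in> carrier (raag \<Lambda>)" for k x
    using that auto_closed[OF that(1)] by (simp add: restr_def)
  show ?thesis
  proof (rule autoI[where h = "restr h"])
    show "restr f \<in> hom (raag \<Lambda>) (raag \<Lambda>)"
      by (rule homI) (simp_all add: restr_def)
    show "restr f \<in> extensional (carrier (raag \<Lambda>))" by (simp add: restr_def)
    fix x assume x: "x \<in> carrier (raag \<Lambda>)"
    show "restr h x \<in> carrier (raag \<Lambda>)" using closed h(1) x by simp
    show "restr f (restr h x) = x"
      using x closed[OF h(1) x] closed[OF f] incl_restr[OF fF] incl_restr[OF hF] h(3)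
      by (intro incl_inj) auto
    show "restr h (restr f x) = x"
      using x closed[OF f x] closed[OF h(1)] incl_restr[OF fF] incl_restr[OF hF] h(2)
      by (intro incl_inj) auto
  qed
qed

text \<open>
  Adjacent vertices commute and are independent, so \<open>f\<close> sends them into a common conjugate of a factor;
  as distinct conjugates meet trivially, connectedness forces this conjugate to be the same for all
  vertices of \<open>\<Lambda>\<close>.
\<close>

lemma factor_elliptic:
  assumes AB: "free_product (raag \<Gamma>) A B" and \<Lambda>: "rigid_graph \<Lambda>" and f: "f \<in> auto (raag \<Gamma>)"
  shows "\<exists>F'\<in>{A, B}. \<exists>g\<in>carrier (raag \<Gamma>). f ` F \<subseteq> conj_set (raag \<Gamma>) g F'"
proof -
  interpret free_product "raag \<Gamma>" A B by (rule AB)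
  interpret \<Lambda>: rigid_graph \<Lambda> by (rule \<Lambda>)
  interpret f: group_hom "raag \<Gamma>" "raag \<Gamma>" f by (rule group.auto_group_hom[OF group_raag f])
  let ?G = "raag \<Gamma>" and ?g = "\<lambda>u. raag_gen \<Gamma> (e u)"
  have f_inj: "x = y" if "f x = f y" "x \<in> carrier ?G" "y \<in> carrier ?G" for x y
    using that auto_inj[OF f] by (auto dest: inj_onD)
  have fg: "f (?g u) \<in> carrier ?G" "f (?g u) \<noteq> \<one>\<^bsub>?G\<^esub>" if "u \<in> pverts \<Lambda>" for u
    using f_inj[of "?g u" "\<one>\<^bsub>?G\<^esub>"] raag_gen_not_one[OF e_verts[OF that]] e_verts[OF that] by auto
  have edge: "\<exists>F'\<in>{A, B}. \<exists>g\<in>carrier ?G. f (?g u) \<in> conj_set ?G g F' \<and> f (?g w) \<in> conj_set ?G g F'"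
    if uw: "(u, w) \<in> parcs \<Lambda>" for u w
  proof -
    note u = pair_graph_arcsD[OF graphs(1) uw]
    have e: "e u \<in> pverts \<Gamma>" "e w \<in> pverts \<Gamma>" "(e u, e w) \<in> parcs \<Gamma>" "e u \<noteq> e w"
      using u full uw e_verts inj by (auto dest: injD)
    have "f (?g u) \<otimes>\<^bsub>?G\<^esub> f (?g w) = f (?g w) \<otimes>\<^bsub>?G\<^esub> f (?g u)"
      using f.hom_mult[of "?g u" "?g w"] f.hom_mult[of "?g w" "?g u"] raag_gen_commute[OF e(1-3)] e
      by simp
    moreover have "j = 0" if "f (?g u) [^]\<^bsub>?G\<^esub> i = f (?g w) [^]\<^bsub>?G\<^esub> j" for i j :: int
    proof -
      have "f (?g u [^]\<^bsub>?G\<^esub> i) = f (?g w [^]\<^bsub>?G\<^esub> j)"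
        using that f.hom_int_pow[of "?g u" i] f.hom_int_pow[of "?g w" j] e by simp
      from f_inj[OF this] have "?g u [^]\<^bsub>?G\<^esub> i = ?g w [^]\<^bsub>?G\<^esub> j" using e by simp
      \<comment> \<open>The left side is 0 because \<open>e u\<close> and \<open>e w\<close> are
        distinct, and the right side is \<open>j\<close>.\<close>
      then have "exponent_sum \<Gamma> (e w) (?g u [^]\<^bsub>?G\<^esub> i) = exponent_sum \<Gamma> (e w) (?g w [^]\<^bsub>?G\<^esub> j)"
        by simp
      then show "j = 0" using e by (simp add: exponent_sum_hom exponent_sum_gen)
    qed
    ultimately show ?thesis
      using commuting_in_common_conjugate[OF fg[OF u(1)] fg(1)[OF u(2)]] by blast
  qed
  obtain u0 where u0: "u0 \<in> pverts \<Lambda>" using \<Lambda>.nonempty by blast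
  then obtain w0 where "(u0, w0) \<in> parcs \<Lambda>" using \<Lambda>.neighbour by blast
  from edge[OF this] obtain F' g where F': "F' \<in> {A, B}" "g \<in> carrier ?G" "f (?g u0) \<in> conj_set ?G g F'"
    by blast
  define W where "W = {u \<in> pverts \<Lambda>. f (?g u) \<in> conj_set ?G g F'}"
  have "W = pverts \<Lambda>"
  proof (rule \<Lambda>.connected)
    show "W \<subseteq> pverts \<Lambda>" "W \<noteq> {}" using u0 F' by (auto simp: W_def)
    fix v u assume v: "v \<in> W" and vu: "(v, u) \<in> parcs \<Lambda>"
    obtain F'' h where F'': "F'' \<in> {A, B}" "h \<in> carrier ?G" "f (?g v) \<in> conj_set ?G h F''"
      "f (?g u) \<in> conj_set ?G h F''" using edge[OF vu] by blast
    have vV: "v \<in> pverts \<Lambda>" "f (?g v) \<in> conj_set ?G g F'" using v by (auto simp: W_def)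
    have "conj_set ?G g F' = conj_set ?G h F''"
      using conj_factor_unique[OF F'(1) F''(1) F'(2) F''(2) fg(2)[OF vV(1)] vV(2) F''(3)] by blast
    then show "u \<in> W" using F''(4) pair_graph_arcsD(2)[OF graphs(1) vu] by (simp add: W_def)
  qed
  then have verts_C: "f (?g u) \<in> conj_set ?G g F'" if "u \<in> pverts \<Lambda>" for u using that by (auto simp: W_def)
  interpret F': subgroup F' ?G by (rule subgroup_factor[OF F'(1)])
  have cm: "x \<otimes>\<^bsub>?G\<^esub> y \<in> conj_set ?G g F'" if "x \<in> conj_set ?G g F'" "y \<in> conj_set ?G g F'" for x y
  proof -
    obtain a b where ab: "a \<in> F'" "b \<in> F'" "x = g \<otimes>\<^bsub>?G\<^esub> a \<otimes>\<^bsub>?G\<^esub> inv\<^bsub>?G\<^esub> g" "y = g \<otimes>\<^bsub>?G\<^esub> b \<otimes>\<^bsub>?G\<^esub> inv\<^bsub>?G\<^esub> g"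
      using \<open>x \<in> _\<close> \<open>y \<in> _\<close> by (auto simp: conj_set_def)
    then have "x \<otimes>\<^bsub>?G\<^esub> y = g \<otimes>\<^bsub>?G\<^esub> (a \<otimes>\<^bsub>?G\<^esub> b) \<otimes>\<^bsub>?G\<^esub> inv\<^bsub>?G\<^esub> g"
      using F'(2) by (simp add: incl.H.m_assoc)
    then show ?thesis using ab by (auto simp: conj_set_def)
  qed
  have ci: "inv\<^bsub>?G\<^esub> x \<in> conj_set ?G g F'" if "x \<in> conj_set ?G g F'" for x
  proof -
    obtain a where a: "a \<in> F'" "x = g \<otimes>\<^bsub>?G\<^esub> a \<otimes>\<^bsub>?G\<^esub> inv\<^bsub>?G\<^esub> g" using \<open>x \<in> _\<close> by (auto simp: conj_set_def)
    then have "inv\<^bsub>?G\<^esub> x = g \<otimes>\<^bsub>?G\<^esub> inv\<^bsub>?G\<^esub> a \<otimes>\<^bsub>?G\<^esub> inv\<^bsub>?G\<^esub> g"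
      using F'(2) by (simp add: incl.H.m_assoc incl.H.inv_mult_group)
    then show ?thesis using a by (auto simp: conj_set_def)
  qed
  have "f (incl x) \<in> conj_set ?G g F'" if "x \<in> carrier (raag \<Lambda>)" for x
    using that
  proof (induction rule: raag_induct)
    case one
    have "\<one>\<^bsub>?G\<^esub> = g \<otimes>\<^bsub>?G\<^esub> \<one>\<^bsub>?G\<^esub> \<otimes>\<^bsub>?G\<^esub> inv\<^bsub>?G\<^esub> g" using F'(2) by simp
    then have "\<one>\<^bsub>?G\<^esub> \<in> conj_set ?G g F'" unfolding conj_set_def using F'.one_closed by blast
    then show ?case by simp
  next
    case (gen v x)
    have "f (incl (raag_gen \<Lambda> v \<otimes>\<^bsub>raag \<Lambda>\<^esub> x)) = f (?g v) \<otimes>\<^bsub>?G\<^esub> f (incl x)"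
      using gen(1,2) e_verts[OF gen(1)] by (simp add: incl_gen)
    then show ?case using cm[OF verts_C[OF gen(1)] gen(3)] by (simp only:)
  next
    case (inv v x)
    have "f (incl (inv\<^bsub>raag \<Lambda>\<^esub> raag_gen \<Lambda> v \<otimes>\<^bsub>raag \<Lambda>\<^esub> x)) = inv\<^bsub>?G\<^esub> f (?g v) \<otimes>\<^bsub>?G\<^esub> f (incl x)"
      using inv(1,2) e_verts[OF inv(1)] by (simp add: incl_gen)
    then show ?case using cm[OF ci[OF verts_C[OF inv(1)]] inv(3)] by (simp only:)
  qed
  then have "f ` F \<subseteq> conj_set ?G g F'" unfolding incl_factor[symmetric] by blast
  then show ?thesis using F'(1,2) by blast
qed

end

section \<open>The outer automorphism group of the free product\<close>

locale rigid_pair = L: rigid_graph \<Gamma>1 + R: rigid_graph \<Gamma>2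
  for \<Gamma>1 :: "'a pair_pre_digraph" and \<Gamma>2 :: "'b pair_pre_digraph"
begin

abbreviation "\<Gamma> \<equiv> graph_disjoint_union \<Gamma>1 \<Gamma>2"
abbreviation "G \<equiv> raag \<Gamma>"
abbreviation "G1 \<equiv> raag \<Gamma>1"
abbreviation "G2 \<equiv> raag \<Gamma>2"

sublocale G: group G by (rule group_raag)
sublocale G1: group G1 by (rule group_raag)
sublocale G2: group G2 by (rule group_raag)

lemma verts_union: "pverts \<Gamma> = Inl ` pverts \<Gamma>1 \<union> Inr ` pverts \<Gamma>2"
  by (auto simp: graph_disjoint_union_def)

sublocale I1: full_subgraph \<Gamma>1 \<Gamma> Inl
proof (rule full_subgraph.intro)
  show "pair_graph \<Gamma>1" "pair_graph \<Gamma>"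
    using L.graph pair_graph_disjoint_union[OF L.graph R.graph] by auto
qed (auto simp: graph_disjoint_union_def)

sublocale I2: full_subgraph \<Gamma>2 \<Gamma> Inr
proof (rule full_subgraph.intro)
  show "pair_graph \<Gamma>2" "pair_graph \<Gamma>" using R.graph I1.graphs(2) by auto
qed (auto simp: graph_disjoint_union_def)

sublocale FP: free_product G I1.F I2.F
  using pair_graph_arcsD[OF L.graph]
  by (intro raag_free_product[OF I1.graphs(2) verts_union]) (auto simp: graph_disjoint_union_def)

lemma factors_nontrivial: "I1.F \<noteq> {\<one>\<^bsub>G\<^esub>}" "I2.F \<noteq> {\<one>\<^bsub>G\<^esub>}"
  using I1.factor_nontrivial I2.factor_nontrivial L.nonempty R.nonempty by auto

lemma hom_eqI:
  assumes h: "h \<in> hom G G" "k \<in> hom G G"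
    and eq: "\<And>x. x \<in> carrier G1 \<Longrightarrow> h (I1.incl x) = k (I1.incl x)"
      "\<And>y. y \<in> carrier G2 \<Longrightarrow> h (I2.incl y) = k (I2.incl y)"
    and x: "x \<in> carrier G"
  shows "h x = k x"
proof (rule raag_hom_eqI[OF group_raag h _ x])
  fix v assume "v \<in> pverts \<Gamma>"
  then consider u where "u \<in> pverts \<Gamma>1" "v = Inl u" | u where "u \<in> pverts \<Gamma>2" "v = Inr u"
    unfolding verts_union by blast
  then show "h (raag_gen \<Gamma> v) = k (raag_gen \<Gamma> v)"
  proof cases
    case 1
    then show ?thesis using eq(1)[of "raag_gen \<Gamma>1 u"] by (simp add: I1.incl_gen)
  next
    case 2
    then show ?thesis using eq(2)[of "raag_gen \<Gamma>2 u"] by (simp add: I2.incl_gen)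
  qed
qed

section \<open>Independent conjugation of the two factors\<close>

definition twist_gen :: "'a word set \<Rightarrow> 'b word set \<Rightarrow> 'a + 'b \<Rightarrow> ('a + 'b) word set" where
  "twist_gen a b v = (case v of
      Inl u \<Rightarrow> I1.incl (a \<otimes>\<^bsub>G1\<^esub> raag_gen \<Gamma>1 u \<otimes>\<^bsub>G1\<^esub> inv\<^bsub>G1\<^esub> a)
    | Inr u \<Rightarrow> I2.incl (b \<otimes>\<^bsub>G2\<^esub> raag_gen \<Gamma>2 u \<otimes>\<^bsub>G2\<^esub> inv\<^bsub>G2\<^esub> b))"

definition twist :: "'a word set \<Rightarrow> 'b word set \<Rightarrow> ('a + 'b) word set \<Rightarrow> ('a + 'b) word set" where
  "twist a b = raag_lift \<Gamma> G (twist_gen a b)"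

lemma conj_hom: "group K \<Longrightarrow> a \<in> carrier K \<Longrightarrow> (\<lambda>x. a \<otimes>\<^bsub>K\<^esub> x \<otimes>\<^bsub>K\<^esub> inv\<^bsub>K\<^esub> a) \<in> hom K K"
proof -
  assume K: "group K" and a: "a \<in> carrier K"
  interpret group K by (rule K)
  show ?thesis by (rule homI) (use a in \<open>simp_all add: m_assoc\<close>)
qed

lemma respects_twist:
  assumes a: "a \<in> carrier G1" and b: "b \<in> carrier G2"
  shows "respects_edges \<Gamma> G (twist_gen a b)"
proof (rule respects_edgesI)
  show "twist_gen a b v \<in> carrier G" if "v \<in> pverts \<Gamma>" for v
    using that a b unfolding verts_union by (auto simp: twist_gen_def)
  have comm: "h x \<otimes>\<^bsub>H\<^esub> h y = h y \<otimes>\<^bsub>H\<^esub> h x"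
    if "h \<in> hom K H" "x \<in> carrier K" "y \<in> carrier K" "x \<otimes>\<^bsub>K\<^esub> y = y \<otimes>\<^bsub>K\<^esub> x"
    for h x y and K :: "'k monoid" and H :: "'l monoid"
    using that hom_mult by metis
  have h1: "(\<lambda>x. I1.incl (a \<otimes>\<^bsub>G1\<^esub> x \<otimes>\<^bsub>G1\<^esub> inv\<^bsub>G1\<^esub> a)) \<in> hom G1 G"
    using hom_compose[OF conj_hom[OF group_raag a] I1.incl.homh] by (simp add: o_def)
  have h2: "(\<lambda>x. I2.incl (b \<otimes>\<^bsub>G2\<^esub> x \<otimes>\<^bsub>G2\<^esub> inv\<^bsub>G2\<^esub> b)) \<in> hom G2 G"
    using hom_compose[OF conj_hom[OF group_raag b] I2.incl.homh] by (simp add: o_def)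
  fix v w assume "(v, w) \<in> parcs \<Gamma>"
  then consider x y where "(x, y) \<in> parcs \<Gamma>1" "v = Inl x" "w = Inl y"
    | x y where "(x, y) \<in> parcs \<Gamma>2" "v = Inr x" "w = Inr y"
    by (auto simp: graph_disjoint_union_def)
  then show "twist_gen a b v \<otimes>\<^bsub>G\<^esub> twist_gen a b w = twist_gen a b w \<otimes>\<^bsub>G\<^esub> twist_gen a b v"
  proof cases
    case 1
    note xy = pair_graph_arcsD[OF L.graph 1(1)]
    show ?thesis
      using hom_mult[OF h1, of "raag_gen \<Gamma>1 x" "raag_gen \<Gamma>1 y"]
        hom_mult[OF h1, of "raag_gen \<Gamma>1 y" "raag_gen \<Gamma>1 x"] raag_gen_commute[OF xy(1,2) 1(1)] xy
      by (simp add: 1(2,3) twist_gen_def)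
  next
    case 2
    note xy = pair_graph_arcsD[OF R.graph 2(1)]
    show ?thesis
      using hom_mult[OF h2, of "raag_gen \<Gamma>2 x" "raag_gen \<Gamma>2 y"]
        hom_mult[OF h2, of "raag_gen \<Gamma>2 y" "raag_gen \<Gamma>2 x"] raag_gen_commute[OF xy(1,2) 2(1)] xy
      by (simp add: 2(2,3) twist_gen_def)
  qed
qed

context
  fixes a b
  assumes a: "a \<in> carrier G1" and b: "b \<in> carrier G2"
begin

lemma twist_hom: "twist a b \<in> hom G G"
  unfolding twist_def by (rule raag_lift_hom[OF group_raag respects_twist[OF a b]])

lemma twist_incl1:
  assumes x: "x \<in> carrier G1"
  shows "twist a b (I1.incl x) = I1.incl (a \<otimes>\<^bsub>G1\<^esub> x \<otimes>\<^bsub>G1\<^esub> inv\<^bsub>G1\<^esub> a)"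
proof -
  have h: "twist a b \<circ> I1.incl \<in> hom G1 G" using hom_compose[OF I1.incl.homh twist_hom] .
  have k: "I1.incl \<circ> (\<lambda>x. a \<otimes>\<^bsub>G1\<^esub> x \<otimes>\<^bsub>G1\<^esub> inv\<^bsub>G1\<^esub> a) \<in> hom G1 G"
    using hom_compose[OF conj_hom[OF group_raag a] I1.incl.homh] .
  have "(twist a b \<circ> I1.incl) (raag_gen \<Gamma>1 u) =
      (I1.incl \<circ> (\<lambda>x. a \<otimes>\<^bsub>G1\<^esub> x \<otimes>\<^bsub>G1\<^esub> inv\<^bsub>G1\<^esub> a)) (raag_gen \<Gamma>1 u)" if u: "u \<in> pverts \<Gamma>1" for u
    using raag_lift_gen[OF group_raag respects_twist[OF a b] I1.e_verts[OF u]] u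
    by (simp only: o_apply I1.incl_gen[OF u] twist_def) (simp add: twist_gen_def)
  from raag_hom_eqI[OF group_raag h k this x] show ?thesis by simp
qed

lemma twist_incl2:
  assumes x: "x \<in> carrier G2"
  shows "twist a b (I2.incl x) = I2.incl (b \<otimes>\<^bsub>G2\<^esub> x \<otimes>\<^bsub>G2\<^esub> inv\<^bsub>G2\<^esub> b)"
proof -
  have h: "twist a b \<circ> I2.incl \<in> hom G2 G" using hom_compose[OF I2.incl.homh twist_hom] .
  have k: "I2.incl \<circ> (\<lambda>x. b \<otimes>\<^bsub>G2\<^esub> x \<otimes>\<^bsub>G2\<^esub> inv\<^bsub>G2\<^esub> b) \<in> hom G2 G"
    using hom_compose[OF conj_hom[OF group_raag b] I2.incl.homh] .
  have "(twist a b \<circ> I2.incl) (raag_gen \<Gamma>2 u) =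
      (I2.incl \<circ> (\<lambda>x. b \<otimes>\<^bsub>G2\<^esub> x \<otimes>\<^bsub>G2\<^esub> inv\<^bsub>G2\<^esub> b)) (raag_gen \<Gamma>2 u)" if u: "u \<in> pverts \<Gamma>2" for u
    using raag_lift_gen[OF group_raag respects_twist[OF a b] I2.e_verts[OF u]] u
    by (simp only: o_apply I2.incl_gen[OF u] twist_def) (simp add: twist_gen_def)
  from raag_hom_eqI[OF group_raag h k this x] show ?thesis by simp
qed

end

lemma twist_mult:
  assumes "a \<in> carrier G1" "b \<in> carrier G2" "a' \<in> carrier G1" "b' \<in> carrier G2" and x: "x \<in> carrier G"
  shows "twist (a \<otimes>\<^bsub>G1\<^esub> a') (b \<otimes>\<^bsub>G2\<^esub> b') x = twist a b (twist a' b' x)"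
proof -
  have ab: "a \<otimes>\<^bsub>G1\<^esub> a' \<in> carrier G1" "b \<otimes>\<^bsub>G2\<^esub> b' \<in> carrier G2" using assms by auto
  have c: "twist a b \<circ> twist a' b' \<in> hom G G"
    using hom_compose[OF twist_hom twist_hom] assms by blast
  have "twist (a \<otimes>\<^bsub>G1\<^esub> a') (b \<otimes>\<^bsub>G2\<^esub> b') x = (twist a b \<circ> twist a' b') x"
  proof (rule hom_eqI[OF twist_hom[OF ab] c _ _ x])
    fix y assume y: "y \<in> carrier G1"
    have y': "a' \<otimes>\<^bsub>G1\<^esub> y \<otimes>\<^bsub>G1\<^esub> inv\<^bsub>G1\<^esub> a' \<in> carrier G1" using y assms by simp
    show "twist (a \<otimes>\<^bsub>G1\<^esub> a') (b \<otimes>\<^bsub>G2\<^esub> b') (I1.incl y) = (twist a b \<circ> twist a' b') (I1.incl y)"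
      by (simp only: o_apply twist_incl1[OF ab y] twist_incl1[OF assms(3,4) y]
          twist_incl1[OF assms(1,2) y'] G1.conj_conj[OF assms(1,3) y])
  next
    fix y assume y: "y \<in> carrier G2"
    have y': "b' \<otimes>\<^bsub>G2\<^esub> y \<otimes>\<^bsub>G2\<^esub> inv\<^bsub>G2\<^esub> b' \<in> carrier G2" using y assms by simp
    show "twist (a \<otimes>\<^bsub>G1\<^esub> a') (b \<otimes>\<^bsub>G2\<^esub> b') (I2.incl y) = (twist a b \<circ> twist a' b') (I2.incl y)"
      by (simp only: o_apply twist_incl2[OF ab y] twist_incl2[OF assms(3,4) y]
          twist_incl2[OF assms(1,2) y'] G2.conj_conj[OF assms(2,4) y])
  qed
  then show ?thesis by simp
qed

lemma twist_one:
  assumes x: "x \<in> carrier G"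
  shows "twist \<one>\<^bsub>G1\<^esub> \<one>\<^bsub>G2\<^esub> x = x"
proof -
  have i: "(\<lambda>x. x) \<in> hom G G" by (simp add: hom_def)
  have o: "\<one>\<^bsub>G1\<^esub> \<in> carrier G1" "\<one>\<^bsub>G2\<^esub> \<in> carrier G2" by auto
  show ?thesis
    by (rule hom_eqI[OF twist_hom[OF o] i _ _ x]) (simp_all add: twist_incl1 twist_incl2)
qed

lemma twist_auto:
  assumes a: "a \<in> carrier G1" and b: "b \<in> carrier G2"
  shows "twist a b \<in> auto G"
proof (rule autoI[where h = "twist (inv\<^bsub>G1\<^esub> a) (inv\<^bsub>G2\<^esub> b)"])
  have i: "inv\<^bsub>G1\<^esub> a \<in> carrier G1" "inv\<^bsub>G2\<^esub> b \<in> carrier G2" using a b by auto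
  show "twist a b \<in> hom G G" using twist_hom[OF a b] .
  show "twist a b \<in> extensional (carrier G)" unfolding twist_def by (rule raag_lift_extensional)
  fix x assume x: "x \<in> carrier G"
  show "twist (inv\<^bsub>G1\<^esub> a) (inv\<^bsub>G2\<^esub> b) x \<in> carrier G"
    using hom_in_carrier[OF twist_hom[OF i] x] .
  show "twist a b (twist (inv\<^bsub>G1\<^esub> a) (inv\<^bsub>G2\<^esub> b) x) = x"
    using twist_mult[OF a b i x] twist_one[OF x] a b by simp
  show "twist (inv\<^bsub>G1\<^esub> a) (inv\<^bsub>G2\<^esub> b) (twist a b x) = x"
    using twist_mult[OF i a b x] twist_one[OF x] a b by simp
qed

definition outer_twist :: "'a word set \<times> 'b word set \<Rightarrow> (('a + 'b) word set \<Rightarrow> ('a + 'b) word set) set" where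
  "outer_twist p = Out_class G (twist (fst p) (snd p))"

lemma outer_twist_hom: "group_hom (G1 \<times>\<times> G2) (Out G) outer_twist"
proof -
  have "outer_twist \<in> hom (G1 \<times>\<times> G2) (Out G)"
  proof (rule homI)
    fix p assume p: "p \<in> carrier (G1 \<times>\<times> G2)"
    show "outer_twist p \<in> carrier (Out G)"
      using p twist_auto[of "fst p" "snd p"] by (auto simp: outer_twist_def carrier_Out)
    fix q assume q: "q \<in> carrier (G1 \<times>\<times> G2)"
    obtain a b a' b' where pq: "p = (a, b)" "q = (a', b')" by (cases p; cases q)
    then have c: "a \<in> carrier G1" "b \<in> carrier G2" "a' \<in> carrier G1" "b' \<in> carrier G2" using p q by auto
    have "compose (carrier G) (twist a b) (twist a' b') = twist (a \<otimes>\<^bsub>G1\<^esub> a') (b \<otimes>\<^bsub>G2\<^esub> b')"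
    proof (rule extensionalityI)
      show "twist (a \<otimes>\<^bsub>G1\<^esub> a') (b \<otimes>\<^bsub>G2\<^esub> b') \<in> extensional (carrier G)"
        unfolding twist_def by (rule raag_lift_extensional)
    qed (use twist_mult[OF c] in \<open>auto simp: compose_def\<close>)
    then show "outer_twist (p \<otimes>\<^bsub>G1 \<times>\<times> G2\<^esub> q) = outer_twist p \<otimes>\<^bsub>Out G\<^esub> outer_twist q"
      using G.Out_mult[OF twist_auto twist_auto] c by (simp add: outer_twist_def pq)
  qed
  then show ?thesis
    by (simp add: group_hom_def group_hom_axioms_def G.group_Out DirProd_group group_raag)
qed

text \<open>If \<open>twist a b\<close> is conjugation by \<open>g\<close>, then
  \<open>inv g\<close> times the image of \<open>a\<close> centralizes the first factor and hence
  lies in it, which puts \<open>g\<close> into that factor. The same argument with \<open>b\<close>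
  puts \<open>g\<close> into the second factor, so \<open>g\<close> is trivial. Then
  \<open>a\<close> and \<open>b\<close> are central, hence trivial.\<close>

lemma outer_twist_inj: "inj_on outer_twist (carrier (G1 \<times>\<times> G2))"
proof -
  interpret T: group_hom "G1 \<times>\<times> G2" "Out G" outer_twist by (rule outer_twist_hom)
  show ?thesis
    unfolding T.inj_on_one_iff
  proof (intro allI impI)
    fix p assume p: "p \<in> carrier (G1 \<times>\<times> G2)" and one: "outer_twist p = \<one>\<^bsub>Out G\<^esub>"
    obtain a b where ab: "p = (a, b)" by (cases p)
    then have a: "a \<in> carrier G1" and b: "b \<in> carrier G2" using p by auto
    have "outer_twist p = outer_twist (\<one>\<^bsub>G1\<^esub>, \<one>\<^bsub>G2\<^esub>)" using one T.hom_one by simp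
    then have "Out_class G (twist a b) = Out_class G (twist \<one>\<^bsub>G1\<^esub> \<one>\<^bsub>G2\<^esub>)"
      by (simp add: outer_twist_def ab)
    then obtain g where g: "g \<in> carrier G"
      "\<And>x. x \<in> carrier G \<Longrightarrow> twist a b x = g \<otimes>\<^bsub>G\<^esub> twist \<one>\<^bsub>G1\<^esub> \<one>\<^bsub>G2\<^esub> x \<otimes>\<^bsub>G\<^esub> inv\<^bsub>G\<^esub> g"
      using G.Out_class_eq_iff[OF twist_auto[OF a b] twist_auto[OF G1.one_closed G2.one_closed]] by blast
    have eq: "twist a b x = g \<otimes>\<^bsub>G\<^esub> x \<otimes>\<^bsub>G\<^esub> inv\<^bsub>G\<^esub> g" if "x \<in> carrier G" for x
      using g(2)[OF that] twist_one[OF that] by simp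
    have fixed: "inv\<^bsub>G\<^esub> g \<otimes>\<^bsub>G\<^esub> c \<otimes>\<^bsub>G\<^esub> x = x \<otimes>\<^bsub>G\<^esub> (inv\<^bsub>G\<^esub> g \<otimes>\<^bsub>G\<^esub> c)"
      if "c \<in> carrier G" "x \<in> carrier G" "c \<otimes>\<^bsub>G\<^esub> x \<otimes>\<^bsub>G\<^esub> inv\<^bsub>G\<^esub> c = g \<otimes>\<^bsub>G\<^esub> x \<otimes>\<^bsub>G\<^esub> inv\<^bsub>G\<^esub> g" for c x
    proof -
      have "c \<otimes>\<^bsub>G\<^esub> x = g \<otimes>\<^bsub>G\<^esub> x \<otimes>\<^bsub>G\<^esub> inv\<^bsub>G\<^esub> g \<otimes>\<^bsub>G\<^esub> c"
        using that g(1) by (subst G.inv_solve_right'[symmetric]) auto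
      then show ?thesis using that g(1) by (simp add: G.m_assoc)
    qed
    have 1: "I1.incl (a \<otimes>\<^bsub>G1\<^esub> x \<otimes>\<^bsub>G1\<^esub> inv\<^bsub>G1\<^esub> a) = g \<otimes>\<^bsub>G\<^esub> I1.incl x \<otimes>\<^bsub>G\<^esub> inv\<^bsub>G\<^esub> g"
      if "x \<in> carrier G1" for x using eq[of "I1.incl x"] twist_incl1[OF a b that] that by simp
    have 2: "I2.incl (b \<otimes>\<^bsub>G2\<^esub> x \<otimes>\<^bsub>G2\<^esub> inv\<^bsub>G2\<^esub> b) = g \<otimes>\<^bsub>G\<^esub> I2.incl x \<otimes>\<^bsub>G\<^esub> inv\<^bsub>G\<^esub> g"
      if "x \<in> carrier G2" for x using eq[of "I2.incl x"] twist_incl2[OF a b that] that by simp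
    have "g \<in> I1.F"
    proof -
      obtain u where u: "u \<in> pverts \<Gamma>1" using L.nonempty by blast
      let ?x = "I1.incl (raag_gen \<Gamma>1 u)" and ?c = "I1.incl a"
      have x: "?x \<in> I1.F" "?x \<noteq> \<one>\<^bsub>G\<^esub>" and c: "?c \<in> I1.F"
        using u a raag_gen_not_one[OF I1.e_verts[OF u]] I1.incl_in_factor[of "raag_gen \<Gamma>1 u"]
          I1.incl_in_factor[of a] by (auto simp: I1.incl_gen)
      have "inv\<^bsub>G\<^esub> g \<otimes>\<^bsub>G\<^esub> ?c \<otimes>\<^bsub>G\<^esub> ?x = ?x \<otimes>\<^bsub>G\<^esub> (inv\<^bsub>G\<^esub> g \<otimes>\<^bsub>G\<^esub> ?c)"
        using 1[of "raag_gen \<Gamma>1 u"] u a by (intro fixed) auto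
      from FP.factor_centralizer[OF _ x _ this] have h: "inv\<^bsub>G\<^esub> g \<otimes>\<^bsub>G\<^esub> ?c \<in> I1.F"
        using g(1) a by simp
      have "inv\<^bsub>G\<^esub> g = inv\<^bsub>G\<^esub> g \<otimes>\<^bsub>G\<^esub> ?c \<otimes>\<^bsub>G\<^esub> inv\<^bsub>G\<^esub> ?c" using g(1) a by (simp add: G.m_assoc)
      then have "inv\<^bsub>G\<^esub> g \<in> I1.F" using FP.A.m_closed[OF h FP.A.m_inv_closed[OF c]] by simp
      then show ?thesis using FP.A.m_inv_closed g(1) by fastforce
    qed
    moreover have "g \<in> I2.F"
    proof -
      obtain u where u: "u \<in> pverts \<Gamma>2" using R.nonempty by blast
      let ?x = "I2.incl (raag_gen \<Gamma>2 u)" and ?c = "I2.incl b"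
      have x: "?x \<in> I2.F" "?x \<noteq> \<one>\<^bsub>G\<^esub>" and c: "?c \<in> I2.F"
        using u b raag_gen_not_one[OF I2.e_verts[OF u]] I2.incl_in_factor[of "raag_gen \<Gamma>2 u"]
          I2.incl_in_factor[of b] by (auto simp: I2.incl_gen)
      have "inv\<^bsub>G\<^esub> g \<otimes>\<^bsub>G\<^esub> ?c \<otimes>\<^bsub>G\<^esub> ?x = ?x \<otimes>\<^bsub>G\<^esub> (inv\<^bsub>G\<^esub> g \<otimes>\<^bsub>G\<^esub> ?c)"
        using 2[of "raag_gen \<Gamma>2 u"] u b by (intro fixed) auto
      from FP.factor_centralizer[OF _ x _ this] have h: "inv\<^bsub>G\<^esub> g \<otimes>\<^bsub>G\<^esub> ?c \<in> I2.F"
        using g(1) b by simp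
      have "inv\<^bsub>G\<^esub> g = inv\<^bsub>G\<^esub> g \<otimes>\<^bsub>G\<^esub> ?c \<otimes>\<^bsub>G\<^esub> inv\<^bsub>G\<^esub> ?c" using g(1) b by (simp add: G.m_assoc)
      then have "inv\<^bsub>G\<^esub> g \<in> I2.F" using FP.B.m_closed[OF h FP.B.m_inv_closed[OF c]] by simp
      then show ?thesis using FP.B.m_inv_closed g(1) by fastforce
    qed
    ultimately have g1: "g = \<one>\<^bsub>G\<^esub>" using FP.disjoint by blast
    have "a = \<one>\<^bsub>G1\<^esub>"
    proof (rule L.center_trivial[OF a])
      fix x assume x: "x \<in> carrier G1"
      have "a \<otimes>\<^bsub>G1\<^esub> x \<otimes>\<^bsub>G1\<^esub> inv\<^bsub>G1\<^esub> a = x"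
        using 1[OF x] x a by (intro I1.incl_inj) (simp_all add: g1)
      then show "a \<otimes>\<^bsub>G1\<^esub> x = x \<otimes>\<^bsub>G1\<^esub> a" using a x by (simp add: G1.inv_solve_right')
    qed
    moreover have "b = \<one>\<^bsub>G2\<^esub>"
    proof (rule R.center_trivial[OF b])
      fix x assume x: "x \<in> carrier G2"
      have "b \<otimes>\<^bsub>G2\<^esub> x \<otimes>\<^bsub>G2\<^esub> inv\<^bsub>G2\<^esub> b = x"
        using 2[OF x] x b by (intro I2.incl_inj) (simp_all add: g1)
      then show "b \<otimes>\<^bsub>G2\<^esub> x = x \<otimes>\<^bsub>G2\<^esub> b" using b x by (simp add: G2.inv_solve_right')
    qed
    ultimately show "p = \<one>\<^bsub>G1 \<times>\<times> G2\<^esub>" by (simp add: ab)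
  qed
qed

abbreviation "H \<equiv> outer_twist ` carrier (G1 \<times>\<times> G2)"

lemma subgroup_H: "subgroup H (Out G)"
proof -
  interpret T: group_hom "G1 \<times>\<times> G2" "Out G" outer_twist by (rule outer_twist_hom)
  show ?thesis by (rule T.img_is_subgroup)
qed

lemma H_iso: "(Out G)\<lparr>carrier := H\<rparr> \<cong> G1 \<times>\<times> G2"
proof -
  interpret T: group_hom "G1 \<times>\<times> G2" "Out G" outer_twist by (rule outer_twist_hom)
  have "outer_twist \<in> iso (G1 \<times>\<times> G2) ((Out G)\<lparr>carrier := H\<rparr>)"
    using outer_twist_inj T.homh by (auto simp: iso_def hom_def bij_betw_def)
  then have "G1 \<times>\<times> G2 \<cong> (Out G)\<lparr>carrier := H\<rparr>" by (rule is_isoI)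
  then show ?thesis using group.iso_sym DirProd_group group_raag by blast
qed

section \<open>Finiteness of the index\<close>

definition preserving :: "(('a + 'b) word set \<Rightarrow> ('a + 'b) word set) set" where
  "preserving = {f \<in> auto G. f ` I1.F = I1.F \<and> f ` I2.F = I2.F}"

text \<open>If the restrictions differ by conjugation with \<open>a\<close> on one factor and with
  \<open>b\<close> on the other, then \<open>f\<close> is \<open>twist a b\<close> composed with
  \<open>h\<close>, because both agree on the two factors. The outer classes thus differ by an
  element of \<open>H\<close>.\<close>

lemma coset_preserving_eq:
  assumes f: "f \<in> preserving" and h: "h \<in> preserving"
    and eq: "Out_class G1 (I1.restr f) = Out_class G1 (I1.restr h)"
      "Out_class G2 (I2.restr f) = Out_class G2 (I2.restr h)"
  shows "H #>\<^bsub>Out G\<^esub> Out_class G f = H #>\<^bsub>Out G\<^esub> Out_class G h"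
proof -
  interpret O: group "Out G" by (rule G.group_Out)
  interpret H: subgroup H "Out G" by (rule subgroup_H)
  have fa: "f \<in> auto G" "f ` I1.F = I1.F" "f ` I2.F = I2.F"
    and ha: "h \<in> auto G" "h ` I1.F = I1.F" "h ` I2.F = I2.F"
    using f h by (auto simp: preserving_def)
  have r1: "I1.restr f \<in> auto G1" "I1.restr h \<in> auto G1" using fa ha I1.restr_auto by auto
  have r2: "I2.restr f \<in> auto G2" "I2.restr h \<in> auto G2" using fa ha I2.restr_auto by auto
  obtain a where a: "a \<in> carrier G1"
    "\<And>x. x \<in> carrier G1 \<Longrightarrow> I1.restr f x = a \<otimes>\<^bsub>G1\<^esub> I1.restr h x \<otimes>\<^bsub>G1\<^esub> inv\<^bsub>G1\<^esub> a"
    using eq(1) group.Out_class_eq_iff[OF group_raag r1] by blast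
  obtain b where b: "b \<in> carrier G2"
    "\<And>x. x \<in> carrier G2 \<Longrightarrow> I2.restr f x = b \<otimes>\<^bsub>G2\<^esub> I2.restr h x \<otimes>\<^bsub>G2\<^esub> inv\<^bsub>G2\<^esub> b"
    using eq(2) group.Out_class_eq_iff[OF group_raag r2] by blast
  have "f x = (twist a b \<circ> h) x" if x: "x \<in> carrier G" for x
  proof (rule hom_eqI[OF auto_hom[OF fa(1)] _ _ _ x])
    show "twist a b \<circ> h \<in> hom G G" using hom_compose[OF auto_hom[OF ha(1)] twist_hom[OF a(1) b(1)]] .
    show "f (I1.incl y) = (twist a b \<circ> h) (I1.incl y)" if y: "y \<in> carrier G1" for y
      using I1.incl_restr[OF fa(2) y] I1.incl_restr[OF ha(2) y] a(2)[OF y]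
        twist_incl1[OF a(1) b(1) auto_closed[OF r1(2) y]] by simp
    show "f (I2.incl y) = (twist a b \<circ> h) (I2.incl y)" if y: "y \<in> carrier G2" for y
      using I2.incl_restr[OF fa(3) y] I2.incl_restr[OF ha(3) y] b(2)[OF y]
        twist_incl2[OF a(1) b(1) auto_closed[OF r2(2) y]] by simp
  qed
  then have "f = compose (carrier G) (twist a b) h"
    using auto_extensional[OF fa(1)] by (intro extensionalityI[of f "carrier G"]) (auto simp: compose_def)
  then have "Out_class G f = outer_twist (a, b) \<otimes>\<^bsub>Out G\<^esub> Out_class G h"
    using G.Out_mult[OF twist_auto[OF a(1) b(1)] ha(1)] by (simp add: outer_twist_def)
  moreover have t: "outer_twist (a, b) \<in> H" using a b by auto
  moreover have "Out_class G h \<in> carrier (Out G)" using ha by (auto simp: carrier_Out)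
  ultimately show ?thesis
    using O.coset_mult_assoc[OF H.subset _ , of "outer_twist (a, b)" "Out_class G h"]
      O.coset_join2[OF _ subgroup_H t] H.mem_carrier[OF t] by simp
qed

text \<open>The coset is a function of the pair of outer classes of the restrictions, realised by
  choosing one \<open>h\<close> for each pair, and these pairs range over a finite set.\<close>

lemma finite_preserving_cosets: "finite ((\<lambda>f. H #>\<^bsub>Out G\<^esub> Out_class G f) ` preserving)"
proof -
  let ?k = "\<lambda>f. (Out_class G1 (I1.restr f), Out_class G2 (I2.restr f))"
    and ?c = "\<lambda>f. H #>\<^bsub>Out G\<^esub> Out_class G f"
  have "?k ` preserving \<subseteq> carrier (Out G1) \<times> carrier (Out G2)"
    using I1.restr_auto I2.restr_auto by (auto simp: preserving_def carrier_Out)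
  then have fin: "finite (?k ` preserving)"
    using finite_subset L.finite_Out R.finite_Out by blast
  have "?c f = ?c (SOME h. h \<in> preserving \<and> ?k h = ?k f)" if f: "f \<in> preserving" for f
  proof -
    have "(SOME h. h \<in> preserving \<and> ?k h = ?k f) \<in> preserving \<and>
        ?k (SOME h. h \<in> preserving \<and> ?k h = ?k f) = ?k f"
      by (rule someI[of "\<lambda>h. h \<in> preserving \<and> ?k h = ?k f" f]) (use f in simp)
    then show ?thesis using f by (intro coset_preserving_eq) auto
  qed
  then have "?c ` preserving \<subseteq> (\<lambda>k. ?c (SOME h. h \<in> preserving \<and> ?k h = k)) ` ?k ` preserving"
    by (auto simp: image_image)
  then show ?thesis using finite_subset fin by blast
qed

lemma class_of_preserving:
  assumes f: "f \<in> auto G" and g: "g \<in> carrier G" "f ` I1.F = conj_set G g I1.F"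
    and h: "h \<in> carrier G" "f ` I2.F = conj_set G h I2.F"
  shows "\<exists>f'\<in>preserving. Out_class G f' = Out_class G f"
proof -
  obtain k where k: "k \<in> carrier G" "conj_set G k (f ` I1.F) = I1.F" "conj_set G k (f ` I2.F) = I2.F"
    using FP.normalize_automorphism[OF f g h factors_nontrivial(2)] by blast
  let ?c = "\<lambda>x\<in>carrier G. k \<otimes>\<^bsub>G\<^esub> x \<otimes>\<^bsub>G\<^esub> inv\<^bsub>G\<^esub> k"
  let ?f = "compose (carrier G) ?c f"
  have fa: "?f \<in> auto G" using G.compose_auto[OF G.conj_in_auto[OF k(1)] f] .
  have val: "?f x = k \<otimes>\<^bsub>G\<^esub> f x \<otimes>\<^bsub>G\<^esub> inv\<^bsub>G\<^esub> k" if "x \<in> carrier G" for x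
    using that auto_closed[OF f] by (simp add: compose_def)
  have im: "?f ` F = conj_set G k (f ` F)" if "F \<subseteq> carrier G" for F
    using that val unfolding conj_set_def image_image by (intro image_cong) auto
  have "Out_class G ?f = Out_class G f"
    using G.Out_class_eq_iff[OF fa f] val k(1) by blast
  moreover have "?f \<in> preserving"
    using fa im[OF FP.A.subset] im[OF FP.B.subset] k by (simp add: preserving_def)
  ultimately show ?thesis by blast
qed

text \<open>The composite of \<open>f\<close> with the inverse of \<open>s\<close> exchanges the
  conjugacy classes of the factors twice, so it maps each factor onto a conjugate of itself. Up to
  an inner automorphism it then lies in \<open>preserving\<close>.\<close>

lemma swap_compose:
  assumes f: "f \<in> auto G" "f ` I1.F = conj_set G g I2.F" "f ` I2.F = conj_set G h I1.F"
    and s: "s \<in> auto G" "s ` I1.F = conj_set G g' I2.F" "s ` I2.F = conj_set G h' I1.F"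
    and c: "g \<in> carrier G" "h \<in> carrier G" "g' \<in> carrier G" "h' \<in> carrier G"
  shows "\<exists>d\<in>preserving. Out_class G f = Out_class G d \<otimes>\<^bsub>Out G\<^esub> Out_class G s"
proof -
  note sub = FP.A.subset FP.B.subset
  obtain r where r: "r \<in> auto G" "\<And>x. x \<in> carrier G \<Longrightarrow> r (s x) = x" "\<And>x. x \<in> carrier G \<Longrightarrow> s (r x) = x"
    using G.auto_inverse[OF s(1)] by blast
  interpret f: group_hom G G f by (rule G.auto_group_hom[OF f(1)])
  interpret r: group_hom G G r by (rule G.auto_group_hom[OF r(1)])
  have rs: "r ` s ` X = X" if "X \<subseteq> carrier G" for X
    using that r(2) image_cong[of X X "\<lambda>x. r (s x)" "\<lambda>x. x"] unfolding image_image by (simp add: subset_iff)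
  have sc: "s ` X \<subseteq> carrier G" if "X \<subseteq> carrier G" for X
    using that auto_closed[OF s(1)] by auto
  have r2: "r ` I2.F = conj_set G (r (inv\<^bsub>G\<^esub> g')) I1.F"
    using FP.conj_set_inverse[OF c(3) sub(2) s(2)] G.hom_conj_set[OF r(1) _ sc[OF sub(1)], of "inv\<^bsub>G\<^esub> g'"]
      rs[OF sub(1)] c by simp
  have r1: "r ` I1.F = conj_set G (r (inv\<^bsub>G\<^esub> h')) I2.F"
    using FP.conj_set_inverse[OF c(4) sub(1) s(3)] G.hom_conj_set[OF r(1) _ sc[OF sub(2)], of "inv\<^bsub>G\<^esub> h'"]
      rs[OF sub(2)] c by simp
  let ?d = "compose (carrier G) f r"
  have d: "?d \<in> auto G" using G.compose_auto[OF f(1) r(1)] .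
  have im: "?d ` X = f ` r ` X" if "X \<subseteq> carrier G" for X
    using that unfolding image_image by (intro image_cong) (auto simp: compose_def)
  have rc: "r (inv\<^bsub>G\<^esub> h') \<in> carrier G" "r (inv\<^bsub>G\<^esub> g') \<in> carrier G" using c by auto
  have d1: "?d ` I1.F = conj_set G (f (r (inv\<^bsub>G\<^esub> h')) \<otimes>\<^bsub>G\<^esub> h) I1.F"
    using im[OF sub(1)] r1 G.hom_conj_set[OF f(1) rc(1) sub(2)] f(3)
      G.conj_set_mult[OF f.hom_closed[OF rc(1)] c(2) sub(1)] by simp
  have d2: "?d ` I2.F = conj_set G (f (r (inv\<^bsub>G\<^esub> g')) \<otimes>\<^bsub>G\<^esub> g) I2.F"
    using im[OF sub(2)] r2 G.hom_conj_set[OF f(1) rc(2) sub(1)] f(2)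
      G.conj_set_mult[OF f.hom_closed[OF rc(2)] c(1) sub(2)] by simp
  obtain d' where d': "d' \<in> preserving" "Out_class G d' = Out_class G ?d"
    using class_of_preserving[OF d _ d1 _ d2] rc c by auto
  have "compose (carrier G) ?d s = f"
    using auto_extensional[OF f(1)] auto_closed[OF s(1)] r(2)
    by (intro extensionalityI[of _ "carrier G"]) (auto simp: compose_def)
  then have "Out_class G f = Out_class G d' \<otimes>\<^bsub>Out G\<^esub> Out_class G s"
    using G.Out_mult[OF d s(1)] d'(2) by simp
  then show ?thesis using d' by blast
qed

lemma finite_index_H: "finite (rcosets\<^bsub>Out G\<^esub> H)"
proof -
  interpret O: group "Out G" by (rule G.group_Out)
  let ?K = "(\<lambda>f. H #>\<^bsub>Out G\<^esub> Out_class G f) ` preserving"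
  let ?swap = "\<lambda>s. s \<in> auto G \<and> (\<exists>g\<in>carrier G. \<exists>h\<in>carrier G.
    s ` I1.F = conj_set G g I2.F \<and> s ` I2.F = conj_set G h I1.F)"
  \<comment> \<open>If no automorphism exchanges the factors, \<open>s\<close> is an arbitrary
    value; only the first case below then occurs.\<close>
  define s where "s = (SOME s. ?swap s)"
  have Hs: "H \<subseteq> carrier (Out G)" by (rule subgroup.subset[OF subgroup_H])
  have "H #>\<^bsub>Out G\<^esub> Out_class G f \<in> ?K \<union> (\<lambda>C. C #>\<^bsub>Out G\<^esub> Out_class G s) ` ?K" if f: "f \<in> auto G" for f
  proof -
    have ell: "\<exists>F'\<in>{I1.F, I2.F}. \<exists>g\<in>carrier G. k ` F \<subseteq> conj_set G g F'"
      if "k \<in> auto G" "F \<in> {I1.F, I2.F}" for k F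
      using that(2) I1.factor_elliptic[OF FP.free_product_axioms L.rigid_graph_axioms that(1)]
        I2.factor_elliptic[OF FP.free_product_axioms R.rigid_graph_axioms that(1)] by auto
    obtain g h where gh: "g \<in> carrier G" "h \<in> carrier G"
      "f ` I1.F = conj_set G g I1.F \<and> f ` I2.F = conj_set G h I2.F \<or>
       f ` I1.F = conj_set G g I2.F \<and> f ` I2.F = conj_set G h I1.F"
      using FP.automorphism_permutes_factors[OF factors_nontrivial ell f] by metis
    from gh(3) show ?thesis
    proof
      assume "f ` I1.F = conj_set G g I1.F \<and> f ` I2.F = conj_set G h I2.F"
      then obtain f' where "f' \<in> preserving" "Out_class G f' = Out_class G f"
        using class_of_preserving[OF f gh(1) _ gh(2)] by blast
      then have "H #>\<^bsub>Out G\<^esub> Out_class G f \<in> ?K" by (metis imageI)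
      then show ?thesis by blast
    next
      assume sw: "f ` I1.F = conj_set G g I2.F \<and> f ` I2.F = conj_set G h I1.F"
      then have "?swap f" by (intro conjI f bexI[of _ g] bexI[of _ h] gh(1,2)) simp_all
      then have "?swap s" unfolding s_def by (rule someI[of ?swap])
      then obtain g' h' where s: "s \<in> auto G" "g' \<in> carrier G" "h' \<in> carrier G"
        "s ` I1.F = conj_set G g' I2.F" "s ` I2.F = conj_set G h' I1.F" by blast
      obtain d where d: "d \<in> preserving" "Out_class G f = Out_class G d \<otimes>\<^bsub>Out G\<^esub> Out_class G s"
        using swap_compose[OF f _ _ s(1,4,5) gh(1,2) s(2,3)] sw by blast
      have "Out_class G d \<in> carrier (Out G)" "Out_class G s \<in> carrier (Out G)"
        using d(1) s(1) by (auto simp: carrier_Out preserving_def)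
      then have "H #>\<^bsub>Out G\<^esub> Out_class G f = H #>\<^bsub>Out G\<^esub> Out_class G d #>\<^bsub>Out G\<^esub> Out_class G s"
        using O.coset_mult_assoc[OF Hs] d(2) by simp
      then show ?thesis using d(1) by blast
    qed
  qed
  then have "rcosets\<^bsub>Out G\<^esub> H \<subseteq> ?K \<union> (\<lambda>C. C #>\<^bsub>Out G\<^esub> Out_class G s) ` ?K"
    unfolding RCOSETS_def carrier_Out by blast
  then show ?thesis
    using finite_subset finite_preserving_cosets by blast
qed

end

section \<open>Joins\<close>

text \<open>The two inclusions commute elementwise since the join contains every edge across, so
  multiplying them gives a homomorphism from the direct product. The two retractions recover the
  coordinates, because each one kills the other factor; every vertex lies in the image.\<close>

lemma raag_join_iso:
  assumes g1: "pair_graph \<Gamma>1" and g2: "pair_graph \<Gamma>2"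
  shows "raag \<Gamma>1 \<times>\<times> raag \<Gamma>2 \<cong> raag (graph_join \<Gamma>1 \<Gamma>2)"
proof -
  let ?\<Delta> = "graph_join \<Gamma>1 \<Gamma>2" and ?G1 = "raag \<Gamma>1" and ?G2 = "raag \<Gamma>2"
  let ?D = "raag ?\<Delta>"
  have gr: "pair_graph ?\<Delta>" by (rule pair_graph_join[OF g1 g2])
  have verts: "pverts ?\<Delta> = Inl ` pverts \<Gamma>1 \<union> Inr ` pverts \<Gamma>2"
    by (auto simp: graph_join_def graph_disjoint_union_def)
  interpret D: group ?D by (rule group_raag)
  interpret I: full_subgraph \<Gamma>1 ?\<Delta> Inl
    by (rule full_subgraph.intro) (use g1 gr in \<open>auto simp: graph_join_def graph_disjoint_union_def\<close>)
  interpret J: full_subgraph \<Gamma>2 ?\<Delta> Inr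
    by (rule full_subgraph.intro) (use g2 gr in \<open>auto simp: graph_join_def graph_disjoint_union_def\<close>)
  \<comment> \<open>Commutation is propagated from vertices to elements one factor at a
    time.\<close>
  have comm_gen: "raag_gen ?\<Delta> (Inr w) \<otimes>\<^bsub>?D\<^esub> I.incl x = I.incl x \<otimes>\<^bsub>?D\<^esub> raag_gen ?\<Delta> (Inr w)"
    if w: "w \<in> pverts \<Gamma>2" and x: "x \<in> carrier ?G1" for w x
    using x
  proof (induction rule: raag_induct)
    case one
    then show ?case using J.e_verts[OF w] by simp
  next
    case (gen v x)
    have "(Inr w, Inl v) \<in> parcs ?\<Delta>" using w gen(1) by (auto simp: graph_join_def)
    then show ?case
      using gen raag_gen_commute[OF J.e_verts[OF w] I.e_verts[OF gen(1)]] J.e_verts[OF w] I.e_verts[OF gen(1)]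
        D.mult_commute_mult[of "raag_gen ?\<Delta> (Inr w)" "raag_gen ?\<Delta> (Inl v)" "I.incl x"]
      by (simp add: I.incl_gen)
  next
    case (inv v x)
    have "(Inr w, Inl v) \<in> parcs ?\<Delta>" using w inv(1) by (auto simp: graph_join_def)
    then show ?case
      using inv raag_gen_commute[OF J.e_verts[OF w] I.e_verts[OF inv(1)]] J.e_verts[OF w] I.e_verts[OF inv(1)]
        D.mult_commute_mult[of "raag_gen ?\<Delta> (Inr w)" "inv\<^bsub>?D\<^esub> raag_gen ?\<Delta> (Inl v)" "I.incl x"]
        D.commute_inv[of "raag_gen ?\<Delta> (Inr w)" "raag_gen ?\<Delta> (Inl v)"]
      by (simp add: I.incl_gen)
  qed
  have comm: "I.incl x \<otimes>\<^bsub>?D\<^esub> J.incl y = J.incl y \<otimes>\<^bsub>?D\<^esub> I.incl x"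
    if x: "x \<in> carrier ?G1" and y: "y \<in> carrier ?G2" for x y
    using y
  proof (induction rule: raag_induct)
    case one
    then show ?case using x by simp
  next
    case (gen w y)
    then show ?case
      using x comm_gen[OF gen(1) x] J.e_verts[OF gen(1)]
        D.mult_commute_mult[of "I.incl x" "raag_gen ?\<Delta> (Inr w)" "J.incl y"]
      by (simp add: J.incl_gen)
  next
    case (inv w y)
    then show ?case
      using x comm_gen[OF inv(1) x] J.e_verts[OF inv(1)]
        D.mult_commute_mult[of "I.incl x" "inv\<^bsub>?D\<^esub> raag_gen ?\<Delta> (Inr w)" "J.incl y"]
        D.commute_inv[of "I.incl x" "raag_gen ?\<Delta> (Inr w)"]
      by (simp add: J.incl_gen)
  qed
  have retr_J: "I.retr (J.incl y) = \<one>\<^bsub>?G1\<^esub>" if y: "y \<in> carrier ?G2" for y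
  proof -
    have "I.retr (raag_gen ?\<Delta> (Inr w)) = \<one>\<^bsub>?G1\<^esub>" if "w \<in> pverts \<Gamma>2" for w
      by (rule I.retr_gen_outside[OF J.e_verts[OF that]]) blast
    with y show ?thesis by (induction rule: raag_induct) (simp_all add: J.incl_gen J.e_verts)
  qed
  have retr_I: "J.retr (I.incl x) = \<one>\<^bsub>?G2\<^esub>" if x: "x \<in> carrier ?G1" for x
  proof -
    have "J.retr (raag_gen ?\<Delta> (Inl v)) = \<one>\<^bsub>?G2\<^esub>" if "v \<in> pverts \<Gamma>1" for v
      by (rule J.retr_gen_outside[OF I.e_verts[OF that]]) blast
    with x show ?thesis by (induction rule: raag_induct) (simp_all add: I.incl_gen I.e_verts)
  qed
  define \<psi> where "\<psi> p = I.incl (fst p) \<otimes>\<^bsub>?D\<^esub> J.incl (snd p)" for p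
  have hom: "\<psi> \<in> hom (?G1 \<times>\<times> ?G2) ?D"
  proof (rule homI)
    show "\<psi> p \<in> carrier ?D" if "p \<in> carrier (?G1 \<times>\<times> ?G2)" for p using that by (auto simp: \<psi>_def)
    fix p q assume "p \<in> carrier (?G1 \<times>\<times> ?G2)" "q \<in> carrier (?G1 \<times>\<times> ?G2)"
    then obtain x y x' y' where pq: "p = (x, y)" "q = (x', y')" and c: "x \<in> carrier ?G1" "y \<in> carrier ?G2"
      "x' \<in> carrier ?G1" "y' \<in> carrier ?G2" by auto
    have "I.incl x \<otimes>\<^bsub>?D\<^esub> I.incl x' \<otimes>\<^bsub>?D\<^esub> (J.incl y \<otimes>\<^bsub>?D\<^esub> J.incl y') =
        I.incl x \<otimes>\<^bsub>?D\<^esub> (I.incl x' \<otimes>\<^bsub>?D\<^esub> J.incl y) \<otimes>\<^bsub>?D\<^esub> J.incl y'"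
      using c by (simp add: D.m_assoc)
    also have "\<dots> = I.incl x \<otimes>\<^bsub>?D\<^esub> J.incl y \<otimes>\<^bsub>?D\<^esub> (I.incl x' \<otimes>\<^bsub>?D\<^esub> J.incl y')"
      unfolding comm[OF c(3,2)] using c by (simp add: D.m_assoc)
    finally show "\<psi> (p \<otimes>\<^bsub>?G1 \<times>\<times> ?G2\<^esub> q) = \<psi> p \<otimes>\<^bsub>?D\<^esub> \<psi> q"
      using c by (simp add: \<psi>_def pq)
  qed
  have "inj_on \<psi> (carrier (?G1 \<times>\<times> ?G2))"
  proof (rule inj_on_inverseI[where g = "\<lambda>z. (I.retr z, J.retr z)"])
    fix p assume "p \<in> carrier (?G1 \<times>\<times> ?G2)"
    then obtain x y where "p = (x, y)" and c: "x \<in> carrier ?G1" "y \<in> carrier ?G2" by auto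
    then show "(I.retr (\<psi> p), J.retr (\<psi> p)) = p"
      by (simp add: \<psi>_def I.retr_incl J.retr_incl retr_I retr_J)
  qed
  moreover have "\<exists>p\<in>carrier (?G1 \<times>\<times> ?G2). \<psi> p = z" if z: "z \<in> carrier ?D" for z
    using z
  proof (induction rule: raag_induct)
    case one
    show ?case by (intro bexI[of _ "(\<one>\<^bsub>?G1\<^esub>, \<one>\<^bsub>?G2\<^esub>)"]) (auto simp: \<psi>_def)
  next
    case (gen v z)
    then obtain x y where c: "x \<in> carrier ?G1" "y \<in> carrier ?G2" "\<psi> (x, y) = z" by auto
    have "\<exists>q\<in>carrier (?G1 \<times>\<times> ?G2). \<psi> q = raag_gen ?\<Delta> v"
    proof (cases v)
      case (Inl u)
      then have "u \<in> pverts \<Gamma>1" using gen(1) verts by auto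
      then show ?thesis using I.e_verts
        by (intro bexI[of _ "(raag_gen \<Gamma>1 u, \<one>\<^bsub>?G2\<^esub>)"]) (auto simp: \<psi>_def Inl I.incl_gen)
    next
      case (Inr u)
      then have "u \<in> pverts \<Gamma>2" using gen(1) verts by auto
      then show ?thesis using J.e_verts
        by (intro bexI[of _ "(\<one>\<^bsub>?G1\<^esub>, raag_gen \<Gamma>2 u)"]) (auto simp: \<psi>_def Inr J.incl_gen)
    qed
    then show ?case using hom_mult[OF hom] gen(3) group.is_monoid[OF DirProd_group[OF group_raag group_raag]]
      by (metis monoid.m_closed)
  next
    case (inv v z)
    have "\<exists>q\<in>carrier (?G1 \<times>\<times> ?G2). \<psi> q = inv\<^bsub>?D\<^esub> raag_gen ?\<Delta> v"
    proof (cases v)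
      case (Inl u)
      then have "u \<in> pverts \<Gamma>1" using inv(1) verts by auto
      then show ?thesis using I.e_verts
        by (intro bexI[of _ "(inv\<^bsub>?G1\<^esub> raag_gen \<Gamma>1 u, \<one>\<^bsub>?G2\<^esub>)"]) (auto simp: \<psi>_def Inl I.incl_gen)
    next
      case (Inr u)
      then have "u \<in> pverts \<Gamma>2" using inv(1) verts by auto
      then show ?thesis using J.e_verts
        by (intro bexI[of _ "(\<one>\<^bsub>?G1\<^esub>, inv\<^bsub>?G2\<^esub> raag_gen \<Gamma>2 u)"]) (auto simp: \<psi>_def Inr J.incl_gen)
    qed
    then show ?case using hom_mult[OF hom] inv(3) group.is_monoid[OF DirProd_group[OF group_raag group_raag]]
      by (metis monoid.m_closed)
  qed
  then have "\<psi> ` carrier (?G1 \<times>\<times> ?G2) = carrier ?D"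
    using hom by (auto simp: hom_def)
  ultimately have "\<psi> \<in> iso (?G1 \<times>\<times> ?G2) ?D"
    using hom by (simp add: iso_def bij_betw_def)
  then show ?thesis by (rule is_isoI)
qed

theorem lemma1p1:
  fixes \<Gamma>1 :: "'a pair_pre_digraph" and \<Gamma>2 :: "'b pair_pre_digraph"
  assumes "pair_graph \<Gamma>1" and "pair_graph \<Gamma>2"
    and "\<not> cyclic_group (raag \<Gamma>1)" and "\<not> cyclic_group (raag \<Gamma>2)"
    and "finite (carrier (Out (raag \<Gamma>1)))" and "finite (carrier (Out (raag \<Gamma>2)))"
  defines "\<Gamma> \<equiv> graph_disjoint_union \<Gamma>1 \<Gamma>2" and "\<Delta> \<equiv> graph_join \<Gamma>1 \<Gamma>2"
  shows "(\<exists>H. subgroup H (Out (raag \<Gamma>))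
            \<and> finite (rcosets\<^bsub>Out (raag \<Gamma>)\<^esub> H)
            \<and> (Out (raag \<Gamma>))\<lparr>carrier := H\<rparr> \<cong> raag \<Gamma>1 \<times>\<times> raag \<Gamma>2)
         \<and> raag \<Gamma>1 \<times>\<times> raag \<Gamma>2 \<cong> raag \<Delta>"
proof -
  interpret rigid_pair \<Gamma>1 \<Gamma>2 using assms by (simp add: rigid_pair_def rigid_graph_def)
  show ?thesis
    unfolding assms(7,8)
    using subgroup_H finite_index_H H_iso raag_join_iso[OF assms(1,2)] by blast
qed

end
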